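(* Let $r\ge2$, $\zeta$ a primitive $r$-th root of unity, and $n\ge0$. Let $RP_{r,n}$ be the set of partitions of $n$ in which each part has multiplicity less than $r$, and $CP_{r,n}$ the set of partitions of $n$ with no part divisible by $r$. Let $M=M({Q'}^{(r)},p^{(r)})$ be the square matrix (rows indexed by $RP_{r,n}$, columns by $CP_{r,n}$, in any fixed orders) defined by ${Q'}^{(r)}_\lambda(x;\zeta)=\sum_{\rho\in CP_{r,n}}M_{\lambda\rho}\,p_\rho(x)$ for $\lambda\in RP_{r,n}$. Then $\det M\in\mathbb{R}$ and $$\det M=\pm\frac{1}{r^{c_{r,n}}\prod_{\rho\in CP_{r,n}}\prod_{i\ge1}\rho_i},$$ where $c_{r,n}=\sum_{j\ge1,\ r\nmid j}\ \sum_{k\ge0}k\,W_{r,r^kj,n}$ with $W_{r,s,n}=\sum_{\rho\in CP_{r,n}}|\{i\ge1\mid m_i(\rho)\ge s\}|$ ($m_i(\rho)$ the multiplicity of $i$ in $\rho$).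
   Context: $P_\lambda(x;t)$ is the Hall–Littlewood $P$-function; $Q'_\lambda(x;t)$ is the basis dual to $(P_\lambda(x;t))$ for the Hall inner product $\langle p_\lambda,p_\mu\rangle_0=z_\lambda\delta_{\lambda\mu}$, specialized at $t=\zeta$. For a symmetric function $f$, $f^{(r)}$ denotes $f$ with the power sums $p_r,p_{2r},p_{3r},\dots$ set to $0$. $p_\rho=p_{\rho_1}p_{\rho_2}\cdots$. Note $|RP_{r,n}|=|CP_{r,n}|$, and the sign $\pm$ reflects the choice of orderings. Equivalently $\sum_n c_{r,n}q^n=\prod_{k\ge1, r\nmid k}(1-q^k)^{-1}\sum_{k\ge1}\frac{q^{rk}}{1-q^{rk}}$. *)

theory Defs
  imports
    Complex_Main
    "HOL-Library.Multiset"
    "HOL-Library.Poly_Mapping"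
    "HOL-Combinatorics.Permutations"
    "HOL-Computational_Algebra.Polynomial_Factorial"
    "Jordan_Normal_Form.Determinant"
begin

section \<open>The ring of symmetric functions\<close>

text \<open>
  A monomial in the variables \<open>x\<^sub>0, x\<^sub>1, \<dots>\<close> is its exponent vector, of type
  \<^typ>\<open>nat \<Rightarrow>\<^sub>0 nat\<close>.  A symmetric function is a formal power series of bounded degree in
  these infinitely many variables that is invariant under permutations of the variables.
\<close>

definition mon_degree :: "(nat \<Rightarrow>\<^sub>0 nat) \<Rightarrow> nat" where
  "mon_degree \<alpha> = (\<Sum>i\<in>Poly_Mapping.keys \<alpha>. Poly_Mapping.lookup \<alpha> i)"

definition bounded_degree :: "((nat \<Rightarrow>\<^sub>0 nat) \<Rightarrow> 'a::zero) \<Rightarrow> bool" where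
  "bounded_degree f \<longleftrightarrow> (\<exists>d. \<forall>\<alpha>. f \<alpha> \<noteq> 0 \<longrightarrow> mon_degree \<alpha> \<le> d)"

definition perm_invariant :: "((nat \<Rightarrow>\<^sub>0 nat) \<Rightarrow> 'a) \<Rightarrow> bool" where
  "perm_invariant f \<longleftrightarrow> (\<forall>\<pi> \<alpha>. bij \<pi> \<longrightarrow> f (Poly_Mapping.map_key \<pi> \<alpha>) = f \<alpha>)"

typedef (overloaded) 'a symfun =
  "{f :: (nat \<Rightarrow>\<^sub>0 nat) \<Rightarrow> 'a::zero. bounded_degree f \<and> perm_invariant f}"
  morphisms mcoeff Abs_symfun
  by (rule exI[of _ "\<lambda>_. 0"]) (simp add: bounded_degree_def perm_invariant_def)

setup_lifting type_definition_symfun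

lemma symfun_eqI: "(\<And>\<alpha>. mcoeff f \<alpha> = mcoeff g \<alpha>) \<Longrightarrow> f = g"
  by transfer auto

lemma mon_degree_superset:
  "finite A \<Longrightarrow> Poly_Mapping.keys \<alpha> \<subseteq> A \<Longrightarrow> mon_degree \<alpha> = (\<Sum>i\<in>A. Poly_Mapping.lookup \<alpha> i)"
  unfolding mon_degree_def
  by (rule sum.mono_neutral_left) (auto simp: in_keys_iff)

lemma mon_degree_add: "mon_degree (\<alpha> + \<beta>) = mon_degree \<alpha> + mon_degree \<beta>"
proof -
  let ?A = "Poly_Mapping.keys \<alpha> \<union> Poly_Mapping.keys \<beta>"
  have "mon_degree (\<alpha> + \<beta>) = (\<Sum>i\<in>?A. Poly_Mapping.lookup (\<alpha> + \<beta>) i)"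
    by (rule mon_degree_superset) (auto simp: Poly_Mapping.keys_add)
  also have "\<dots> = (\<Sum>i\<in>?A. Poly_Mapping.lookup \<alpha> i) + (\<Sum>i\<in>?A. Poly_Mapping.lookup \<beta> i)"
    by (simp add: lookup_add sum.distrib)
  also have "\<dots> = mon_degree \<alpha> + mon_degree \<beta>"
    by (simp add: mon_degree_superset[of ?A])
  finally show ?thesis .
qed

lemma mon_degree_zero [simp]: "mon_degree 0 = 0"
  by (simp add: mon_degree_def)

definition mon_splits :: "(nat \<Rightarrow>\<^sub>0 nat) \<Rightarrow> ((nat \<Rightarrow>\<^sub>0 nat) \<times> (nat \<Rightarrow>\<^sub>0 nat)) set" where
  "mon_splits \<alpha> = {(\<beta>, \<gamma>). \<beta> + \<gamma> = \<alpha>}"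

lemma finite_mon_splits [simp]: "finite (mon_splits \<alpha>)"
proof -
  let ?K = "Poly_Mapping.keys \<alpha>"
  let ?B = "{..Max (insert 0 (Poly_Mapping.lookup \<alpha> ` ?K))}"
  let ?F = "{f :: nat \<Rightarrow> nat. \<forall>x. (x \<in> ?K \<longrightarrow> f x \<in> ?B) \<and> (x \<notin> ?K \<longrightarrow> f x = 0)}"
  have fin: "finite ?F" by (rule finite_set_of_finite_funs) auto
  have le: "Poly_Mapping.lookup \<beta> i \<le> Poly_Mapping.lookup \<alpha> i"
           "Poly_Mapping.lookup \<gamma> i \<le> Poly_Mapping.lookup \<alpha> i" if "\<beta> + \<gamma> = \<alpha>" for \<beta> \<gamma> i
    using that by (auto simp: lookup_add)
  have inF: "f \<in> ?F" if "\<And>i. f i \<le> Poly_Mapping.lookup \<alpha> i" for f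
  proof -
    have "f x \<in> ?B" if "x \<in> ?K" for x
    proof -
      have "Poly_Mapping.lookup \<alpha> x \<le> Max (insert 0 (Poly_Mapping.lookup \<alpha> ` ?K))"
        by (rule Max_ge) (use \<open>x \<in> ?K\<close> in auto)
      then show ?thesis using le_trans[OF \<open>f x \<le> Poly_Mapping.lookup \<alpha> x\<close>] by simp
    qed
    moreover have "f x = 0" if "x \<notin> ?K" for x
      using \<open>f x \<le> Poly_Mapping.lookup \<alpha> x\<close> that by (simp add: in_keys_iff)
    ultimately show ?thesis by blast
  qed
  have "(\<lambda>(\<beta>, \<gamma>). (Poly_Mapping.lookup \<beta>, Poly_Mapping.lookup \<gamma>)) ` mon_splits \<alpha> \<subseteq> ?F \<times> ?F"
    using inF le unfolding mon_splits_def by fastforce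
  then have "finite ((\<lambda>(\<beta>, \<gamma>). (Poly_Mapping.lookup \<beta>, Poly_Mapping.lookup \<gamma>)) ` mon_splits \<alpha>)"
    using fin finite_subset by blast
  moreover have "inj_on (\<lambda>(\<beta>, \<gamma>). (Poly_Mapping.lookup \<beta>, Poly_Mapping.lookup \<gamma>)) (mon_splits \<alpha>)"
    by (auto simp: inj_on_def lookup_inject)
  ultimately show ?thesis by (rule finite_imageD)
qed

lemma mon_splits_zero [simp]: "mon_splits 0 = {(0, 0)}"
proof -
  have "\<beta> = 0 \<and> \<gamma> = 0" if "\<beta> + \<gamma> = 0" for \<beta> \<gamma> :: "nat \<Rightarrow>\<^sub>0 nat"
  proof -
    have "Poly_Mapping.lookup \<beta> i + Poly_Mapping.lookup \<gamma> i = 0" for i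
      using arg_cong[OF that, of "\<lambda>p. Poly_Mapping.lookup p i"] by (simp add: lookup_add)
    then have "\<beta> = 0" "\<gamma> = 0"
      by (simp_all add: poly_mapping_eq_iff fun_eq_iff)
    then show ?thesis ..
  qed
  moreover have "(0::nat \<Rightarrow>\<^sub>0 nat) + 0 = 0" by simp
  ultimately show ?thesis unfolding mon_splits_def by blast
qed

lemma map_key_inverse:
  assumes "bij \<pi>"
  shows "Poly_Mapping.map_key \<pi> (Poly_Mapping.map_key (inv_into UNIV \<pi>) \<alpha>) = \<alpha>"
    and "Poly_Mapping.map_key (inv_into UNIV \<pi>) (Poly_Mapping.map_key \<pi> \<alpha>) = \<alpha>"
proof -
  have i: "inj \<pi>" "inj (inv_into UNIV \<pi>)"
    using assms by (auto simp: bij_is_inj bij_imp_bij_inv)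
  show "Poly_Mapping.map_key \<pi> (Poly_Mapping.map_key (inv_into UNIV \<pi>) \<alpha>) = \<alpha>"
    using i assms by (auto intro!: poly_mapping_eqI simp: map_key.rep_eq inv_f_f)
  show "Poly_Mapping.map_key (inv_into UNIV \<pi>) (Poly_Mapping.map_key \<pi> \<alpha>) = \<alpha>"
    using i assms by (auto intro!: poly_mapping_eqI simp: map_key.rep_eq bij_is_surj surj_f_inv_f)
qed

lemma mon_splits_map_key:
  assumes "bij \<pi>"
  shows "bij_betw (\<lambda>(\<beta>, \<gamma>). (Poly_Mapping.map_key \<pi> \<beta>, Poly_Mapping.map_key \<pi> \<gamma>))
           (mon_splits \<alpha>) (mon_splits (Poly_Mapping.map_key \<pi> \<alpha>))"
proof (rule bij_betw_byWitness
    [where f' = "\<lambda>(\<beta>, \<gamma>). (Poly_Mapping.map_key (inv_into UNIV \<pi>) \<beta>, Poly_Mapping.map_key (inv_into UNIV \<pi>) \<gamma>)"])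
  have i: "inj \<pi>" "inj (inv_into UNIV \<pi>)"
    using assms by (auto simp: bij_is_inj bij_imp_bij_inv)
  show "(\<lambda>(\<beta>, \<gamma>). (Poly_Mapping.map_key \<pi> \<beta>, Poly_Mapping.map_key \<pi> \<gamma>)) ` mon_splits \<alpha>
          \<subseteq> mon_splits (Poly_Mapping.map_key \<pi> \<alpha>)"
    using i by (auto simp: mon_splits_def map_key_plus)
  show "(\<lambda>(\<beta>, \<gamma>). (Poly_Mapping.map_key (inv_into UNIV \<pi>) \<beta>, Poly_Mapping.map_key (inv_into UNIV \<pi>) \<gamma>)) `
          mon_splits (Poly_Mapping.map_key \<pi> \<alpha>) \<subseteq> mon_splits \<alpha>"
  proof clarsimp
    fix \<beta> \<gamma> assume "(\<beta>, \<gamma>) \<in> mon_splits (Poly_Mapping.map_key \<pi> \<alpha>)"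
    then have "\<beta> + \<gamma> = Poly_Mapping.map_key \<pi> \<alpha>" by (simp add: mon_splits_def)
    then have "Poly_Mapping.map_key (inv_into UNIV \<pi>) (\<beta> + \<gamma>) = \<alpha>"
      using map_key_inverse[OF assms] by simp
    then show "(Poly_Mapping.map_key (inv_into UNIV \<pi>) \<beta>, Poly_Mapping.map_key (inv_into UNIV \<pi>) \<gamma>) \<in> mon_splits \<alpha>"
      using i by (simp add: mon_splits_def map_key_plus)
  qed
qed (use map_key_inverse[OF assms] in auto)

instantiation symfun :: (comm_ring_1) comm_ring_1
begin

lift_definition zero_symfun :: "'a symfun" is "\<lambda>_. 0"
  by (simp add: bounded_degree_def perm_invariant_def)

lift_definition one_symfun :: "'a symfun" is "\<lambda>\<alpha>. if \<alpha> = 0 then 1 else 0"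
proof -
  have "Poly_Mapping.map_key \<pi> \<alpha> = 0 \<longleftrightarrow> \<alpha> = 0" if "bij \<pi>" for \<pi> :: "nat \<Rightarrow> nat" and \<alpha> :: "nat \<Rightarrow>\<^sub>0 nat"
    using map_key_inverse[OF that, of \<alpha>] that
    by (metis bij_imp_bij_inv bij_is_inj map_key_zero)
  then show "bounded_degree (\<lambda>\<alpha>. if \<alpha> = 0 then 1 else 0) \<and>
        perm_invariant (\<lambda>\<alpha>. if \<alpha> = 0 then 1 else (0::'a))"
    by (auto simp: bounded_degree_def perm_invariant_def)
qed

lift_definition plus_symfun :: "'a symfun \<Rightarrow> 'a symfun \<Rightarrow> 'a symfun" is "\<lambda>f g \<alpha>. f \<alpha> + g \<alpha>"
proof -
  fix f g :: "(nat \<Rightarrow>\<^sub>0 nat) \<Rightarrow> 'a"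
  assume *: "bounded_degree f \<and> perm_invariant f" "bounded_degree g \<and> perm_invariant g"
  then obtain d e where "\<forall>\<alpha>. f \<alpha> \<noteq> 0 \<longrightarrow> mon_degree \<alpha> \<le> d" "\<forall>\<alpha>. g \<alpha> \<noteq> 0 \<longrightarrow> mon_degree \<alpha> \<le> e"
    unfolding bounded_degree_def by blast
  then have "\<forall>\<alpha>. f \<alpha> + g \<alpha> \<noteq> 0 \<longrightarrow> mon_degree \<alpha> \<le> max d e"
    by (metis add_0 le_max_iff_disj)
  then show "bounded_degree (\<lambda>\<alpha>. f \<alpha> + g \<alpha>) \<and> perm_invariant (\<lambda>\<alpha>. f \<alpha> + g \<alpha>)"
    using * unfolding bounded_degree_def perm_invariant_def by auto
qed

lift_definition uminus_symfun :: "'a symfun \<Rightarrow> 'a symfun" is "\<lambda>f \<alpha>. - f \<alpha>"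
  by (auto simp: bounded_degree_def perm_invariant_def)

definition minus_symfun :: "'a symfun \<Rightarrow> 'a symfun \<Rightarrow> 'a symfun" where
  "minus_symfun f g = f + (- g)"

lift_definition times_symfun :: "'a symfun \<Rightarrow> 'a symfun \<Rightarrow> 'a symfun"
  is "\<lambda>f g \<alpha>. \<Sum>(\<beta>, \<gamma>)\<in>mon_splits \<alpha>. f \<beta> * g \<gamma>"
proof -
  fix f g :: "(nat \<Rightarrow>\<^sub>0 nat) \<Rightarrow> 'a"
  assume *: "bounded_degree f \<and> perm_invariant f" "bounded_degree g \<and> perm_invariant g"
  then obtain d e where de: "\<forall>\<alpha>. f \<alpha> \<noteq> 0 \<longrightarrow> mon_degree \<alpha> \<le> d" "\<forall>\<alpha>. g \<alpha> \<noteq> 0 \<longrightarrow> mon_degree \<alpha> \<le> e"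
    unfolding bounded_degree_def by blast
  have "mon_degree \<alpha> \<le> d + e" if nz: "(\<Sum>(\<beta>, \<gamma>)\<in>mon_splits \<alpha>. f \<beta> * g \<gamma>) \<noteq> 0" for \<alpha>
  proof -
    obtain \<beta> \<gamma> where "\<beta> + \<gamma> = \<alpha>" "f \<beta> * g \<gamma> \<noteq> 0"
      by (rule sum.not_neutral_contains_not_neutral[OF nz]) (auto simp: mon_splits_def)
    then show ?thesis
      using de by (metis add_mono mon_degree_add mult_zero_left mult_zero_right)
  qed
  then have 1: "bounded_degree (\<lambda>\<alpha>. \<Sum>(\<beta>, \<gamma>)\<in>mon_splits \<alpha>. f \<beta> * g \<gamma>)"
    unfolding bounded_degree_def by blast
  have "(\<Sum>(\<beta>, \<gamma>)\<in>mon_splits (Poly_Mapping.map_key \<pi> \<alpha>). f \<beta> * g \<gamma>) =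
        (\<Sum>(\<beta>, \<gamma>)\<in>mon_splits \<alpha>. f \<beta> * g \<gamma>)" if "bij \<pi>" for \<pi> \<alpha>
  proof -
    have "(\<Sum>(\<beta>, \<gamma>)\<in>mon_splits (Poly_Mapping.map_key \<pi> \<alpha>). f \<beta> * g \<gamma>) =
          (\<Sum>(\<beta>, \<gamma>)\<in>mon_splits \<alpha>. f (Poly_Mapping.map_key \<pi> \<beta>) * g (Poly_Mapping.map_key \<pi> \<gamma>))"
      by (subst sum.reindex_bij_betw[OF mon_splits_map_key[OF that], symmetric])
         (simp add: case_prod_unfold)
    also have "\<dots> = (\<Sum>(\<beta>, \<gamma>)\<in>mon_splits \<alpha>. f \<beta> * g \<gamma>)"
      using * that by (simp add: perm_invariant_def)
    finally show ?thesis .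
  qed
  then have 2: "perm_invariant (\<lambda>\<alpha>. \<Sum>(\<beta>, \<gamma>)\<in>mon_splits \<alpha>. f \<beta> * g \<gamma>)"
    unfolding perm_invariant_def by blast
  from 1 2 show "bounded_degree (\<lambda>\<alpha>. \<Sum>(\<beta>, \<gamma>)\<in>mon_splits \<alpha>. f \<beta> * g \<gamma>) \<and>
      perm_invariant (\<lambda>\<alpha>. \<Sum>(\<beta>, \<gamma>)\<in>mon_splits \<alpha>. f \<beta> * g \<gamma>)" ..
qed

instance
proof
  fix a b c :: "'a symfun"
  show "a + b + c = a + (b + c)" by transfer (simp add: add.assoc)
  show "a + b = b + a" by transfer (simp add: add.commute)
  show "0 + a = a" by transfer simp
  show "- a + a = 0" by transfer simp
  show "a - b = a + - b" by (simp add: minus_symfun_def)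
  show "(0::'a symfun) \<noteq> 1"
    by transfer (metis zero_neq_one)
  show "(a + b) * c = a * c + b * c"
    by transfer (simp add: distrib_right sum.distrib case_prod_unfold)
  show "a * b = b * a"
  proof (transfer, rule ext)
    fix a b :: "(nat \<Rightarrow>\<^sub>0 nat) \<Rightarrow> 'a" and \<alpha>
    show "(\<Sum>(\<beta>, \<gamma>)\<in>mon_splits \<alpha>. a \<beta> * b \<gamma>) = (\<Sum>(\<beta>, \<gamma>)\<in>mon_splits \<alpha>. b \<beta> * a \<gamma>)"
      by (rule sum.reindex_bij_witness[of _ prod.swap prod.swap])
         (auto simp: mon_splits_def add.commute mult.commute)
  qed
  show "1 * a = a"
  proof (transfer, rule ext)
    fix a :: "(nat \<Rightarrow>\<^sub>0 nat) \<Rightarrow> 'a" and \<alpha>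
    have "(\<Sum>(\<beta>, \<gamma>)\<in>mon_splits \<alpha>. (if \<beta> = 0 then 1 else 0) * a \<gamma>) =
          (\<Sum>(\<beta>, \<gamma>)\<in>{(0 :: nat \<Rightarrow>\<^sub>0 nat, \<alpha>)}. (if \<beta> = 0 then 1 else 0) * a \<gamma>)"
    proof (rule sum.mono_neutral_right)
      show "{(0, \<alpha>)} \<subseteq> mon_splits \<alpha>" by (simp add: mon_splits_def)
      show "\<forall>p\<in>mon_splits \<alpha> - {(0, \<alpha>)}. (case p of (\<beta>, \<gamma>) \<Rightarrow> (if \<beta> = 0 then 1 else 0) * a \<gamma>) = 0"
        by (auto simp: mon_splits_def split: if_splits)
    qed simp
    then show "(\<Sum>(\<beta>, \<gamma>)\<in>mon_splits \<alpha>. (if \<beta> = 0 then 1 else 0) * a \<gamma>) = a \<alpha>" by simp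
  qed
  show "a * b * c = a * (b * c)"
  proof (transfer, rule ext)
    fix a b c :: "(nat \<Rightarrow>\<^sub>0 nat) \<Rightarrow> 'a" and \<alpha>
    have "(\<Sum>(\<beta>, \<gamma>)\<in>mon_splits \<alpha>. (\<Sum>(\<delta>, \<epsilon>)\<in>mon_splits \<beta>. a \<delta> * b \<epsilon>) * c \<gamma>) =
          (\<Sum>p\<in>mon_splits \<alpha>. \<Sum>q\<in>mon_splits (fst p). a (fst q) * b (snd q) * c (snd p))"
      by (simp add: case_prod_unfold sum_distrib_right)
    also have "\<dots> = (\<Sum>(p, q)\<in>Sigma (mon_splits \<alpha>) (\<lambda>p. mon_splits (fst p)). a (fst q) * b (snd q) * c (snd p))"
      by (rule sum.Sigma) simp_all
    also have "\<dots> = (\<Sum>(p, q)\<in>Sigma (mon_splits \<alpha>) (\<lambda>p. mon_splits (snd p)). a (fst p) * (b (fst q) * c (snd q)))"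
      by (rule sum.reindex_bij_witness
          [of _ "\<lambda>(p, q). ((fst p + fst q, snd q), (fst p, fst q))"
                "\<lambda>(p, q). ((fst q, snd q + snd p), (snd q, snd p))"])
         (auto simp: mon_splits_def add.assoc mult.assoc)
    also have "\<dots> = (\<Sum>p\<in>mon_splits \<alpha>. \<Sum>q\<in>mon_splits (snd p). a (fst p) * (b (fst q) * c (snd q)))"
      by (rule sum.Sigma[symmetric]) simp_all
    also have "\<dots> = (\<Sum>(\<beta>, \<gamma>)\<in>mon_splits \<alpha>. a \<beta> * (\<Sum>(\<delta>, \<epsilon>)\<in>mon_splits \<gamma>. b \<delta> * c \<epsilon>))"
      by (simp add: case_prod_unfold sum_distrib_left)
    finally show "(\<Sum>(\<beta>, \<gamma>)\<in>mon_splits \<alpha>. (\<Sum>(\<delta>, \<epsilon>)\<in>mon_splits \<beta>. a \<delta> * b \<epsilon>) * c \<gamma>) =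
          (\<Sum>(\<beta>, \<gamma>)\<in>mon_splits \<alpha>. a \<beta> * (\<Sum>(\<delta>, \<epsilon>)\<in>mon_splits \<gamma>. b \<delta> * c \<epsilon>))" .
  qed
qed

end

lift_definition sf_scale :: "'a::comm_ring_1 \<Rightarrow> 'a symfun \<Rightarrow> 'a symfun" is "\<lambda>c f \<alpha>. c * f \<alpha>"
proof -
  fix c :: 'a and f :: "(nat \<Rightarrow>\<^sub>0 nat) \<Rightarrow> 'a"
  assume "bounded_degree f \<and> perm_invariant f"
  then show "bounded_degree (\<lambda>\<alpha>. c * f \<alpha>) \<and> perm_invariant (\<lambda>\<alpha>. c * f \<alpha>)"
    unfolding bounded_degree_def perm_invariant_def by (metis mult_zero_right)
qed

interpretation symfun: Modules.module "sf_scale :: 'a::comm_ring_1 \<Rightarrow> 'a symfun \<Rightarrow> 'a symfun"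
proof
  fix a b :: 'a and f g :: "'a symfun"
  show "sf_scale a (f + g) = sf_scale a f + sf_scale a g"
    by transfer (simp add: distrib_left)
  show "sf_scale (a + b) f = sf_scale a f + sf_scale b f"
    by transfer (simp add: distrib_right)
  show "sf_scale a (sf_scale b f) = sf_scale (a * b) f"
    by transfer (simp add: mult.assoc)
  show "sf_scale 1 f = f"
    by transfer simp
qed


section \<open>Partitions\<close>

text \<open>A partition is the finite multiset of its (positive) parts, so \<^term>\<open>count \<mu> i\<close> is the
  multiplicity of \<open>i\<close> in \<open>\<mu>\<close>.\<close>

definition is_partition :: "nat multiset \<Rightarrow> bool" where
  "is_partition \<mu> \<longleftrightarrow> 0 \<notin># \<mu>"

definition partitions_of :: "nat \<Rightarrow> nat multiset set" where
  "partitions_of n = {\<mu>. is_partition \<mu> \<and> \<Sum>\<^sub># \<mu> = n}"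

text \<open>The part \<open>\<lambda>\<^sub>i\<close> in weakly decreasing order, counting from \<open>i = 0\<close> and with \<open>\<lambda>\<^sub>i = 0\<close>
  for \<open>i \<ge> \<ell>(\<lambda>)\<close>.\<close>

definition nth_part :: "nat multiset \<Rightarrow> nat \<Rightarrow> nat" where
  "nth_part \<mu> i = (if i < size \<mu> then rev (sorted_list_of_multiset \<mu>) ! i else 0)"

definition RP :: "nat \<Rightarrow> nat \<Rightarrow> nat multiset set" where
  "RP r n = {\<mu> \<in> partitions_of n. \<forall>i\<in>#\<mu>. count \<mu> i < r}"

definition CP :: "nat \<Rightarrow> nat \<Rightarrow> nat multiset set" where
  "CP r n = {\<rho> \<in> partitions_of n. \<forall>i\<in>#\<rho>. \<not> r dvd i}"

definition W :: "nat \<Rightarrow> nat \<Rightarrow> nat \<Rightarrow> nat" where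
  "W r s n = (\<Sum>\<rho>\<in>CP r n. card {i. i \<ge> 1 \<and> count \<rho> i \<ge> s})"

text \<open>Both sums are over infinite index ranges but have finite support, since \<^term>\<open>W r s n = 0\<close>
  for \<open>s > n\<close>.\<close>

definition c_exp :: "nat \<Rightarrow> nat \<Rightarrow> nat" where
  "c_exp r n = Sum_any (\<lambda>j. if j \<ge> 1 \<and> \<not> r dvd j then Sum_any (\<lambda>k. k * W r (r ^ k * j) n) else 0)"


section \<open>Power sums and the Hall inner product\<close>

lift_definition psum :: "nat \<Rightarrow> 'a::comm_ring_1 symfun"
  is "\<lambda>k \<alpha>. if \<exists>i. \<alpha> = Poly_Mapping.single i k then 1 else 0"
proof
  fix k
  have "mon_degree (Poly_Mapping.single i k) \<le> k" for i
    by (simp add: mon_degree_def)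
  then show "bounded_degree (\<lambda>\<alpha>. if \<exists>i. \<alpha> = Poly_Mapping.single i k then 1 else (0::'a))"
    unfolding bounded_degree_def by (intro exI[of _ k]) auto
  have *: "Poly_Mapping.map_key \<pi> (Poly_Mapping.single i k) = Poly_Mapping.single (inv_into UNIV \<pi> i) k"
    if "bij \<pi>" for \<pi> :: "nat \<Rightarrow> nat" and i
    using that map_key_single[of \<pi> "inv_into UNIV \<pi> i" k]
    by (simp add: bij_is_inj bij_is_surj surj_f_inv_f)
  have "(\<exists>i. Poly_Mapping.map_key \<pi> \<alpha> = Poly_Mapping.single i k) \<longleftrightarrow> (\<exists>i. \<alpha> = Poly_Mapping.single i k)"
    if "bij \<pi>" for \<pi> :: "nat \<Rightarrow> nat" and \<alpha>
  proof
    assume "\<exists>i. Poly_Mapping.map_key \<pi> \<alpha> = Poly_Mapping.single i k"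
    then obtain i where "Poly_Mapping.map_key \<pi> \<alpha> = Poly_Mapping.single i k" ..
    then have "Poly_Mapping.map_key (inv_into UNIV \<pi>) (Poly_Mapping.single i k) = \<alpha>"
      using map_key_inverse(2)[OF that, of \<alpha>] by simp
    then show "\<exists>i. \<alpha> = Poly_Mapping.single i k"
      using *[OF bij_imp_bij_inv[OF that], of i] by auto
  next
    assume "\<exists>i. \<alpha> = Poly_Mapping.single i k"
    then show "\<exists>i. Poly_Mapping.map_key \<pi> \<alpha> = Poly_Mapping.single i k"
      using *[OF that] by auto
  qed
  then show "perm_invariant (\<lambda>\<alpha>. if \<exists>i. \<alpha> = Poly_Mapping.single i k then 1 else (0::'a))"
    unfolding perm_invariant_def by (intro allI impI if_cong refl)
qed

definition pprod :: "nat multiset \<Rightarrow> 'a::comm_ring_1 symfun" where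
  "pprod \<rho> = (\<Prod>k\<in>#\<rho>. psum k)"

text \<open>The coefficient of \<open>p\<^sub>\<mu>\<close> in the expansion of a symmetric function in the basis
  \<open>(p\<^sub>\<mu>)\<close>; this is a basis whenever the coefficient ring contains the rationals.\<close>

definition pcoeff :: "'a::comm_ring_1 symfun \<Rightarrow> nat multiset \<Rightarrow> 'a" where
  "pcoeff f \<mu> = symfun.representation (pprod ` Collect is_partition) f (pprod \<mu>)"

definition zee :: "nat multiset \<Rightarrow> nat" where
  "zee \<mu> = (\<Prod>i\<in>set_mset \<mu>. i ^ count \<mu> i * fact (count \<mu> i))"

text \<open>The bilinear form determined by \<open>\<langle>p\<^sub>\<lambda>, p\<^sub>\<mu>\<rangle> = z\<^sub>\<lambda> \<delta>\<^sub>\<lambda>\<^sub>\<mu>\<close>.\<close>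

definition hall :: "'a::comm_ring_1 symfun \<Rightarrow> 'a symfun \<Rightarrow> 'a" where
  "hall f g = (\<Sum>\<mu> | is_partition \<mu> \<and> pcoeff f \<mu> \<noteq> 0. of_nat (zee \<mu>) * pcoeff f \<mu> * pcoeff g \<mu>)"

text \<open>\<open>f\<^sup>(\<^sup>r\<^sup>)\<close>: write \<open>f\<close> as a polynomial in the power sums and put \<open>p\<^sub>r = p\<^sub>2\<^sub>r = \<dots> = 0\<close>.\<close>

definition p_truncate :: "nat \<Rightarrow> 'a::comm_ring_1 symfun \<Rightarrow> 'a symfun" where
  "p_truncate r f = (\<Sum>\<mu> | is_partition \<mu> \<and> pcoeff f \<mu> \<noteq> 0.
     sf_scale (pcoeff f \<mu>) (\<Prod>k\<in>#\<mu>. if r dvd k then 0 else psum k))"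


section \<open>Hall--Littlewood functions\<close>

text \<open>
  The indeterminate \<open>t\<close> is the variable of \<^typ>\<open>complex poly\<close>, so the generic symmetric functions
  have type \<^typ>\<open>complex poly symfun\<close>.  The Hall--Littlewood polynomial in the finitely many
  variables \<open>x\<^sub>0, \<dots>, x\<^bsub>m-1\<^esub>\<close> is first written as a rational function in \<open>t\<close> and the \<open>x\<^sub>i\<close>:
  \[ P_\lambda(x_0,\dots,x_{m-1};t) = \frac{1}{v_\lambda(t)} \sum_{w \in S_m}
       w\Bigl( x^\lambda \prod_{i<j} \frac{x_i - t x_j}{x_i - x_j} \Bigr), \qquad
     v_\lambda(t) = \prod_{i \ge 0} \prod_{k=1}^{m_i} \frac{1-t^k}{1-t}, \]
  where \<open>m\<^sub>i\<close> is the multiplicity of \<open>i\<close> in \<open>\<lambda>\<close> padded with zeros to length \<open>m\<close>.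
\<close>

type_synonym ratfun = "((nat \<Rightarrow>\<^sub>0 nat) \<Rightarrow>\<^sub>0 complex poly) fract"

definition rf_t :: ratfun where
  "rf_t = to_fract (Poly_Mapping.single 0 [:0, 1:])"

definition rf_x :: "nat \<Rightarrow> ratfun" where
  "rf_x i = to_fract (Poly_Mapping.single (Poly_Mapping.single i 1) 1)"

definition v_fac :: "nat \<Rightarrow> ratfun" where
  "v_fac m = (\<Prod>k=1..m. (1 - rf_t ^ k) / (1 - rf_t))"

definition v_part :: "nat \<Rightarrow> nat multiset \<Rightarrow> ratfun" where
  "v_part m \<mu> = v_fac (m - size \<mu>) * (\<Prod>i\<in>set_mset \<mu>. v_fac (count \<mu> i))"

definition HL_poly :: "nat \<Rightarrow> nat multiset \<Rightarrow> ratfun" where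
  "HL_poly m \<mu> = 1 / v_part m \<mu> *
     (\<Sum>w | w permutes {..<m}.
        (\<Prod>i<m. rf_x (w i) ^ nth_part \<mu> i) *
        (\<Prod>j<m. \<Prod>i<j. (rf_x (w i) - rf_t * rf_x (w j)) / (rf_x (w i) - rf_x (w j))))"

text \<open>The image \<open>f(x\<^sub>0, \<dots>, x\<^bsub>m-1\<^esub>, 0, 0, \<dots>)\<close> of a symmetric function.\<close>

lift_definition sf_restrict :: "nat \<Rightarrow> 'a::zero symfun \<Rightarrow> (nat \<Rightarrow>\<^sub>0 nat) \<Rightarrow>\<^sub>0 'a"
  is "\<lambda>m f \<alpha>. if Poly_Mapping.keys \<alpha> \<subseteq> {..<m} then f \<alpha> else 0"
proof -
  fix m and f :: "(nat \<Rightarrow>\<^sub>0 nat) \<Rightarrow> 'a"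
  assume "bounded_degree f \<and> perm_invariant f"
  then obtain d where d: "\<And>\<alpha>. f \<alpha> \<noteq> 0 \<Longrightarrow> mon_degree \<alpha> \<le> d"
    unfolding bounded_degree_def by blast
  let ?S = "{\<alpha>. (if Poly_Mapping.keys \<alpha> \<subseteq> {..<m} then f \<alpha> else 0) \<noteq> 0}"
  let ?F = "{g :: nat \<Rightarrow> nat. \<forall>x. (x \<in> {..<m} \<longrightarrow> g x \<in> {..d}) \<and> (x \<notin> {..<m} \<longrightarrow> g x = 0)}"
  have "Poly_Mapping.lookup \<alpha> \<in> ?F" if "\<alpha> \<in> ?S" for \<alpha>
  proof -
    have k: "Poly_Mapping.keys \<alpha> \<subseteq> {..<m}" and "f \<alpha> \<noteq> 0"
      using that by (auto split: if_splits)
    then have "(\<Sum>i<m. Poly_Mapping.lookup \<alpha> i) \<le> d"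
      using d mon_degree_superset[OF _ k] by fastforce
    then have "Poly_Mapping.lookup \<alpha> i \<le> d" if "i < m" for i
      using member_le_sum[of i "{..<m}" "Poly_Mapping.lookup \<alpha>"] that by fastforce
    moreover have "Poly_Mapping.lookup \<alpha> i = 0" if "i \<notin> {..<m}" for i
      using k that by (meson in_keys_iff subsetD)
    ultimately show ?thesis by auto
  qed
  then have "Poly_Mapping.lookup ` ?S \<subseteq> ?F" by (rule image_subsetI)
  moreover have "finite ?F" by (rule finite_set_of_finite_funs) auto
  ultimately have "finite (Poly_Mapping.lookup ` ?S)" by (rule finite_subset)
  then show "finite ?S"
    by (rule finite_imageD) (auto simp: inj_on_def lookup_inject)
qed

text \<open>\<open>P\<^sub>\<lambda>(x;t)\<close>, the stable limit of the Hall--Littlewood polynomials.\<close>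

definition HL_P :: "nat multiset \<Rightarrow> complex poly symfun" where
  "HL_P \<mu> = (THE f. \<forall>m\<ge>size \<mu>. to_fract (sf_restrict m f) = HL_poly m \<mu>)"

text \<open>\<open>Q'\<^sub>\<lambda>(x;t)\<close>.  The transition matrix from the \<open>P\<^sub>\<lambda>(x;t)\<close> to the Schur functions is
  unitriangular with entries polynomial in \<open>t\<close>, so the dual basis already exists over
  polynomials in \<open>t\<close>.\<close>

definition HL_Q' :: "nat multiset \<Rightarrow> complex poly symfun" where
  "HL_Q' \<mu> = (THE f. \<forall>\<nu>. is_partition \<nu> \<longrightarrow> hall f (HL_P \<nu>) = (if \<nu> = \<mu> then 1 else 0))"

text \<open>Specialization \<open>t = \<zeta>\<close> of the coefficients.\<close>

lift_definition specialize :: "complex \<Rightarrow> complex poly symfun \<Rightarrow> complex symfun"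
  is "\<lambda>\<zeta> f \<alpha>. poly (f \<alpha>) \<zeta>"
proof -
  fix \<zeta> and f :: "(nat \<Rightarrow>\<^sub>0 nat) \<Rightarrow> complex poly"
  assume "bounded_degree f \<and> perm_invariant f"
  then show "bounded_degree (\<lambda>\<alpha>. poly (f \<alpha>) \<zeta>) \<and> perm_invariant (\<lambda>\<alpha>. poly (f \<alpha>) \<zeta>)"
    unfolding bounded_degree_def perm_invariant_def by auto (metis poly_0)
qed


section \<open>Transition matrices\<close>

text \<open>\<open>M(u, v)\<close> with \<open>u\<^sub>i = \<Sum>\<^sub>j M\<^sub>i\<^sub>j v\<^sub>j\<close>.  It is not required to be square; the library
  determinant of a non-square matrix is \<open>0\<close>.\<close>

definition transition_mat :: "'a::comm_ring_1 symfun list \<Rightarrow> 'a symfun list \<Rightarrow> 'a mat" where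
  "transition_mat us vs = (THE M. M \<in> carrier_mat (length us) (length vs) \<and>
     (\<forall>i<length us. us ! i = (\<Sum>j<length vs. sf_scale (M $$ (i, j)) (vs ! j))))"

definition primitive_root :: "nat \<Rightarrow> complex \<Rightarrow> bool" where
  "primitive_root r \<zeta> \<longleftrightarrow> \<zeta> ^ r = 1 \<and> (\<forall>k. 0 < k \<and> k < r \<longrightarrow> \<zeta> ^ k \<noteq> 1)"

end

theory Submission
  imports Defs "Jordan_Normal_Form.Char_Poly" "HOL-Combinatorics.Multiset_Permutations"
    "HOL-Computational_Algebra.Polynomial_FPS"
begin

text \<open>
  Expand \<open>Q'\<^sub>\<lambda>(x;t) = \<Sum>\<^sub>\<rho> N\<^sub>\<lambda>\<^sub>\<rho> p\<^sub>\<rho>\<close>.  Since \<open>Q\<^sub>\<lambda> = b\<^sub>\<lambda>(t) P\<^sub>\<lambda>\<close> arises from \<open>Q'\<^sub>\<lambda>\<close> by \<open>p\<^sub>k \<mapsto> (1 - t\<^sup>k) p\<^sub>k\<close>,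
  duality of \<open>Q'\<close> and \<open>P\<close> reads \<open>\<Sum>\<^sub>\<rho> N\<^sub>\<lambda>\<^sub>\<rho> N\<^sub>\<mu>\<^sub>\<rho> z\<^sub>\<rho> \<Prod>\<^sub>i (1 - t\<^bsup>\<rho>\<^sub>i\<^esup>) = \<delta>\<^sub>\<lambda>\<^sub>\<mu> b\<^sub>\<lambda>(t)\<close>.  At \<open>t = \<zeta>\<close> only
  the \<open>\<rho>\<close> without parts divisible by \<open>r\<close> survive, and taking determinants expresses \<open>(det M)\<^sup>2\<close> through
  \<open>z\<^sub>\<rho>\<close>, \<open>1 - \<zeta>\<^sup>k\<close> and \<open>b\<^sub>\<lambda>(\<zeta>)\<close>; counting parts modulo \<open>r\<close> and \<open>\<Prod>\<^bsub>0<k<r\<^esub> (1 - \<zeta>\<^sup>k) = r\<close> evaluate the result.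

  The orthogonality is proved with vertex operators.  The operator \<open>E(y) : p\<^sub>k \<mapsto> p\<^sub>k + y\<^sup>k\<close> is adjoint to
  multiplication by the complete symmetric functions, \<open>D(y) : p\<^sub>k \<mapsto> p\<^sub>k - y\<^sup>k\<close> is its inverse, and \<open>Q\<close> satisfies
  \<open>Q\<^bsub>(r,\<nu>)\<^esub> = \<Sum>\<^sub>k q\<^bsub>r+k\<^esub> D\<^sub>k Q\<^sub>\<nu>\<close>.  Evaluating this recursion in finitely many variables by partial fractions
  recovers the symmetrization formula.
\<close>

section \<open>Polynomials in the power sums\<close>

text \<open>\<open>HL_P\<close> is fixed by its symmetrization formula in finitely many variables
  and \<open>HL_Q'\<close> by duality, both through definite descriptions, so an explicit candidate
  must be shown to satisfy each description and to be determined by it. The candidate lives in the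
  free polynomial ring on the power sums, where operators such as p_k -> p_k + y^k are plain
  substitutions; \<open>Psi\<close> identifies the part of this ring without p_0 with the symmetric
  functions.

  The main obstacle is integrality in t: P_lambda = Q_lambda / b_lambda(t) must have coefficients in
  C[t]. This holds because Q' generates every homogeneous component over C[t], so that all pairings
  with Q_lambda are multiples of b_lambda.

  The exponent c_{r,n} enters twice: as the power of r in the product of the m_i(rho)!, and as the
  excess of the factors 1 - zeta^k over those in the b_lambda(zeta). Everything assembles to a
  perfect square, (det M)^2 R^2 = 1 with R = r^c times the product of all parts. Taking the root
  leaves only a sign open and shows that det M is real.\<close>

abbreviation "lookup \<equiv> Poly_Mapping.lookup"
abbreviation "keys \<equiv> Poly_Mapping.keys"
abbreviation "single \<equiv> Poly_Mapping.single"

text \<open>A monomial is the multiset of its indices, so a partition rho serves directly as the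
  monomial p_rho. The index 0 is allowed and gives a spurious variable p_0, which
  \<open>one_shift\<close>, \<open>ev\<close> and \<open>homog\<close> keep out of the way.\<close>

type_synonym 'a pol = "nat multiset \<Rightarrow>\<^sub>0 'a"

abbreviation pmono :: "nat multiset \<Rightarrow> 'a::zero \<Rightarrow> 'a pol" where
  "pmono \<equiv> single"

abbreviation pvar :: "nat \<Rightarrow> 'a::zero_neq_one pol" where
  "pvar k \<equiv> single {#k#} 1"

abbreviation pconst :: "'a::zero \<Rightarrow> 'a pol" where
  "pconst \<equiv> single 0"

lemma poly_mapping_sum_monomials:
  "(\<Sum>\<rho>\<in>keys f. single \<rho> (lookup f \<rho>)) = (f :: 'a \<Rightarrow>\<^sub>0 'b::comm_monoid_add)"
  by (rule poly_mapping_eqI)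
     (simp add: lookup_sum lookup_single when_def sum.delta in_keys_iff)

lemma pol_add_induct [case_names mono add]:
  assumes "\<And>\<rho> c. P (pmono \<rho> c)" and "\<And>f g. P f \<Longrightarrow> P g \<Longrightarrow> P (f + g)"
  shows "P (f :: 'a::comm_monoid_add pol)"
proof -
  have "P (\<Sum>\<rho>\<in>X. pmono \<rho> (lookup f \<rho>))" if "finite X" for X
    using that
  proof (induction X rule: finite_induct)
    case empty
    show ?case using assms(1)[of 0 0] by simp
  qed (use assms in auto)
  from this[of "keys f"] show ?thesis by (simp add: poly_mapping_sum_monomials)
qed

lemma pol_induct [case_names const add var]:
  assumes "\<And>c. P (pconst c)" and "\<And>f g. P f \<Longrightarrow> P g \<Longrightarrow> P (f + g)" and "\<And>k f. P f \<Longrightarrow> P (pvar k * f)"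
  shows "P (f :: 'a::comm_semiring_1 pol)"
proof (induction f rule: pol_add_induct)
  case (mono \<rho> c)
  show ?case
  proof (induction \<rho>)
    case empty
    show ?case using assms(1) by simp
  next
    case (add k \<rho>)
    from assms(3)[OF this, of k] show ?case by (simp add: mult_single)
  qed
qed (use assms in auto)

text \<open>The coefficient is passed to \<open>F\<close> instead of acting as a scalar, so that
  substitutions, the inner product, derivatives and the map to symmetric functions, whose targets
  differ, are all instances.\<close>

definition lin :: "(nat multiset \<Rightarrow> 'a \<Rightarrow> 'b) \<Rightarrow> 'a::zero pol \<Rightarrow> 'b::comm_monoid_add" where
  "lin F f = (\<Sum>\<rho>\<in>keys f. F \<rho> (lookup f \<rho>))"

lemma lin_superset:
  assumes "finite X" "keys f \<subseteq> X" "\<And>\<rho>. F \<rho> 0 = 0"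
  shows "lin F f = (\<Sum>\<rho>\<in>X. F \<rho> (lookup f \<rho>))"
  unfolding lin_def using assms by (intro sum.mono_neutral_left) (auto simp: in_keys_iff)

lemma lin_add:
  assumes "\<And>\<rho>. F \<rho> 0 = 0" "\<And>\<rho> a b. F \<rho> (a + b) = F \<rho> a + F \<rho> b"
  shows "lin F (f + g) = lin F f + lin F g"
proof -
  let ?X = "keys f \<union> keys g"
  have "lin F h = (\<Sum>\<rho>\<in>?X. F \<rho> (lookup h \<rho>))" if "h \<in> {f, g, f + g}" for h
    using that Poly_Mapping.keys_add[of f g] by (intro lin_superset assms) auto
  thus ?thesis by (simp add: lookup_add assms sum.distrib)
qed

lemma lin_mono: "F \<rho> 0 = 0 \<Longrightarrow> lin F (pmono \<rho> c) = F \<rho> c"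
  by (simp add: lin_def)

section \<open>Substitution homomorphisms\<close>

definition psubst :: "('a::comm_ring_1 \<Rightarrow> 'b::comm_ring_1) \<Rightarrow> (nat \<Rightarrow> 'b) \<Rightarrow> 'a pol \<Rightarrow> 'b" where
  "psubst c v = lin (\<lambda>\<rho> a. c a * (\<Prod>k\<in>#\<rho>. v k))"

context comm_ring_hom
begin

lemma psubst_mono: "psubst hom v (pmono \<rho> a) = hom a * (\<Prod>k\<in>#\<rho>. v k)"
  by (simp add: psubst_def lin_mono)

lemma psubst_pconst [simp]: "psubst hom v (pconst a) = hom a"
  by (simp add: psubst_mono)

lemma psubst_pvar [simp]: "psubst hom v (pvar k) = v k"
  by (simp add: psubst_mono)

lemma psubst_add: "psubst hom v (f + g) = psubst hom v f + psubst hom v g"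
  unfolding psubst_def by (rule lin_add) (simp_all add: hom_add algebra_simps)

lemma psubst_mult: "psubst hom v (f * g) = psubst hom v f * psubst hom v g"
proof (induction f rule: pol_add_induct)
  case (mono \<rho> c)
  show ?case
  proof (induction g rule: pol_add_induct)
    case (mono \<sigma> d)
    show ?case by (simp add: psubst_mono mult_single hom_mult algebra_simps)
  qed (simp add: psubst_add algebra_simps)
qed (simp add: psubst_add algebra_simps)

lemma psubst_hom: "comm_ring_hom (psubst hom v)"
proof
  show "psubst hom v 1 = 1" unfolding single_one[symmetric] by (simp del: single_one)
  show "psubst hom v 0 = 0" by (simp add: psubst_def lin_def)
qed (simp_all add: psubst_add psubst_mult)

end

lemma pol_hom_eqI:
  assumes "comm_ring_hom F" "comm_ring_hom G"
    and c: "\<And>c. F (pconst c) = G (pconst c)" and v: "\<And>k. F (pvar k) = G (pvar k)"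
  shows "F f = G (f :: 'a::comm_ring_1 pol)"
proof -
  interpret F: comm_ring_hom F by fact
  interpret G: comm_ring_hom G by fact
  show ?thesis by (induction f rule: pol_induct) (simp_all add: c v F.hom_add G.hom_add F.hom_mult G.hom_mult)
qed

lemma pconst_hom: "comm_ring_hom (pconst :: 'a::comm_ring_1 \<Rightarrow> 'a pol)"
  by standard (simp_all add: single_add mult_single)

lemma const_poly_hom: "comm_ring_hom (\<lambda>c::'a::comm_ring_1. [:c:])"
  by standard simp_all

lemma comm_ring_hom_comp: "comm_ring_hom f \<Longrightarrow> comm_ring_hom g \<Longrightarrow> comm_ring_hom (\<lambda>x. f (g x))"
proof -
  assume "comm_ring_hom f" "comm_ring_hom g"
  then interpret f: comm_ring_hom f + g: comm_ring_hom g by simp_all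
  show ?thesis by standard (simp_all add: f.hom_add g.hom_add f.hom_mult g.hom_mult)
qed

text \<open>The substitution p_k -> p_k + s_k y^k, with y the variable of the outer polynomial;
  \<open>shc s n\<close> takes the coefficient of y^n. For k > 0 the choices s_k = 1, -1 and t^k - 1
  give the families \<open>E\<close>, \<open>D\<close> and \<open>D'\<close>.\<close>

definition shift :: "(nat \<Rightarrow> 'a) \<Rightarrow> 'a::comm_ring_1 pol \<Rightarrow> 'a pol poly" where
  "shift s = psubst (\<lambda>c. [:pconst c:]) (\<lambda>k. [:pvar k:] + monom (pconst (s k)) k)"

abbreviation shc :: "(nat \<Rightarrow> 'a) \<Rightarrow> nat \<Rightarrow> 'a::comm_ring_1 pol \<Rightarrow> 'a pol" where
  "shc s n f \<equiv> poly.coeff (shift s f) n"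

lemma shift_coeff_hom: "comm_ring_hom (\<lambda>c::'a::comm_ring_1. [:pconst c:] :: 'a pol poly)"
  using comm_ring_hom_comp[OF const_poly_hom pconst_hom] .

lemma shift_hom: "comm_ring_hom (shift s)"
  unfolding shift_def by (rule comm_ring_hom.psubst_hom[OF shift_coeff_hom])

interpretation shift: comm_ring_hom "shift s" for s
  by (rule shift_hom)

lemma shift_pconst [simp]: "shift s (pconst c) = [:pconst c:]"
  unfolding shift_def by (rule comm_ring_hom.psubst_pconst[OF shift_coeff_hom])

lemma shift_pvar [simp]: "shift s (pvar k) = [:pvar k:] + monom (pconst (s k)) k"
  unfolding shift_def by (rule comm_ring_hom.psubst_pvar[OF shift_coeff_hom])

lemma shc_add: "shc s n (f + g) = shc s n f + shc s n g"
  by (simp add: shift.hom_add)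

lemma shc_mult: "shc s n (f * g) = (\<Sum>i\<le>n. shc s i f * shc s (n - i) g)"
  by (simp add: shift.hom_mult coeff_mult)

lemma shc_pconst: "shc s n (pconst c) = (if n = 0 then pconst c else 0)"
  by (simp add: coeff_pCons split: nat.split)

lemma shc_pconst_mult: "shc s n (pconst c * f) = pconst c * shc s n f"
  by (simp add: shift.hom_mult)

lemma shc_pvar_mult:
  "shc s n (pvar k * f) = pvar k * shc s n f + (if k \<le> n then pconst (s k) * shc s (n - k) f else 0)"
  unfolding shift.hom_mult shift_pvar distrib_right
  by (simp add: coeff_monom_mult)

lemma shc_0: "(\<And>k. k = 0 \<Longrightarrow> s k = 0) \<Longrightarrow> shc s 0 f = f"
  by (induction f rule: pol_induct) (auto simp: shc_pconst shc_add shc_pvar_mult simp del: shift_pconst)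

text \<open>Both operators add constants to the variables, so in either order p_k becomes p_k + s_k
  y^k + u_k z^k.\<close>

lemma shc_commute: "shc s a (shc u b f) = shc u b (shc s a f)"
proof (induction f arbitrary: a b rule: pol_induct)
  case (const c)
  show ?case by (simp add: shc_pconst del: shift_pconst)
next
  case (add f g)
  thus ?case by (simp add: shc_add)
next
  case (var k f)
  thus ?case
    unfolding shc_pvar_mult
    by (simp add: shc_add shc_pconst_mult shc_pvar_mult if_distrib[of "shc _ _"] cong: if_cong)
qed

lemma shc_sum: "shc s n (\<Sum>i\<in>X. f i) = (\<Sum>i\<in>X. shc s n (f i))"
  by (simp add: shift.hom_sum coeff_sum)

text \<open>The y^n coefficient of the fact that substituting p_k - s_k y^k after p_k + s_k y^k,
  with the same y, changes nothing.\<close>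

lemma shc_inverse:
  "(\<Sum>i\<le>n. shc (\<lambda>k. - s k) (n - i) (shc s i f)) = (if n = 0 then f else 0)"
proof (induction f arbitrary: n rule: pol_induct)
  case (const c)
  have "(\<Sum>i\<le>n. shc (\<lambda>k. - s k) (n - i) (shc s i (pconst c)))
      = (\<Sum>i\<in>{0}. shc (\<lambda>k. - s k) (n - i) (shc s i (pconst c)))"
    by (rule sum.mono_neutral_right) (auto simp: shc_pconst simp del: shift_pconst)
  thus ?case by (simp add: shc_pconst del: shift_pconst)
next
  case (add f g)
  thus ?case by (simp add: shc_add sum.distrib)
next
  case (var k f)
  let ?D = "shc (\<lambda>k. - s k)"
  have "(\<Sum>i\<le>n. ?D (n - i) (shc s i (pvar k * f)))
     = (\<Sum>i\<le>n. pvar k * ?D (n - i) (shc s i f))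
      + (\<Sum>i\<le>n. if k \<le> n - i then pconst (- s k) * ?D (n - i - k) (shc s i f) else 0)
      + (\<Sum>i\<le>n. if k \<le> i then pconst (s k) * ?D (n - i) (shc s (i - k) f) else 0)"
    unfolding shc_pvar_mult sum.distrib[symmetric]
    by (rule sum.cong) (auto simp: shc_add shc_pvar_mult shc_pconst_mult diff_diff_left)
  also have "(\<Sum>i\<le>n. pvar k * ?D (n - i) (shc s i f)) = (if n = 0 then pvar k * f else 0)"
    using var[of n] by (simp add: sum_distrib_left[symmetric])
  \<comment> \<open>Moving the index by k gives the terms from the inner operator the same form as
    those from the outer one; the signs s_k and -s_k then cancel.\<close>
  also have "(\<Sum>i\<le>n. if k \<le> i then pconst (s k) * ?D (n - i) (shc s (i - k) f) else 0)
    = (\<Sum>i\<le>n. if k \<le> n - i then pconst (s k) * ?D (n - i - k) (shc s i f) else 0)"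
  proof -
    have "(\<Sum>i\<le>n. if k \<le> i then pconst (s k) * ?D (n - i) (shc s (i - k) f) else 0)
        = (\<Sum>i\<in>{i. i \<le> n \<and> k \<le> i}. pconst (s k) * ?D (n - i) (shc s (i - k) f))"
      by (rule sum.mono_neutral_cong_right) auto
    also have "\<dots> = (\<Sum>i\<in>{i. i \<le> n \<and> k \<le> n - i}. pconst (s k) * ?D (n - i - k) (shc s i f))"
    proof (rule sum.reindex_bij_witness[of _ "\<lambda>i. i + k" "\<lambda>i. i - k"])
      fix i assume "i \<in> {i. i \<le> n \<and> k \<le> i}"
      hence "i - k + k = i" "n - (i - k) - k = n - i" "i - k \<in> {i. i \<le> n \<and> k \<le> n - i}" by auto
      thus "i - k + k = i" "i - k \<in> {i. i \<le> n \<and> k \<le> n - i}"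
        "pconst (s k) * ?D (n - (i - k) - k) (shc s (i - k) f) = pconst (s k) * ?D (n - i) (shc s (i - k) f)"
        by simp_all
    qed auto
    also have "\<dots> = (\<Sum>i\<le>n. if k \<le> n - i then pconst (s k) * ?D (n - i - k) (shc s i f) else 0)"
      by (rule sum.mono_neutral_cong_left) auto
    finally show ?thesis .
  qed
  moreover have "(\<Sum>i\<le>n. if k \<le> n - i then pconst (- s k) * ?D (n - i - k) (shc s i f) else 0)
      + (\<Sum>i\<le>n. if k \<le> n - i then pconst (s k) * ?D (n - i - k) (shc s i f) else 0) = 0"
    unfolding sum.distrib[symmetric] by (rule sum.neutral) (simp add: single_uminus)
  ultimately show ?case by (simp only: add.assoc add_0_right)
qed

section \<open>The inner product\<close>

text \<open>The Hall form on \<open>pol\<close>. Any monomial containing p_0 lies in its radical, as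
  \<open>zee\<close> then has a factor 0.\<close>

definition pip :: "'a::comm_ring_1 pol \<Rightarrow> 'a pol \<Rightarrow> 'a" where
  "pip f g = lin (\<lambda>\<rho> a. of_nat (zee \<rho>) * a * lookup g \<rho>) f"

lemma pip_add_left: "pip (f + f') g = pip f g + pip f' g"
  unfolding pip_def by (rule lin_add) (simp_all add: algebra_simps)

lemma pip_commute: "pip f g = pip g f"
proof -
  have *: "pip f g = (\<Sum>\<rho>\<in>keys f \<union> keys g.
      of_nat (zee \<rho>) * lookup f \<rho> * lookup g \<rho>)" for f g :: "'a pol"
    unfolding pip_def by (rule lin_superset) auto
  show ?thesis unfolding * by (rule sum.cong) (auto simp: algebra_simps)
qed

lemma pip_add_right: "pip f (g + g') = pip f g + pip f g'"
  using pip_add_left[of g g' f] by (simp add: pip_commute)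

lemma pip_mono_left: "pip (pmono \<rho> a) g = of_nat (zee \<rho>) * a * lookup g \<rho>"
  by (simp add: pip_def lin_mono)

lemma pip_pconst_left: "pip (pconst c * f) g = c * pip f g"
  by (induction f rule: pol_add_induct)
     (simp_all add: mult_single pip_mono_left distrib_left pip_add_left algebra_simps)

lemma pip_pconst_right: "pip f (pconst c * g) = c * pip f g"
  using pip_pconst_left[of c g f] by (simp add: pip_commute)

lemma pip_0_left [simp]: "pip 0 g = 0"
  by (simp add: pip_def lin_def)

lemma pip_0_right [simp]: "pip f 0 = 0"
  using pip_0_left[of f] by (simp add: pip_commute)

lemma pip_sum_left: "pip (\<Sum>i\<in>X. f i) g = (\<Sum>i\<in>X. pip (f i) g)"
  by (induction X rule: infinite_finite_induct) (simp_all add: pip_add_left)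

lemma pip_sum_right: "pip g (\<Sum>i\<in>X. f i) = (\<Sum>i\<in>X. pip g (f i))"
  by (induction X rule: infinite_finite_induct) (simp_all add: pip_add_right)

section \<open>Adjoints of multiplication by power sums\<close>

definition pdiff :: "nat \<Rightarrow> 'a::comm_ring_1 pol \<Rightarrow> 'a pol" where
  "pdiff k = lin (\<lambda>\<rho> a. pmono (\<rho> - {#k#}) (of_nat (count \<rho> k) * a))"

lemma pdiff_add: "pdiff k (f + g) = pdiff k f + pdiff k g"
  unfolding pdiff_def by (rule lin_add) (simp_all add: algebra_simps single_add)

lemma pdiff_0 [simp]: "pdiff k 0 = 0"
  by (simp add: pdiff_def lin_def)

lemma pdiff_mono: "pdiff k (pmono \<rho> a) = pmono (\<rho> - {#k#}) (of_nat (count \<rho> k) * a)"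
  by (simp add: pdiff_def lin_mono)

lemma pdiff_pvar_mult: "pdiff k (pvar i * f) = pvar i * pdiff k f + (if i = k then f else 0)"
proof (induction f rule: pol_add_induct)
  case (mono \<rho> c)
  show ?case
  proof (cases "k \<in># \<rho>")
    case True
    thus ?thesis
      by (auto simp: mult_single pdiff_mono algebra_simps single_add)
  next
    case False
    thus ?thesis
      by (auto simp: mult_single pdiff_mono not_in_iff)
  qed
qed (simp_all add: pdiff_add algebra_simps)

text \<open>Only the factor at \<open>k\<close> changes when a part \<open>k\<close> is added;
  \<open>F i 0 = 1\<close> lets the factor at \<open>k\<close> be split off even if \<open>k\<close>
  does not occur. This serves \<open>zee\<close>, \<open>mfact\<close> and b_lambda alike.\<close>

lemma prod_count_add_mset:
  fixes F :: "'b \<Rightarrow> nat \<Rightarrow> 'c::comm_monoid_mult"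
  assumes "\<And>i. F i 0 = 1" "F k (Suc (count \<sigma> k)) = c * F k (count \<sigma> k)"
  shows "(\<Prod>i\<in>set_mset (add_mset k \<sigma>). F i (count (add_mset k \<sigma>) i)) = c * (\<Prod>i\<in>set_mset \<sigma>. F i (count \<sigma> i))"
proof -
  have *: "(\<Prod>i\<in>set_mset \<tau>. F i (count \<tau> i)) = F k (count \<tau> k) * (\<Prod>i\<in>set_mset \<tau> - {k}. F i (count \<tau> i))" for \<tau>
  proof (cases "k \<in># \<tau>")
    case True
    thus ?thesis by (simp add: prod.remove)
  next
    case False
    thus ?thesis by (simp add: not_in_iff assms)
  qed
  have "(\<Prod>i\<in>set_mset (add_mset k \<sigma>) - {k}. F i (count (add_mset k \<sigma>) i))
      = (\<Prod>i\<in>set_mset \<sigma> - {k}. F i (count \<sigma> i))"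
    by (rule prod.cong) auto
  moreover have "F k (count (add_mset k \<sigma>) k) = c * F k (count \<sigma> k)"
    by (simp add: assms)
  ultimately show ?thesis unfolding *[of "add_mset k \<sigma>"] *[of \<sigma>] by (simp only: mult.assoc)
qed

lemma zee_add_mset: "zee (add_mset k \<rho>) = k * (count \<rho> k + 1) * zee \<rho>"
  unfolding zee_def by (rule prod_count_add_mset) (simp_all add: algebra_simps)

text \<open>Multiplication by p_k is adjoint to k d/dp_k, because adding a part k multiplies
  \<open>zee\<close> by k (m_k + 1).\<close>

lemma pip_pvar_left: "pip (pvar k * f) g = of_nat k * pip f (pdiff k g)"
proof (induction f rule: pol_add_induct)
  case (mono \<rho> a)
  show ?case
  proof (induction g rule: pol_add_induct)
    case (mono \<sigma> b)
    \<comment> \<open>Multiset difference truncates: it can yield \<open>\<rho>\<close> also when k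
      is absent from \<open>\<sigma>\<close>, but then the factor m_k of the derivative is
      0.\<close>
    have "\<sigma> - {#k#} = \<rho> \<Longrightarrow> \<sigma> \<noteq> add_mset k \<rho> \<Longrightarrow> count \<sigma> k = 0"
      by (metis diff_single_trivial not_in_iff insert_DiffM)
    thus ?case
      by (auto simp: mult_single pip_mono_left pdiff_mono lookup_single zee_add_mset algebra_simps when_def)
  qed (simp_all add: pip_add_right pdiff_add algebra_simps)
qed (simp_all add: pip_add_left algebra_simps)

definition one_shift :: "nat \<Rightarrow> 'a::comm_ring_1" where
  "one_shift k = (if k = 0 then 0 else 1)"

text \<open>Chain rule: E(y) f depends on y through the p_k + y^k only, so y d/dy E(y) f is the sum
  of k y^k d/dp_k E(y) f. The coefficients of y^n are compared.\<close>

lemma pdiff_shc_euler: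
  "of_nat n * shc one_shift n f = (\<Sum>k=1..n. of_nat k * pdiff k (shc one_shift (n - k) f))"
proof (induction f arbitrary: n rule: pol_induct)
  case (const c)
  show ?case by (auto simp: shc_pconst pdiff_mono simp del: shift_pconst intro!: sum.neutral)
next
  case (add f g)
  thus ?case by (simp add: shc_add pdiff_add sum.distrib algebra_simps)
next
  case (var i f)
  show ?case
  proof (cases "i = 0")
    case True
    have "shc one_shift m (pvar i * f) = pvar i * shc one_shift m f" for m
      by (simp add: True shc_pvar_mult one_shift_def del: shift_pvar)
    hence "of_nat n * shc one_shift n (pvar i * f) = pvar i * (of_nat n * shc one_shift n f)"
        "(\<Sum>k=1..n. of_nat k * pdiff k (shc one_shift (n - k) (pvar i * f)))
          = pvar i * (\<Sum>k=1..n. of_nat k * pdiff k (shc one_shift (n - k) f))"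
      using True by (simp_all add: mult.left_commute sum_distrib_left pdiff_pvar_mult)
    thus ?thesis using var[of n] by simp
  next
    case False
  let ?E = "shc one_shift"
  have "(\<Sum>k=1..n. of_nat k * pdiff k (?E (n - k) (pvar i * f)))
     = (\<Sum>k=1..n. pvar i * (of_nat k * pdiff k (?E (n - k) f)))
      + (\<Sum>k=1..n. if i = k then of_nat k * ?E (n - k) f else 0)
      + (\<Sum>k=1..n. if i \<le> n - k then of_nat k * pdiff k (?E (n - k - i) f) else 0)"
    unfolding sum.distrib[symmetric]
    unfolding shc_pvar_mult
    by (rule sum.cong) (use False in \<open>auto simp: one_shift_def pdiff_add pdiff_pvar_mult distrib_left mult.left_commute diff_diff_left add.commute\<close>)
  also have "(\<Sum>k=1..n. pvar i * (of_nat k * pdiff k (?E (n - k) f))) = pvar i * (of_nat n * ?E n f)"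
    by (simp add: var sum_distrib_left)
  also have "(\<Sum>k=1..n. if i = k then of_nat k * ?E (n - k) f else 0) = (if i \<le> n then of_nat i * ?E (n - i) f else 0)"
    using False by (auto simp: sum.delta)
  also have "(\<Sum>k=1..n. if i \<le> n - k then of_nat k * pdiff k (?E (n - k - i) f) else 0)
      = (if i \<le> n then of_nat (n - i) * ?E (n - i) f else 0)"
  proof (cases "i \<le> n")
    case True
    have "(\<Sum>k=1..n. if i \<le> n - k then of_nat k * pdiff k (?E (n - k - i) f) else 0)
       = (\<Sum>k=1..n-i. of_nat k * pdiff k (?E (n - i - k) f))"
      by (rule sum.mono_neutral_cong_right) (auto simp: diff_diff_left add.commute)
    thus ?thesis using True by (simp only: var[symmetric] if_True)
  next
    case False
    thus ?thesis by (auto intro!: sum.neutral)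
  qed
  \<comment> \<open>The two extra terms have weights i and n - i, which add up to n.\<close>
  also have "pvar i * (of_nat n * ?E n f) + (if i \<le> n then of_nat i * ?E (n - i) f else 0)
      + (if i \<le> n then of_nat (n - i) * ?E (n - i) f else 0) = of_nat n * ?E n (pvar i * f)"
    unfolding shc_pvar_mult using False by (auto simp: one_shift_def[of i] algebra_simps of_nat_diff)
  finally show ?thesis by (rule sym)
  qed
qed

section \<open>Newton recursions\<close>

text \<open>With A(y) the series of the a_n and P(y) that of the p_k for k > 0, this says y A' = P
  A, so A is a_0 exp(sum p_k y^k / k) whenever integers can be inverted. The recursion survives ring
  homomorphisms, so generating function identities can be proved by comparing logarithmic
  derivatives in any coefficient ring.\<close>

definition newton :: "(nat \<Rightarrow> 'a::comm_ring_1) \<Rightarrow> (nat \<Rightarrow> 'a) \<Rightarrow> bool" where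
  "newton p a \<longleftrightarrow> (\<forall>n. of_nat n * a n = (\<Sum>k=1..n. p k * a (n - k)))"

lemma newtonD: "newton p a \<Longrightarrow> of_nat n * a n = (\<Sum>k=1..n. p k * a (n - k))"
  by (simp add: newton_def)

lemma newton_unique:
  fixes a b :: "nat \<Rightarrow> 'a::comm_ring_1"
  assumes "newton p a" "newton p b" "a 0 = b 0"
    and unit: "\<And>n. n > 0 \<Longrightarrow> \<exists>u::'a. u * of_nat n = 1"
  shows "a n = b n"
proof (induction n rule: less_induct)
  case (less n)
  show ?case
  proof (cases "n = 0")
    case False
    then obtain u :: 'a where u: "u * of_nat n = 1" using unit by auto
    have "of_nat n * a n = of_nat n * b n"
      unfolding newtonD[OF assms(1)] newtonD[OF assms(2)]
      by (rule sum.cong) (use less False in auto)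
    hence "u * of_nat n * a n = u * of_nat n * b n" by (simp add: mult.assoc)
    thus ?thesis using u by simp
  qed (use assms in simp)
qed

lemma newton_iff_fps:
  "newton p a \<longleftrightarrow> fps_X * fps_deriv (Abs_fps a) = Abs_fps (\<lambda>k. if k = 0 then 0 else p k) * Abs_fps a"
proof -
  have "(\<Sum>i=0..n. (if i = 0 then 0 else p i) * a (n - i)) = (\<Sum>k=1..n. p k * a (n - k))" for n
    by (rule sum.mono_neutral_cong_right) auto
  hence "fps_nth (Abs_fps (\<lambda>k. if k = 0 then 0 else p k) * Abs_fps a) n = (\<Sum>k=1..n. p k * a (n - k))" for n
    by (simp add: fps_mult_nth)
  moreover have "fps_nth (fps_X * fps_deriv (Abs_fps a)) n = of_nat n * a n" for n
    by (cases n) (simp_all add: fps_X_mult_nth del: of_nat_Suc)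
  ultimately show ?thesis
    by (simp add: newton_def fps_eq_iff)
qed

text \<open>Logarithmic derivatives of products add.\<close>

lemma newton_mult:
  assumes "newton p a" "newton q b"
  shows "newton (\<lambda>k. p k + q k) (\<lambda>n. \<Sum>i\<le>n. a i * b (n - i))"
proof -
  have "Abs_fps (\<lambda>n. \<Sum>i\<le>n. a i * b (n - i)) = Abs_fps a * Abs_fps b"
    by (simp add: fps_eq_iff fps_mult_nth atLeast0AtMost)
  moreover have "Abs_fps (\<lambda>k. if k = 0 then 0 else p k + q k)
      = Abs_fps (\<lambda>k. if k = 0 then 0 else p k) + Abs_fps (\<lambda>k. if k = 0 then 0 else q k)"
    by (simp add: fps_eq_iff)
  moreover have "fps_X * fps_deriv (Abs_fps a * Abs_fps b)
      = (fps_X * fps_deriv (Abs_fps a)) * Abs_fps b + Abs_fps a * (fps_X * fps_deriv (Abs_fps b))"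
    by (simp add: algebra_simps)
  ultimately show ?thesis
    using assms[unfolded newton_iff_fps] unfolding newton_iff_fps by (simp only: algebra_simps)
qed

text \<open>Coefficients of (1 - t y z) / (1 - y z) as a series in z.\<close>

definition geoc :: "'a::comm_ring_1 \<Rightarrow> 'a \<Rightarrow> nat \<Rightarrow> 'a" where
  "geoc t y n = (if n = 0 then 1 else (1 - t) * y ^ n)"

text \<open>Applying z d/dz to log((1 - t y z) / (1 - y z)) gives the sum over k > 0 of (1 - t^k)
  y^k z^k.\<close>

lemma newton_geoc: "newton (\<lambda>k. (1 - t ^ k) * y ^ k) (geoc t y)"
proof -
  have *: "(1 - t) * (\<Sum>k=1..n. 1 - t ^ k) = of_nat n * (1 - t) - t + t ^ Suc n" for n
    by (induction n) (simp_all add: algebra_simps)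
  have "of_nat n * geoc t y n = (\<Sum>k=1..n. (1 - t ^ k) * y ^ k * geoc t y (n - k))" for n
  proof (cases n)
    case (Suc m)
    have "(\<Sum>k=1..n. (1 - t ^ k) * y ^ k * geoc t y (n - k))
       = (1 - t ^ n) * y ^ n + (\<Sum>k=1..m. (1 - t ^ k) * y ^ k * geoc t y (n - k))"
      by (simp add: Suc geoc_def)
    also have "(\<Sum>k=1..m. (1 - t ^ k) * y ^ k * geoc t y (n - k)) = (\<Sum>k=1..m. y ^ n * ((1 - t) * (1 - t ^ k)))"
    proof (rule sum.cong)
      fix k assume "k \<in> {1..m}"
      hence "y ^ k * y ^ (n - k) = y ^ n" "n - k \<noteq> 0"
        using Suc by (auto simp: power_add[symmetric])
      thus "(1 - t ^ k) * y ^ k * geoc t y (n - k) = y ^ n * ((1 - t) * (1 - t ^ k))"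
        by (auto simp: geoc_def algebra_simps)
    qed simp
    also have "(1 - t ^ n) * y ^ n + \<dots> = of_nat n * geoc t y n"
      unfolding sum_distrib_left[symmetric] * using Suc by (simp add: geoc_def algebra_simps)
    finally show ?thesis ..
  qed simp
  thus ?thesis by (simp add: newton_def)
qed

lemma newton_hom:
  assumes "comm_ring_hom h" "newton p a"
  shows "newton (\<lambda>k. h (p k)) (\<lambda>n. h (a n))"
proof -
  interpret comm_ring_hom h by fact
  have of_nat: "h (of_nat n) = of_nat n" for n
    by (induction n) (simp_all add: hom_add)
  have "h (of_nat n * a n) = h (\<Sum>k=1..n. p k * a (n - k))" for n
    using newtonD[OF assms(2)] by simp
  thus ?thesis by (simp add: newton_def hom_mult hom_sum of_nat)
qed

section \<open>Complete functions and their Hall--Littlewood analogues\<close>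

abbreviation tvar :: "complex poly" where "tvar \<equiv> [:0, 1:]"

lemma pconst_const_1: "pconst [:1:] = (1 :: complex poly pol)"
  by (metis one_pCons single_one)

lemma pconst_1_minus_tvar: "pconst [:1, -1:] = 1 - pconst tvar"
proof -
  have "[:1, -1:] = 1 - tvar" by (simp add: one_pCons)
  thus ?thesis by (simp add: single_diff)
qed

text \<open>The complete functions h_n, obtained by solving n h_n = sum p_k h_{n-k} for h_n; the
  only denominators are integers, which are units in C[t].\<close>

fun hsym :: "nat \<Rightarrow> complex poly pol" where
  "hsym 0 = 1"
| "hsym (Suc n) = pconst [:1 / of_nat (Suc n):] * (\<Sum>k\<le>n. pvar (Suc k) * hsym (n - k))"

lemma of_nat_pol: "(of_nat n :: 'a::comm_ring_1 pol) = pconst (of_nat n)"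
  by (induction n) (simp_all add: single_add)

lemma pconst_inverse_of_nat: "n > 0 \<Longrightarrow> pconst [:1 / of_nat n:] * (of_nat n :: complex poly pol) = 1"
  unfolding of_nat_pol by (simp add: mult_single of_nat_poly pconst_const_1 del: single_of_nat)

lemma newton_hsym: "newton pvar hsym"
proof -
  have "of_nat n * hsym n = (\<Sum>k=1..n. pvar k * hsym (n - k))" for n
  proof (cases n)
    case (Suc m)
    have "of_nat n * hsym n = (pconst [:1 / of_nat n:] * of_nat n) * (\<Sum>k\<le>m. pvar (Suc k) * hsym (m - k))"
      unfolding Suc hsym.simps by (simp only: ac_simps)
    also have "\<dots> = (\<Sum>k\<le>m. pvar (Suc k) * hsym (m - k))"
      by (subst pconst_inverse_of_nat) (simp_all add: Suc)
    also have "\<dots> = (\<Sum>k=1..n. pvar k * hsym (n - k))"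
      by (rule sum.reindex_bij_witness[of _ "\<lambda>k. k - 1" Suc]) (auto simp: Suc)
    finally show ?thesis .
  qed simp
  thus ?thesis by (simp add: newton_def)
qed

definition phi :: "complex poly pol \<Rightarrow> complex poly pol" where
  "phi = psubst pconst (\<lambda>k. pconst (1 - tvar ^ k) * pvar k)"

lemma phi_hom: "comm_ring_hom phi"
  unfolding phi_def by (rule comm_ring_hom.psubst_hom[OF pconst_hom])

interpretation phi: comm_ring_hom phi
  by (rule phi_hom)

lemma phi_pconst [simp]: "phi (pconst c) = pconst c"
  unfolding phi_def by (rule comm_ring_hom.psubst_pconst[OF pconst_hom])

lemma phi_pvar [simp]: "phi (pvar k) = pconst (1 - tvar ^ k) * pvar k"
  unfolding phi_def by (rule comm_ring_hom.psubst_pvar[OF pconst_hom])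

lemma phi_pmono: "phi (pmono \<rho> c) = pmono \<rho> (c * (\<Prod>k\<in>#\<rho>. 1 - tvar ^ k))"
proof -
  have "(\<Prod>k\<in>#\<rho>. pconst (1 - tvar ^ k) * pvar k) = pmono \<rho> (\<Prod>k\<in>#\<rho>. 1 - tvar ^ k)"
    by (induction \<rho>) (simp_all add: mult_single)
  thus ?thesis unfolding phi_def
    by (simp add: comm_ring_hom.psubst_mono[OF pconst_hom] mult_single)
qed

text \<open>The map \<open>phi\<close> is diagonal in the orthogonal basis of monomials, hence
  self-adjoint.\<close>

lemma pip_phi: "pip f (phi g) = pip (phi f) g"
proof (induction f rule: pol_add_induct)
  case (mono \<rho> a)
  show ?case
    by (induction g rule: pol_add_induct)
      (auto simp: phi_pmono pip_mono_left lookup_single when_def phi.hom_add pip_add_right)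
qed (simp_all add: phi.hom_add pip_add_left)

text \<open>The function q_n(x;t) with generating series prod_i (1 - t x_i u) / (1 - x_i u).\<close>

definition qsym :: "nat \<Rightarrow> complex poly pol" where
  "qsym n = phi (hsym n)"

lemma qsym_0 [simp]: "qsym 0 = 1"
  by (simp add: qsym_def)

lemma newton_qsym: "newton (\<lambda>k. pconst (1 - tvar ^ k) * pvar k) qsym"
  using newton_hom[OF phi_hom newton_hsym] by (simp add: qsym_def[abs_def])

text \<open>E(y) adjoins a variable y to the alphabet, so the series of the q_n acquires the factor
  (1 - t y u) / (1 - y u). Both sides obey the same Newton recursion and start at 1.\<close>

lemma shift_qsym: "shift one_shift (qsym n) = (\<Sum>i\<le>n. [:qsym i:] * geoc [:pconst tvar:] (monom 1 1) (n - i))"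
proof (rule newton_unique)
  let ?p = "\<lambda>k. shift one_shift (pconst (1 - tvar ^ k) * pvar k)"
  show "newton ?p (\<lambda>n. shift one_shift (qsym n))"
    by (rule newton_hom[OF shift_hom newton_qsym])
  have c: "comm_ring_hom (\<lambda>c::complex poly pol. [:c:])" by (rule const_poly_hom)
  have "newton (\<lambda>k. [:pconst (1 - tvar ^ k) * pvar k:] + (1 - [:pconst tvar:] ^ k) * monom 1 1 ^ k)
      (\<lambda>n. \<Sum>i\<le>n. [:qsym i:] * geoc [:pconst tvar:] (monom 1 1) (n - i))"
    by (intro newton_mult newton_geoc newton_hom[OF c newton_qsym])
  moreover have "[:pconst (1 - tvar ^ k) * pvar k:] + (1 - [:pconst tvar:] ^ k) * monom 1 1 ^ k = ?p k" for k
  proof -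
    have "[:pconst tvar:] ^ k = [:pconst (tvar ^ k):]"
      by (induction k) (simp_all add: one_pCons mult_single pconst_const_1)
    hence c: "1 - [:pconst tvar:] ^ k = [:pconst (1 - tvar ^ k):]"
      by (simp add: one_pCons[where 'a="complex poly pol"] single_diff)
    have "?p k = [:pconst (1 - tvar ^ k):] * ([:pvar k:] + monom (pconst (one_shift k)) k)"
      unfolding shift.hom_mult shift_pconst shift_pvar ..
    also have "\<dots> = [:pconst (1 - tvar ^ k) * pvar k:] + [:pconst (1 - tvar ^ k):] * monom 1 k"
      by (cases "k = 0") (simp_all add: one_shift_def distrib_left)
    finally show ?thesis unfolding c by (simp add: monom_power)
  qed
  ultimately show "newton ?p (\<lambda>n. \<Sum>i\<le>n. [:qsym i:] * geoc [:pconst tvar:] (monom 1 1) (n - i))"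
    by simp
  show "shift one_shift (qsym 0) = (\<Sum>i\<le>0. [:qsym i:] * geoc [:pconst tvar:] (monom 1 1) (0 - i))"
    by (simp add: geoc_def one_pCons)
  fix n :: nat assume "n > 0"
  hence "[:pconst [:1 / of_nat n:]:] * of_nat n = (1 :: complex poly pol poly)"
    using pconst_inverse_of_nat[of n] by (simp add: of_nat_poly one_pCons mult.commute)
  thus "\<exists>u::complex poly pol poly. u * of_nat n = 1" by blast
qed

lemma shc_qsym:
  "shc one_shift k (qsym n) =
    (if k = 0 then qsym n else if k \<le> n then pconst (1 - tvar) * qsym (n - k) else 0)"
proof -
  have "poly.coeff (geoc [:pconst tvar:] (monom 1 1) m) k
      = (if k = m then (if m = 0 then 1 else pconst (1 - tvar)) else (0 :: complex poly pol))" for m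
    by (auto simp: geoc_def monom_power one_pCons single_diff
        coeff_pCons pconst_1_minus_tvar split: nat.split)
  hence "shc one_shift k (qsym n)
      = (\<Sum>i\<le>n. if k = n - i then qsym i * (if n - i = 0 then 1 else pconst (1 - tvar)) else 0)"
    by (simp add: shift_qsym coeff_sum) (auto intro!: sum.cong)
  also have "\<dots> = (\<Sum>i\<le>n. if i = n - k \<and> k \<le> n then qsym i * (if n - i = 0 then 1 else pconst (1 - tvar)) else 0)"
    by (rule sum.cong) auto
  also have "\<dots> = (if k = 0 then qsym n else if k \<le> n then pconst (1 - tvar) * qsym (n - k) else 0)"
    by (cases "k \<le> n") (auto simp: mult.commute)
  finally show ?thesis .
qed

lemma pip_of_nat_left: "pip (of_nat n * f) g = of_nat n * pip f g"
  unfolding of_nat_pol by (rule pip_pconst_left)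

lemma pip_of_nat_right: "pip f (of_nat n * g) = of_nat n * pip f g"
  unfolding of_nat_pol by (rule pip_pconst_right)

text \<open>Induction on n, comparing n times both sides: Newton's identity expands n h_n on the
  left, adjointness turns p_k into k d/dp_k, and the Euler relation collects the result into n
  E_n.\<close>

lemma pip_hsym_left: "pip (hsym n * f) g = pip f (shc one_shift n g)"
proof (induction n arbitrary: f rule: less_induct)
  case (less n)
  show ?case
  proof (cases "n = 0")
    case False
    have "of_nat n * pip (hsym n * f) g = pip (of_nat n * hsym n * f) g"
      by (simp add: pip_of_nat_left mult.assoc)
    also have "of_nat n * hsym n * f = (\<Sum>k=1..n. hsym (n - k) * (pvar k * f))"
      unfolding newtonD[OF newton_hsym] sum_distrib_right by (simp add: ac_simps)
    also have "pip \<dots> g = (\<Sum>k=1..n. pip (pvar k * f) (shc one_shift (n - k) g))"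
      unfolding pip_sum_left by (rule sum.cong) (use less False in auto)
    also have "\<dots> = pip f (\<Sum>k=1..n. of_nat k * pdiff k (shc one_shift (n - k) g))"
      by (simp add: pip_pvar_left pip_sum_right pip_of_nat_right)
    also have "\<dots> = of_nat n * pip f (shc one_shift n g)"
      unfolding pdiff_shc_euler[symmetric] by (rule pip_of_nat_right)
    finally show ?thesis using False by simp
  qed (simp add: shc_0 one_shift_def)
qed

section \<open>The Hall--Littlewood functions by recursion\<close>

abbreviation E :: "nat \<Rightarrow> 'a::comm_ring_1 pol \<Rightarrow> 'a pol" where
  "E \<equiv> shc one_shift"

abbreviation D :: "nat \<Rightarrow> 'a::comm_ring_1 pol \<Rightarrow> 'a pol" where
  "D \<equiv> shc (\<lambda>k. - one_shift k)"

abbreviation D' :: "nat \<Rightarrow> complex poly pol \<Rightarrow> complex poly pol" where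
  "D' \<equiv> shc (\<lambda>k. tvar ^ k - 1)"

text \<open>On generators: phi(p_k + (t^k - 1) y^k) = (1 - t^k) (p_k - y^k).\<close>

lemma phi_D': "phi (D' n f) = D n (phi f)"
proof (induction f arbitrary: n rule: pol_induct)
  case (const c)
  thus ?case by (simp add: shc_pconst del: shift_pconst)
next
  case (add f g)
  thus ?case by (simp add: shc_add phi.hom_add)
next
  case (var k f)
  show ?case
  proof (cases "k = 0")
    case True
    hence "phi (pvar k * f) = 0" by (simp add: phi.hom_mult)
    moreover have "D' n (pvar k * f) = pvar k * D' n f"
      using True by (simp add: shc_pvar_mult del: shift_pvar)
    ultimately show ?thesis using True by (simp add: phi.hom_mult)
  next
    case False
    have "pconst (tvar ^ k - 1) = - pconst (1 - tvar ^ k)" by (simp add: single_diff)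
    with False var show ?thesis
      by (simp add: phi.hom_mult shc_pvar_mult shc_pconst_mult phi.hom_add phi.hom_uminus one_shift_def
          mult.assoc distrib_left single_uminus del: shift_pvar shift_pconst)
  qed
qed

lemma shc_eq_0: "degree (shift s f) < n \<Longrightarrow> shc s n f = 0"
  by (rule coeff_eq_0)

text \<open>Partitions are listed in decreasing order.  Conjugating the recursion for \<open>Q\<close> by \<open>\<phi> : p\<^sub>k \<mapsto> (1 - t\<^sup>k) p\<^sub>k\<close>
  turns \<open>D\<close> into \<open>D'\<close> and gives \<open>Q'\<close> without dividing by \<open>1 - t\<^sup>k\<close>.\<close>

fun HLQ' :: "nat list \<Rightarrow> complex poly pol" where
  "HLQ' [] = 1"
| "HLQ' (r # xs) = (\<Sum>k\<le>degree (shift (\<lambda>k. tvar ^ k - 1) (HLQ' xs)). hsym (r + k) * D' k (HLQ' xs))"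

definition HLQ :: "nat list \<Rightarrow> complex poly pol" where
  "HLQ xs = phi (HLQ' xs)"

text \<open>The coefficient of \<open>u\<^sup>r\<close> in the vertex operator \<open>Q(u) D(1/u)\<close>, which adds a row of length \<open>r\<close>.\<close>

definition hlrow :: "nat \<Rightarrow> complex poly pol \<Rightarrow> complex poly pol" where
  "hlrow r f = (\<Sum>k\<le>degree (shift (\<lambda>k. - one_shift k) f). qsym (r + k) * D k f)"

lemma hlrow_eq:
  assumes "\<And>k. k > N \<Longrightarrow> D k f = 0"
  shows "hlrow r f = (\<Sum>k\<le>N. qsym (r + k) * D k f)"
proof -
  let ?d = "degree (shift (\<lambda>k. - one_shift k) f)"
  have "hlrow r f = (\<Sum>k\<le>max N ?d. qsym (r + k) * D k f)"
    unfolding hlrow_def by (rule sum.mono_neutral_left) (auto simp: shc_eq_0)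
  also have "\<dots> = (\<Sum>k\<le>N. qsym (r + k) * D k f)"
    by (rule sum.mono_neutral_right) (auto simp: assms)
  finally show ?thesis .
qed

lemma HLQ_Nil [simp]: "HLQ [] = 1"
  by (simp add: HLQ_def)

lemma HLQ_Cons: "HLQ (r # xs) = hlrow r (HLQ xs)"
proof -
  let ?N = "degree (shift (\<lambda>k. tvar ^ k - 1) (HLQ' xs))"
  have "D k (HLQ xs) = 0" if "k > ?N" for k
    using that by (simp add: HLQ_def phi_D'[symmetric] shc_eq_0)
  hence "hlrow r (HLQ xs) = (\<Sum>k\<le>?N. qsym (r + k) * D k (HLQ xs))"
    by (rule hlrow_eq)
  also have "\<dots> = phi (\<Sum>k\<le>?N. hsym (r + k) * D' k (HLQ' xs))"
    by (simp add: phi.hom_sum phi.hom_mult qsym_def phi_D' HLQ_def)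
  finally show ?thesis by (simp add: HLQ_def)
qed

lemma hlrow_pconst_mult: "hlrow r (pconst c * f) = pconst c * hlrow r f"
proof -
  let ?N = "degree (shift (\<lambda>k. - one_shift k) f)"
  have "hlrow r (pconst c * f) = (\<Sum>k\<le>?N. qsym (r + k) * D k (pconst c * f))"
    by (rule hlrow_eq) (simp add: shc_pconst_mult shc_eq_0 del: shift_pconst)
  thus ?thesis
    by (simp add: shc_pconst_mult sum_distrib_left hlrow_def mult.left_commute)
qed

lemma sum_rect_triangle:
  fixes F :: "nat \<Rightarrow> nat \<Rightarrow> 'a::comm_monoid_add"
  assumes "\<And>i j. i > N \<or> j > M \<Longrightarrow> F i j = 0"
  shows "(\<Sum>i\<le>N. \<Sum>j\<le>M. F i j) = (\<Sum>n\<le>N + M. \<Sum>j\<le>n. F (n - j) j)"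
proof -
  have "(\<Sum>i\<le>N. \<Sum>j\<le>M. F i j) = (\<Sum>j\<le>M. \<Sum>i\<le>N. F i j)"
    by (rule sum.swap)
  also have "\<dots> = (\<Sum>(j,i)\<in>{..M} \<times> {..N}. F i j)"
    by (simp add: sum.cartesian_product)
  also have "\<dots> = (\<Sum>(j,i)\<in>{(j,i). j + i \<le> N + M}. F i j)"
    by (rule sum.mono_neutral_left)
       (auto intro!: assms finite_subset[of "{(j,i). j + i \<le> N + M}" "{..N+M} \<times> {..N+M}"])
  also have "\<dots> = (\<Sum>n\<le>N + M. \<Sum>j\<le>n. F (n - j) j)"
    by (rule sum.triangle_reindex_eq)
  finally show ?thesis .
qed

text \<open>E is multiplicative, and E_a q_m = (1 - t) q_{m-a}, except that the factor 1 - t is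
  missing for a = 0. With a uniform factor the double sum would collapse through D(y) E(y) = 1; the
  correction at a = 0 produces the term with t. For k > r both contributions vanish.\<close>

lemma E_hlrow:
  assumes f: "\<And>j. j > r \<Longrightarrow> E j f = 0" and k: "k \<ge> r"
  shows "E k (hlrow r f) = (if k = r then pconst (1 - tvar) * f + pconst tvar * hlrow r (E r f) else 0)"
proof -
  define N where "N = degree (shift (\<lambda>k. - one_shift k) f)"
  have D0: "D j f = 0" if "j > N" for j
    using that by (simp add: N_def shc_eq_0)
  have DE0: "D j (E b f) = 0" if "j > N \<or> b > r" for j b
  proof (cases "b > r")
    case True
    thus ?thesis using f by simp
  next
    case False
    thus ?thesis using that D0 by (simp add: shc_commute[where a=j])
  qed
  \<comment> \<open>The value of E_{k-b} q_{r+j} under the uniform rule. It depends on j and b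
    through j + b only, which permits summation along antidiagonals.\<close>
  define c where "c n = (if k \<le> r + n then pconst (1 - tvar) * qsym (r + n - k) else 0)" for n
  have Ek: "E (k - b) (qsym (r + j)) = c (j + b) + (if b = k then pconst tvar * qsym (r + j) else 0)" if "b \<le> k" for b j
  proof (cases "b = k")
    case True
    thus ?thesis by (simp add: shc_qsym c_def distrib_right[symmetric] single_add[symmetric])
  next
    case False
    hence "k - b \<le> r + j \<longleftrightarrow> k \<le> r + (j + b)" "k - b \<noteq> 0" "r + j - (k - b) = r + (j + b) - k"
      using that by auto
    thus ?thesis using False by (simp add: shc_qsym c_def)
  qed
  have "E k (hlrow r f) = (\<Sum>j\<le>N. \<Sum>i\<le>k. E i (qsym (r + j)) * E (k - i) (D j f))"
    by (simp add: hlrow_def N_def shc_sum shc_mult)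
  also have "\<dots> = (\<Sum>j\<le>N. \<Sum>b\<le>k. E (k - b) (qsym (r + j)) * D j (E b f))"
  proof (rule sum.cong[OF refl])
    fix j
    show "(\<Sum>i\<le>k. E i (qsym (r + j)) * E (k - i) (D j f)) = (\<Sum>b\<le>k. E (k - b) (qsym (r + j)) * D j (E b f))"
      by (rule sum.reindex_bij_witness[of _ "\<lambda>i. k - i" "\<lambda>i. k - i"]) (auto simp: shc_commute)
  qed
  also have "\<dots> = (\<Sum>j\<le>N. \<Sum>b\<le>k. c (j + b) * D j (E b f)
      + (if b = k then pconst tvar * qsym (r + j) * D j (E k f) else 0))"
    by (intro sum.cong refl) (simp add: Ek distrib_right)
  also have "\<dots> = (\<Sum>j\<le>N. \<Sum>b\<le>k. c (j + b) * D j (E b f)) + (\<Sum>j\<le>N. pconst tvar * qsym (r + j) * D j (E k f))"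
    by (simp add: sum.distrib)
  \<comment> \<open>Terms outside the rectangle vanish: D_j f = 0 for j > N, and E_b f = 0 for b > k
    \<ge> r.\<close>
  also have "(\<Sum>j\<le>N. \<Sum>b\<le>k. c (j + b) * D j (E b f)) = (\<Sum>n\<le>N + k. \<Sum>b\<le>n. c (n - b + b) * D (n - b) (E b f))"
    by (rule sum_rect_triangle) (use k in \<open>auto simp: DE0\<close>)
  also have "\<dots> = (\<Sum>n\<le>N + k. c n * (\<Sum>b\<le>n. D (n - b) (E b f)))"
    by (simp add: sum_distrib_left)
  \<comment> \<open>The inner sum is the y^n coefficient of D(y) E(y) f, hence 0 unless n =
    0.\<close>
  also have "\<dots> = (\<Sum>n\<le>N + k. if n = 0 then c 0 * f else 0)"
    by (intro sum.cong refl) (simp add: shc_inverse[of one_shift])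
  also have "\<dots> = c 0 * f" by simp
  also have "(\<Sum>j\<le>N. pconst tvar * qsym (r + j) * D j (E k f)) = pconst tvar * hlrow r (E k f)"
    by (subst hlrow_eq[of N]) (auto simp: DE0 sum_distrib_left mult.assoc)
  finally show ?thesis using k f[of k]
    by (auto simp: c_def hlrow_def)
qed

text \<open>Each repetition of the leading part r sends the factor 1 - t^m to (1 - t) + t (1 - t^m)
  = 1 - t^{m+1}. Both claims go through one induction, since applying \<open>E_hlrow\<close> to the
  tail requires its vanishing above r.\<close>

lemma E_HLQ:
  assumes "sorted_wrt (\<ge>) xs" "0 \<notin> set xs"
  shows E_HLQ_above: "\<And>k. (case xs of [] \<Rightarrow> 0 | r # _ \<Rightarrow> r) < k \<Longrightarrow> E k (HLQ xs) = 0"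
    and E_HLQ_top: "xs = r # ys \<Longrightarrow> E r (HLQ xs) = pconst (1 - tvar ^ count_list xs r) * HLQ ys"
proof -
  have "(\<forall>k. (case xs of [] \<Rightarrow> 0 | r # _ \<Rightarrow> r) < k \<longrightarrow> E k (HLQ xs) = 0)
    \<and> (case xs of [] \<Rightarrow> True | r # ys \<Rightarrow> E r (HLQ xs) = pconst (1 - tvar ^ count_list xs r) * HLQ ys)"
    using assms
  proof (induction xs)
    case Nil
    show ?case by simp
  next
    case (Cons r xs)
    define h where "h = (case xs of [] \<Rightarrow> 0 | r # _ \<Rightarrow> r)"
    have hr: "h \<le> r" using Cons.prems by (auto simp: h_def split: list.split)
    have 0: "E j (HLQ xs) = 0" if "j > h" for j
      using Cons that by (auto simp: h_def)
    hence 1: "E j (HLQ xs) = 0" if "j > r" for j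
      using hr that by auto
    have E_r: "E r (HLQ (r # xs)) = pconst (1 - tvar) * HLQ xs + pconst tvar * hlrow r (E r (HLQ xs))"
      unfolding HLQ_Cons by (subst E_hlrow[OF 1]) auto
    have 2: "E r (HLQ (r # xs)) = pconst (1 - tvar ^ count_list (r # xs) r) * HLQ xs"
    proof (cases "h = r")
      case True
      then obtain ys where xs: "xs = r # ys"
        using Cons.prems by (cases xs) (auto simp: h_def)
      have "E r (HLQ xs) = pconst (1 - tvar ^ count_list xs r) * HLQ ys"
        using Cons by (auto simp: xs)
      hence "hlrow r (E r (HLQ xs)) = pconst (1 - tvar ^ count_list xs r) * HLQ xs"
        by (simp only: hlrow_pconst_mult xs HLQ_Cons)
      hence "E r (HLQ (r # xs)) = pconst (1 - tvar + tvar * (1 - tvar ^ count_list xs r)) * HLQ xs"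
        unfolding E_r by (simp only: single_add distrib_right mult_single mult.assoc[symmetric] add_0_left)
      also have "1 - tvar + tvar * (1 - tvar ^ count_list xs r) = 1 - tvar ^ count_list (r # xs) r"
        unfolding right_diff_distrib by simp
      finally show ?thesis .
    next
      case False
      hence "r \<notin> set xs" "E r (HLQ xs) = 0"
        using hr Cons.prems 0 by (cases xs; fastforce simp: h_def)+
      thus ?thesis unfolding E_r by (simp add: hlrow_def count_notin)
    qed
    have "E k (HLQ (r # xs)) = 0" if "k > r" for k
      unfolding HLQ_Cons using that by (subst E_hlrow[OF 1]) auto
    with 2 show ?case by simp
  qed
  thus "\<And>k. (case xs of [] \<Rightarrow> 0 | r # _ \<Rightarrow> r) < k \<Longrightarrow> E k (HLQ xs) = 0"
    "xs = r # ys \<Longrightarrow> E r (HLQ xs) = pconst (1 - tvar ^ count_list xs r) * HLQ ys"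
    by auto
qed

text \<open>This is b_lambda(t): reading along the list, a part with m copies still ahead, itself
  included, contributes 1 - t^m.\<close>

fun HLb :: "nat list \<Rightarrow> complex poly" where
  "HLb [] = 1"
| "HLb (r # xs) = (1 - tvar ^ count_list (r # xs) r) * HLb xs"

text \<open>h_{r+k} moves to the right as E_{r+k}, which annihilates Q_ys for k > 0 because no part
  exceeds r. Only k = 0 remains, and E_r strips a leading part r from Q_ys.\<close>

lemma pip_HLQ'_HLQ_Cons:
  assumes ys: "sorted_wrt (\<ge>) ys" "0 \<notin> set ys" and r: "r > 0" "\<forall>y\<in>set ys. y \<le> r"
  shows "pip (HLQ' (r # xs)) (HLQ ys)
    = (if ys \<noteq> [] \<and> hd ys = r then (1 - tvar ^ count_list ys r) * pip (HLQ' xs) (HLQ (tl ys)) else 0)"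
proof -
  have above: "E (r + k) (HLQ ys) = 0" if "k > 0 \<or> \<not> (ys \<noteq> [] \<and> hd ys = r)" for k
    by (rule E_HLQ_above[OF ys]) (use that r in \<open>auto split: list.splits\<close>)
  let ?N = "degree (shift (\<lambda>k. tvar ^ k - 1) (HLQ' xs))"
  have "pip (HLQ' (r # xs)) (HLQ ys) = (\<Sum>k\<le>?N. pip (D' k (HLQ' xs)) (E (r + k) (HLQ ys)))"
    by (simp add: pip_sum_left pip_hsym_left)
  also have "\<dots> = (\<Sum>k\<in>{0}. pip (D' k (HLQ' xs)) (E (r + k) (HLQ ys)))"
    by (rule sum.mono_neutral_right) (auto simp: above)
  also have "\<dots> = pip (HLQ' xs) (E r (HLQ ys))"
    by (simp add: shc_0)
  also have "E r (HLQ ys) = (if ys \<noteq> [] \<and> hd ys = r then pconst (1 - tvar ^ count_list ys r) * HLQ (tl ys) else 0)"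
    using above[of 0] E_HLQ_top[OF ys, of "hd ys" "tl ys"] by (cases ys) auto
  finally show ?thesis by (simp add: pip_pconst_right del: diff_Suc_Suc)
qed

text \<open>Self-adjointness of \<open>phi\<close> makes the pairing symmetric, so the list with the
  larger leading part may be put on the left; equal leading parts are then removed together, which
  lowers the total length.\<close>

lemma pip_HLQ'_HLQ:
  assumes "sorted_wrt (\<ge>) xs" "0 \<notin> set xs" "sorted_wrt (\<ge>) ys" "0 \<notin> set ys"
  shows "pip (HLQ' xs) (HLQ ys) = (if xs = ys then HLb xs else 0)"
  using assms
proof (induction "length xs + length ys" arbitrary: xs ys rule: less_induct)
  case less
  have swap: "pip (HLQ' xs) (HLQ ys) = pip (HLQ' ys) (HLQ xs)" for xs ys
    by (simp add: HLQ_def pip_phi[of "HLQ' xs"]) (rule pip_commute)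
  have main: "pip (HLQ' xs) (HLQ ys) = (if xs = ys then HLb xs else 0)"
    if "length xs + length ys = n" "sorted_wrt (\<ge>) xs" "0 \<notin> set xs" "sorted_wrt (\<ge>) ys" "0 \<notin> set ys"
      "xs = r # xs'" "\<forall>y\<in>set ys. y \<le> r" "n = length xs + length ys"
      and IH: "\<And>xs' ys'. length xs' + length ys' < n \<Longrightarrow> sorted_wrt (\<ge>) xs' \<Longrightarrow> 0 \<notin> set xs' \<Longrightarrow>
        sorted_wrt (\<ge>) ys' \<Longrightarrow> 0 \<notin> set ys' \<Longrightarrow> pip (HLQ' xs') (HLQ ys') = (if xs' = ys' then HLb xs' else 0)"
    for xs ys n r xs'
  proof (cases "ys \<noteq> [] \<and> hd ys = r")
    case True
    then obtain ys' where ys: "ys = r # ys'" by (cases ys) auto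
    have "pip (HLQ' xs) (HLQ ys) = (1 - tvar ^ count_list ys r) * pip (HLQ' xs') (HLQ ys')"
      unfolding \<open>xs = r # xs'\<close> by (subst pip_HLQ'_HLQ_Cons) (use that ys in auto)
    also have "pip (HLQ' xs') (HLQ ys') = (if xs' = ys' then HLb xs' else 0)"
      by (rule IH) (use that ys in auto)
    finally show ?thesis using ys that by auto
  next
    case False
    have "pip (HLQ' xs) (HLQ ys) = 0"
      unfolding \<open>xs = r # xs'\<close> by (subst pip_HLQ'_HLQ_Cons) (use that False in auto)
    thus ?thesis using False that by auto
  qed
  note IH = less(1)
  show ?case
  proof (cases xs)
    case Nil
    show ?thesis
    proof (cases ys)
      case Nil
      thus ?thesis using \<open>xs = []\<close>
        using pip_mono_left[of 0 1 "1 :: complex poly pol"] by (simp add: zee_def)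
    next
      case (Cons s ys')
      have "pip (HLQ' ys) (HLQ xs) = (if ys = xs then HLb ys else 0)"
        by (rule main[OF _ _ _ _ _ Cons]) (use Nil less Cons IH in auto)
      thus ?thesis using swap[of xs ys] by auto
    qed
  next
    case (Cons r xs')
    show ?thesis
    proof (cases "\<forall>y\<in>set ys. y \<le> r")
      case True
      show ?thesis
        by (rule main[OF _ _ _ _ _ Cons]) (use Cons less True IH in auto)
    next
      case False
      then obtain s ys' where ys: "ys = s # ys'" "s > r"
        using less.prems by (cases ys) auto
      have "pip (HLQ' ys) (HLQ xs) = (if ys = xs then HLb ys else 0)"
        by (rule main[OF _ _ _ _ _ ys(1)]) (use Cons less ys IH in auto)
      thus ?thesis using swap[of xs ys] by auto
    qed
  qed
qed

lemmas partition_defs = partitions_of_def is_partition_def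

section \<open>Homogeneous components\<close>

text \<open>Besides fixing the degree this excludes p_0, since the keys have to be
  partitions.\<close>

definition homog :: "nat \<Rightarrow> 'a::zero pol \<Rightarrow> bool" where
  "homog n f \<longleftrightarrow> keys f \<subseteq> partitions_of n"

lemma homog_0 [simp]: "homog n 0"
  by (simp add: homog_def)

lemma homog_add: "homog n f \<Longrightarrow> homog n g \<Longrightarrow> homog n (f + g)"
  using Poly_Mapping.keys_add[of f g] by (auto simp: homog_def)

lemma homog_sum: "(\<And>i. i \<in> X \<Longrightarrow> homog n (f i)) \<Longrightarrow> homog n (\<Sum>i\<in>X. f i)"
  by (induction X rule: infinite_finite_induct) (simp_all add: homog_add)

lemma homog_pmono: "\<rho> \<in> partitions_of n \<Longrightarrow> homog n (pmono \<rho> c)"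
  by (simp add: homog_def)

lemma partitions_of_add: "\<rho> \<in> partitions_of m \<Longrightarrow> \<sigma> \<in> partitions_of n \<Longrightarrow> \<rho> + \<sigma> \<in> partitions_of (m + n)"
  by (auto simp: partition_defs)

lemma homog_mult: "homog m f \<Longrightarrow> homog n g \<Longrightarrow> homog (m + n) (f * g)"
  using keys_mult[of f g] partitions_of_add unfolding homog_def by blast

lemma homog_pconst: "homog 0 (pconst c)"
  by (rule homog_pmono) (simp add: partition_defs)

lemma homog_pconst_mult: "homog n f \<Longrightarrow> homog n (pconst c * f)"
  using homog_mult[OF homog_pconst[of c], of n f] by simp

lemma homog_1: "homog 0 (1 :: 'a::comm_ring_1 pol)"
  using homog_pconst[of "1::'a"] by simp

lemma homog_pvar: "k > 0 \<Longrightarrow> homog k (pvar k)"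
  by (rule homog_pmono) (simp add: partition_defs)

lemma homog_induct [consumes 1, case_names mono add]:
  assumes "homog n f" and "\<And>\<rho> c. \<rho> \<in> partitions_of n \<Longrightarrow> P (pmono \<rho> c)"
    and "\<And>f g. P f \<Longrightarrow> P g \<Longrightarrow> P (f + g)" and "P 0"
  shows "P (f :: 'a::comm_monoid_add pol)"
proof -
  have "P (\<Sum>\<rho>\<in>X. pmono \<rho> (lookup f \<rho>))" if "finite X" "X \<subseteq> partitions_of n" for X
    using that by (induction X rule: finite_induct) (auto intro: assms)
  from this[of "keys f"] assms(1) show ?thesis
    by (simp add: poly_mapping_sum_monomials homog_def)
qed

lemma homog_hsym: "homog n (hsym n)"
proof (induction n rule: less_induct)
  case (less n)
  show ?case
  proof (cases n)
    case 0
    thus ?thesis by (simp add: homog_1)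
  next
    case (Suc m)
    have "homog n (pvar (Suc k) * hsym (m - k))" if "k \<le> m" for k
      using homog_mult[OF homog_pvar[of "Suc k"] less[of "m - k"]] that by (simp add: Suc)
    thus ?thesis by (auto simp: Suc intro!: homog_pconst_mult homog_sum)
  qed
qed

text \<open>With y of degree 1, the substitution p_k -> p_k + s_k y^k preserves the degree.\<close>

lemma homog_shc:
  fixes f :: "'a::comm_ring_1 pol"
  assumes "homog n f"
  shows "if k \<le> n then homog (n - k) (shc s k f) else shc s k f = 0"
  using assms
proof (induction f rule: homog_induct)
  case (mono \<rho> c)
  thus ?case
  proof (induction \<rho> arbitrary: n k)
    case empty
    thus ?case by (auto simp: partitions_of_def shc_pconst homog_pconst simp del: shift_pconst)
  next
    case (add i \<rho>)
    let ?f = "pmono \<rho> c"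
    from add.prems have i: "i > 0" "i \<le> n" and \<rho>: "\<rho> \<in> partitions_of (n - i)"
      by (auto simp: partition_defs)
    have *: "shc s k (pmono (add_mset i \<rho>) c) = pvar i * shc s k ?f + (if i \<le> k then pconst (s i) * shc s (k - i) ?f else 0)" for k
      using shc_pvar_mult[where s=s and n=k and k=i and f="?f"] by (simp add: mult_single)
    note IH = add.IH[OF \<rho>]
    show ?case
    proof (cases "k \<le> n")
      case True
      have 1: "homog (n - k) (pvar i * shc s k ?f)"
      proof (cases "k \<le> n - i")
        case True
        thus ?thesis using homog_mult[OF homog_pvar[OF i(1)], of "n - i - k" "shc s k ?f"] IH[of k] i
          by simp
      qed (use IH[of k] in simp)
      have 2: "homog (n - k) (pconst (s i) * shc s (k - i) ?f)" if "i \<le> k"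
      proof -
        have "k - i \<le> n - i" "n - i - (k - i) = n - k" using that i True by auto
        thus ?thesis using IH[of "k - i"] by (intro homog_pconst_mult) simp
      qed
      show ?thesis using True 1 2 unfolding * by (auto intro: homog_add)
    next
      case False
      thus ?thesis using IH[of k] IH[of "k - i"] i unfolding * by auto
    qed
  qed
qed (auto simp: shc_add homog_add)

lemma homog_HLQ': "homog (sum_list xs) (HLQ' xs)"
proof (induction xs)
  case (Cons r xs)
  have "homog (r + sum_list xs) (hsym (r + k) * D' k (HLQ' xs))" for k
  proof (cases "k \<le> sum_list xs")
    case True
    thus ?thesis
      using homog_shc[OF Cons, of k] homog_mult[OF homog_hsym[of "r + k"], of "sum_list xs - k" "D' k (HLQ' xs)"]
      by simp
  next
    case False
    thus ?thesis using homog_shc[OF Cons, of k] by simp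
  qed
  thus ?case by (auto intro!: homog_sum)
qed (simp add: homog_1)

lemma homog_phi: "homog n f \<Longrightarrow> homog n (phi f)"
  by (induction f rule: homog_induct) (simp_all add: phi_pmono homog_pmono phi.hom_add homog_add)

lemma homog_HLQ: "homog (sum_list xs) (HLQ xs)"
  unfolding HLQ_def by (rule homog_phi[OF homog_HLQ'])

section \<open>Generation by the dual Hall--Littlewood functions\<close>

interpretation pol: Modules.module "\<lambda>c f. pconst c * f :: 'a::comm_ring_1 pol"
  by standard (simp_all add: distrib_left distrib_right single_add mult_single mult.assoc[symmetric])

definition plists :: "nat \<Rightarrow> nat list set" where
  "plists n = {xs. sorted_wrt (\<ge>) xs \<and> 0 \<notin> set xs \<and> sum_list xs = n}"

abbreviation qspan :: "nat \<Rightarrow> complex poly pol set" where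
  "qspan n \<equiv> pol.span (HLQ' ` plists n)"

text \<open>The recursion for Q' is solved for its term k = 0: if no part of nu exceeds r, then h_r
  Q'_nu is Q'_{(r,nu)} up to products with h_{r+k}, k > 0. If the leading part s exceeds r,
  expanding Q'_nu brings some h_{s+k} to the front instead. Either way the index in front grows, so
  induction on n - r applies.\<close>

lemma hsym_mult_qspan:
  assumes IH: "\<And>m f. m < n \<Longrightarrow> homog m f \<Longrightarrow> f \<in> qspan m"
    and "r > 0" "r \<le> n" "homog (n - r) g"
  shows "hsym r * g \<in> qspan n"
  using assms(2-4)
proof (induction "n - r" arbitrary: r g rule: less_induct)
  case less
  have down: "hsym s * g' \<in> qspan n" if "s > r" "s \<le> n" "homog (n - s) g'" for s g'
    using less.hyps[of s g'] that less.prems by auto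
  have gen: "hsym r * HLQ' \<nu> \<in> qspan n" if \<nu>: "\<nu> \<in> plists (n - r)" for \<nu>
  proof (cases "\<forall>y\<in>set \<nu>. y \<le> r")
    case True
    hence "r # \<nu> \<in> plists n" using \<nu> less.prems by (auto simp: plists_def)
    hence 1: "HLQ' (r # \<nu>) \<in> qspan n" by (intro pol.span_base imageI)
    have h: "homog (n - r) (HLQ' \<nu>)" using homog_HLQ'[of \<nu>] \<nu> by (simp add: plists_def)
    have 2: "hsym (r + k) * D' k (HLQ' \<nu>) \<in> qspan n" if "k > 0" for k
    proof (cases "k \<le> n - r")
      case True
      thus ?thesis using homog_shc[OF h, of k] that less.prems by (intro down) auto
    next
      case False
      thus ?thesis using homog_shc[OF h, of k] by (simp add: pol.span_zero)
    qed
    let ?N = "degree (shift (\<lambda>k. tvar ^ k - 1) (HLQ' \<nu>))"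
    have "HLQ' (r # \<nu>) = hsym r * HLQ' \<nu> + (\<Sum>k\<in>{1..?N}. hsym (r + k) * D' k (HLQ' \<nu>))"
      using sum.atLeast0_atMost_Suc_shift sum.atLeast_Suc_atMost[of 0 ?N "\<lambda>k. hsym (r + k) * D' k (HLQ' \<nu>)"]
      by (simp add: atLeast0AtMost shc_0)
    hence "hsym r * HLQ' \<nu> = HLQ' (r # \<nu>) - (\<Sum>k\<in>{1..?N}. hsym (r + k) * D' k (HLQ' \<nu>))"
      by simp
    thus ?thesis
      using 1 2 by (auto intro!: pol.span_diff pol.span_sum)
  next
    case False
    then obtain s \<nu>' where \<nu>': "\<nu> = s # \<nu>'" "s > r"
      using \<nu> by (cases \<nu>) (auto simp: plists_def)
    define m where "m = sum_list \<nu>'"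
    have m: "n = r + s + m" using \<nu> \<nu>' less.prems by (auto simp: plists_def m_def)
    have h: "homog m (HLQ' \<nu>')" using homog_HLQ'[of \<nu>'] by (simp add: m_def)
    have 2: "hsym (s + k) * (hsym r * D' k (HLQ' \<nu>')) \<in> qspan n" for k
    proof (cases "k \<le> m")
      case True
      hence "homog (n - (s + k)) (hsym r * D' k (HLQ' \<nu>'))"
        using homog_shc[OF h, of k] homog_mult[OF homog_hsym[of r], of "m - k" "D' k (HLQ' \<nu>')"] by (simp add: m)
      with True show ?thesis using \<nu>' m by (intro down) auto
    next
      case False
      thus ?thesis using homog_shc[OF h, of k] by (simp add: pol.span_zero)
    qed
    have "hsym r * HLQ' \<nu> = (\<Sum>k\<le>degree (shift (\<lambda>k. tvar ^ k - 1) (HLQ' \<nu>')). hsym (s + k) * (hsym r * D' k (HLQ' \<nu>')))"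
      by (simp add: \<nu>' sum_distrib_left mult.left_commute)
    thus ?thesis using 2 by (auto intro: pol.span_sum)
  qed
  have "g \<in> qspan (n - r)" using less.prems by (intro IH) auto
  thus ?case
  proof (induction rule: pol.span_induct)
    case base
    show ?case
      by (rule pol.subspaceI)
         (auto simp: pol.span_zero distrib_left mult.left_commute[of "hsym r"] intro: pol.span_add pol.span_scale)
  qed (use gen in auto)
qed

text \<open>Newton's identity p_k = k h_k - sum_{j<k} p_j h_{k-j} reduces multiplication by p_k to
  multiplication by complete functions; a nonempty monomial is such a product with p_k.\<close>

lemma homog_in_qspan: "homog n f \<Longrightarrow> f \<in> qspan n"
proof (induction n arbitrary: f rule: less_induct)
  case (less n)
  have h: "hsym r * g \<in> qspan n" if "r > 0" "r \<le> n" "homog (n - r) g" for r g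
    using hsym_mult_qspan[OF less.IH that] .
  have p: "pvar k * g \<in> qspan n" if "k > 0" "k \<le> n" "homog (n - k) g" for k g
    using that
  proof (induction k arbitrary: g rule: less_induct)
    case (less k)
    have "of_nat k * hsym k = pvar k + (\<Sum>j=1..<k. pvar j * hsym (k - j))"
    proof -
      have "{1..k} = insert k {1..<k}" using \<open>k > 0\<close> by auto
      thus ?thesis unfolding newtonD[OF newton_hsym, of k] by simp
    qed
    hence "pvar k = of_nat k * hsym k - (\<Sum>j=1..<k. pvar j * hsym (k - j))"
      by simp
    hence "pvar k * g = pconst (of_nat k) * (hsym k * g) - (\<Sum>j=1..<k. pvar j * (hsym (k - j) * g))"
      by (simp only: left_diff_distrib sum_distrib_right mult.assoc of_nat_pol)
    also have "\<dots> \<in> qspan n"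
    proof (intro pol.span_diff pol.span_scale pol.span_sum h)
      fix j assume j: "j \<in> {1..<k}"
      have "homog (n - j) (hsym (k - j) * g)"
        using homog_mult[OF homog_hsym[of "k - j"] less.prems(3)] j less.prems by simp
      thus "pvar j * (hsym (k - j) * g) \<in> qspan n" using j less.prems by (intro less.IH) auto
    qed (use less.prems in auto)
    finally show ?case .
  qed
  from less.prems show ?case
  proof (induction f rule: homog_induct)
    case (mono \<rho> c)
    show ?case
    proof (cases "\<rho> = {#}")
      case True
      hence "n = 0" using mono by (auto simp: partitions_of_def)
      hence "1 \<in> qspan n" by (intro pol.span_base image_eqI[of _ _ "[]"]) (auto simp: plists_def)
      thus ?thesis using pol.span_scale[of 1 _ c] True by simp
    next
      case False
      then obtain k \<sigma> where \<rho>: "\<rho> = add_mset k \<sigma>" by (metis multiset_cases)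
      have "pvar k * pmono \<sigma> c \<in> qspan n"
        using mono by (intro p homog_pmono) (auto simp: \<rho> partition_defs)
      thus ?thesis by (simp add: \<rho> mult_single)
    qed
  qed (auto intro: pol.span_add pol.span_zero)
qed

section \<open>The Hall--Littlewood \<open>P\<close>-functions\<close>

lemma one_minus_tvar_power_neq_0: "k > 0 \<Longrightarrow> 1 - tvar ^ k \<noteq> 0"
proof
  assume "k > 0" "1 - tvar ^ k = 0"
  hence "poly (1 - tvar ^ k) 0 = 0" by simp
  with \<open>k > 0\<close> show False by (simp add: power_0_left)
qed

lemma HLb_neq_0: "HLb xs \<noteq> 0"
proof (induction xs)
  case (Cons r xs)
  have "1 - tvar ^ count_list (r # xs) r \<noteq> 0" by (rule one_minus_tvar_power_neq_0) simp
  thus ?case using Cons by (simp only: HLb.simps mult_eq_0_iff) simp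
qed simp

text \<open>On the generators Q'_ys of the span the pairing is b_xs or 0, and the coefficients of a
  combination lie in C[t].\<close>

lemma HLb_dvd:
  assumes "xs \<in> plists m" "homog n g"
  shows "HLb xs dvd pip g (HLQ xs)"
  using homog_in_qspan[OF assms(2)]
proof (induction rule: pol.span_induct)
  case base
  show ?case by (rule pol.subspaceI) (auto simp: pip_add_left pip_pconst_left)
next
  case (step x)
  thus ?case using assms by (auto simp: plists_def pip_HLQ'_HLQ)
qed

text \<open>P = Q / b, divided coefficientwise; for \<open>xs\<close> in \<open>plists\<close> the
  polynomial \<open>div\<close> is exact by the divisibility of all pairings.\<close>

definition HLP :: "nat list \<Rightarrow> complex poly pol" where
  "HLP xs = (\<Sum>\<rho>\<in>keys (HLQ xs). pmono \<rho> (lookup (HLQ xs) \<rho> div HLb xs))"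

lemma homog_HLP: "homog (sum_list xs) (HLP xs)"
  unfolding HLP_def using homog_HLQ[of xs] by (intro homog_sum homog_pmono) (auto simp: homog_def)

lemma zee_neq_0: "is_partition \<rho> \<Longrightarrow> zee \<rho> \<noteq> 0"
  by (auto simp: zee_def is_partition_def intro!: gr0I)

text \<open>The coefficient of p_rho in Q is the pairing with p_rho / z_rho, so divisibility of
  pairings is divisibility of coefficients.\<close>

lemma pconst_HLb_HLP:
  assumes "xs \<in> plists m"
  shows "pconst (HLb xs) * HLP xs = HLQ xs"
proof -
  have "HLb xs * (lookup (HLQ xs) \<rho> div HLb xs) = lookup (HLQ xs) \<rho>"
    if "\<rho> \<in> keys (HLQ xs)" for \<rho>
  proof -
    have \<rho>: "\<rho> \<in> partitions_of (sum_list xs)" using that homog_HLQ[of xs] by (auto simp: homog_def)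
    hence z: "zee \<rho> \<noteq> 0" by (auto simp: partitions_of_def zee_neq_0)
    have "HLb xs dvd pip (pmono \<rho> [:1 / of_nat (zee \<rho>):]) (HLQ xs)"
      by (rule HLb_dvd[OF assms homog_pmono[OF \<rho>]])
    also have "pip (pmono \<rho> [:1 / of_nat (zee \<rho>):]) (HLQ xs) = lookup (HLQ xs) \<rho>"
      using z by (simp add: pip_mono_left of_nat_poly)
    finally show ?thesis by simp
  qed
  hence "pconst (HLb xs) * HLP xs = (\<Sum>\<rho>\<in>keys (HLQ xs). pmono \<rho> (lookup (HLQ xs) \<rho>))"
    unfolding HLP_def sum_distrib_left by (intro sum.cong) (simp_all add: mult_single)
  thus ?thesis by (simp add: poly_mapping_sum_monomials)
qed

lemma pip_HLQ'_HLP: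
  assumes "xs \<in> plists m" "ys \<in> plists n"
  shows "pip (HLQ' xs) (HLP ys) = (if xs = ys then 1 else 0)"
proof -
  have "HLb ys * pip (HLQ' xs) (HLP ys) = pip (HLQ' xs) (HLQ ys)"
    by (simp add: pconst_HLb_HLP[OF assms(2), symmetric] pip_pconst_right)
  also have "\<dots> = (if xs = ys then HLb ys else 0)"
    using assms by (auto simp: pip_HLQ'_HLQ plists_def)
  finally have "HLb ys * pip (HLQ' xs) (HLP ys) = HLb ys * (if xs = ys then 1 else 0)" by simp
  thus ?thesis by (rule mult_left_cancel[OF HLb_neq_0, THEN iffD1])
qed

text \<open>Vanishing on all P gives vanishing on all Q = phi Q', hence on the image of every
  homogeneous polynomial under \<open>phi\<close>. As \<open>phi\<close> multiplies p_rho by the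
  nonzero prod (1 - t^k), every coefficient of f times z_rho is 0.\<close>

lemma pip_HLP_nondegenerate:
  assumes f: "keys f \<subseteq> Collect is_partition"
    and 0: "\<And>n xs. xs \<in> plists n \<Longrightarrow> pip f (HLP xs) = 0"
  shows "f = 0"
proof (rule poly_mapping_eqI)
  fix \<rho>
  show "lookup f \<rho> = lookup 0 \<rho>"
  proof (cases "is_partition \<rho>")
    case True
    have q: "pip f (phi g) = 0" if "homog n g" for g n
      using homog_in_qspan[OF that]
    proof (induction rule: pol.span_induct)
      case base
      show ?case by (rule pol.subspaceI) (auto simp: pip_add_right pip_pconst_right phi.hom_add phi.hom_mult)
    next
      case (step x)
      then obtain xs where xs: "xs \<in> plists n" "x = HLQ' xs" by auto
      have "pip f (phi x) = pip f (HLQ xs)" by (simp add: xs HLQ_def)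
      also have "\<dots> = HLb xs * pip f (HLP xs)" by (simp add: pconst_HLb_HLP[OF xs(1), symmetric] pip_pconst_right)
      finally show ?case using 0[OF xs(1)] by simp
    qed
    have "(\<Prod>k\<in>#\<rho>. 1 - tvar ^ k) \<noteq> 0"
      using True one_minus_tvar_power_neq_0 by (auto simp: prod_mset_zero_iff is_partition_def) (metis gr0I)
    moreover have "pip f (phi (pmono \<rho> 1)) = 0"
      by (rule q[OF homog_pmono]) (use True in \<open>simp add: partitions_of_def\<close>)
    ultimately have "of_nat (zee \<rho>) * lookup f \<rho> = 0"
      by (simp add: phi_pmono pip_commute[of f] pip_mono_left)
    thus ?thesis using zee_neq_0[OF True] by simp
  next
    case False
    thus ?thesis using f by (auto simp: in_keys_iff)
  qed
qed

section \<open>The power sum basis\<close>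

lemma mcoeff_0 [simp]: "mcoeff 0 \<alpha> = 0"
  by transfer simp

lemma mcoeff_1: "mcoeff 1 \<alpha> = (if \<alpha> = 0 then 1 else 0)"
  by transfer simp

lemma mcoeff_add [simp]: "mcoeff (f + g) \<alpha> = mcoeff f \<alpha> + mcoeff g \<alpha>"
  by transfer simp

lemma mcoeff_scale [simp]: "mcoeff (sf_scale c f) \<alpha> = c * mcoeff f \<alpha>"
  by transfer simp

lemma mcoeff_mult: "mcoeff (f * g) \<alpha> = (\<Sum>(\<beta>, \<gamma>)\<in>mon_splits \<alpha>. mcoeff f \<beta> * mcoeff g \<gamma>)"
  by transfer simp

lemma mcoeff_sum [simp]: "mcoeff (\<Sum>i\<in>X. f i) \<alpha> = (\<Sum>i\<in>X. mcoeff (f i) \<alpha>)"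
  by (induction X rule: infinite_finite_induct) simp_all

lemma mcoeff_psum: "mcoeff (psum k) \<alpha> = (if \<exists>i. \<alpha> = single i k then 1 else 0)"
  by (simp add: psum.rep_eq)

lemma single_add_minus:
  fixes \<alpha> :: "nat \<Rightarrow>\<^sub>0 nat"
  assumes "k \<le> lookup \<alpha> i"
  shows "single i k + (\<alpha> - single i k) = \<alpha>"
  by (rule poly_mapping_eqI) (use assms in \<open>auto simp: lookup_add lookup_minus lookup_single when_def\<close>)

lemma single_left_inj:
  fixes k :: nat
  assumes "k > 0" "single i k = single j k"
  shows "i = j"
  using arg_cong[OF assms(2), of keys] assms(1) by simp

lemma mcoeff_psum_mult:
  assumes "k > 0"
  shows "mcoeff (psum k * g) \<alpha>
    = (\<Sum>i | k \<le> lookup \<alpha> i. mcoeff g (\<alpha> - single i k))"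
proof -
  let ?h = "\<lambda>i. (single i k, \<alpha> - single i k)"
  let ?I = "{i. k \<le> lookup \<alpha> i}"
  have sub: "?h ` ?I \<subseteq> mon_splits \<alpha>"
    by (auto simp: mon_splits_def single_add_minus)
  have "p \<in> ?h ` ?I" if "p \<in> mon_splits \<alpha>" "fst p = single i k" for p i
  proof -
    have "single i k + snd p = \<alpha>" using that by (auto simp: mon_splits_def)
    hence "snd p = \<alpha> - single i k" "k \<le> lookup \<alpha> i"
      by (auto simp: lookup_add)
    with that(2) show ?thesis by (auto intro!: image_eqI[of _ _ i] simp: prod_eq_iff)
  qed
  hence "mcoeff (psum k * g) \<alpha> = (\<Sum>(\<beta>, \<gamma>)\<in>?h ` ?I. mcoeff (psum k) \<beta> * mcoeff g \<gamma>)"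
    unfolding mcoeff_mult by (intro sum.mono_neutral_right sub) (auto simp: mcoeff_psum)
  also have "\<dots> = (\<Sum>i\<in>?I. mcoeff (psum k) (single i k) * mcoeff g (\<alpha> - single i k))"
  proof (subst sum.reindex)
    show "inj_on ?h ?I" using single_left_inj[OF assms] by (auto simp: inj_on_def)
  qed simp
  finally show ?thesis by (auto simp: mcoeff_psum intro!: sum.cong)
qed

section \<open>Triangularity between power sums and monomials\<close>

definition mtype :: "(nat \<Rightarrow>\<^sub>0 nat) \<Rightarrow> nat multiset" where
  "mtype \<alpha> = image_mset (lookup \<alpha>) (mset_set (keys \<alpha>))"

lemma size_mtype [simp]: "size (mtype \<alpha>) = card (keys \<alpha>)"
  by (simp add: mtype_def)

lemma is_partition_mtype: "is_partition (mtype \<alpha>)"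
  by (auto simp: is_partition_def mtype_def in_keys_iff)

lemma sum_mset_mtype: "\<Sum>\<^sub># (mtype \<alpha>) = mon_degree \<alpha>"
  by (simp add: mtype_def mon_degree_def sum_unfold_sum_mset)

lemma count_mtype: "k > 0 \<Longrightarrow> count (mtype \<alpha>) k = card {i. lookup \<alpha> i = k}"
proof -
  assume "k > 0"
  hence "{i. lookup \<alpha> i = k} = {i \<in> keys \<alpha>. lookup \<alpha> i = k}"
    by (auto simp: in_keys_iff)
  thus ?thesis
    by (simp add: mtype_def count_image_mset' sum.If_cases Int_def eq_commute[of k])
qed

lemma keys_minus_single:
  fixes \<alpha> :: "nat \<Rightarrow>\<^sub>0 nat"
  assumes "k > 0" "k \<le> lookup \<alpha> i"
  shows "keys (\<alpha> - single i k)
    = (if lookup \<alpha> i = k then keys \<alpha> - {i} else keys \<alpha>)"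
  using assms by (auto simp: in_keys_iff lookup_minus lookup_single when_def split: if_splits)

lemma mtype_minus_single:
  assumes "k > 0" "lookup \<alpha> i = k"
  shows "mtype \<alpha> = add_mset k (mtype (\<alpha> - single i k))"
proof -
  have i: "i \<in> keys \<alpha>" using assms by (simp add: in_keys_iff)
  have "mtype (\<alpha> - single i k) = image_mset (lookup \<alpha>) (mset_set (keys \<alpha> - {i}))"
    unfolding mtype_def using assms
    by (auto simp: keys_minus_single lookup_minus lookup_single when_def intro!: image_mset_cong)
  moreover have "mset_set (keys \<alpha>) = add_mset i (mset_set (keys \<alpha> - {i}))"
    by (rule mset_set.remove[OF _ i]) simp
  ultimately show ?thesis using assms by (simp add: mtype_def)
qed

definition mfact :: "nat multiset \<Rightarrow> nat" where
  "mfact \<sigma> = (\<Prod>i\<in>set_mset \<sigma>. fact (count \<sigma> i))"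

lemma mfact_add_mset: "mfact (add_mset k \<sigma>) = (count \<sigma> k + 1) * mfact \<sigma>"
  unfolding mfact_def by (rule prod_count_add_mset) simp_all

lemma mfact_pos: "mfact \<sigma> > 0"
  by (simp add: mfact_def prod_pos)

lemma pprod_empty [simp]: "pprod {#} = 1"
  by (simp add: pprod_def)

lemma pprod_add_mset [simp]: "pprod (add_mset k \<sigma>) = psum k * pprod \<sigma>"
  by (simp add: pprod_def)

text \<open>The expansion of \<open>p\<^sub>\<sigma>\<close> into monomials is triangular with respect to the number of variables.\<close>

lemma mcoeff_pprod:
  assumes "is_partition \<sigma>" "size \<sigma> \<le> card (keys \<alpha>)"
  shows "mcoeff (pprod \<sigma> :: 'a::comm_ring_1 symfun) \<alpha> = (if mtype \<alpha> = \<sigma> then of_nat (mfact \<sigma>) else 0)"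
  using assms
proof (induction \<sigma> arbitrary: \<alpha>)
  case empty
  have "mtype \<alpha> = {#} \<longleftrightarrow> \<alpha> = 0"
    by (simp add: mtype_def mset_set_empty_iff)
  thus ?case by (simp add: mcoeff_1 mfact_def)
next
  case (add k \<sigma>)
  let ?I = "{i. k \<le> lookup \<alpha> i}"
  let ?J = "{i. lookup \<alpha> i = k}"
  have k: "k > 0" and \<sigma>: "is_partition \<sigma>" using add.prems by (auto simp: is_partition_def)
  have "?I \<subseteq> keys \<alpha>" using k by (auto simp: in_keys_iff)
  hence fin: "finite ?I" by (rule finite_subset) simp
  have 1: "mcoeff (pprod \<sigma> :: 'a symfun) (\<alpha> - single i k) = (if mtype \<alpha> = add_mset k \<sigma> then of_nat (mfact \<sigma>) else 0)"
    if "i \<in> ?J" for i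
  proof -
    have "size \<sigma> \<le> card (keys (\<alpha> - single i k))"
      using add.prems that k by (subst keys_minus_single) (auto simp: card_Diff_singleton_if)
    from add.IH[OF \<sigma> this] show ?thesis
      using mtype_minus_single[OF k, of \<alpha> i] that by auto
  qed
  \<comment> \<open>An exponent above k keeps its variable after the division, leaving more
    variables than \<open>\<sigma>\<close> has parts; such coefficients are 0.\<close>
  have 2: "mcoeff (pprod \<sigma> :: 'a symfun) (\<alpha> - single i k) = 0" if "i \<in> ?I - ?J" for i
  proof -
    have "card (keys (\<alpha> - single i k)) = card (keys \<alpha>)"
      using that k by (subst keys_minus_single) auto
    hence "size \<sigma> < card (keys (\<alpha> - single i k))"
      using add.prems by simp
    moreover from this have "mtype (\<alpha> - single i k) \<noteq> \<sigma>"
      by (metis size_mtype less_irrefl)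
    ultimately show ?thesis using add.IH[OF \<sigma>] by simp
  qed
  have "mcoeff (pprod (add_mset k \<sigma>) :: 'a symfun) \<alpha> = (\<Sum>i\<in>?J. mcoeff (pprod \<sigma> :: 'a symfun) (\<alpha> - single i k))"
    unfolding pprod_add_mset mcoeff_psum_mult[OF k]
    by (rule sum.mono_neutral_right[OF fin]) (use 2 in auto)
  also have "\<dots> = of_nat (card ?J) * (if mtype \<alpha> = add_mset k \<sigma> then of_nat (mfact \<sigma>) else 0)"
    using 1 by simp
  also have "card ?J = count (mtype \<alpha>) k"
    by (simp add: count_mtype[OF k])
  finally show ?case by (simp add: mfact_add_mset distrib_right)
qed

lemma mcoeff_pprod_degree:
  "is_partition \<sigma> \<Longrightarrow> mcoeff (pprod \<sigma> :: 'a::comm_ring_1 symfun) \<alpha> \<noteq> 0 \<Longrightarrow> mon_degree \<alpha> = \<Sum>\<^sub># \<sigma>"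
proof (induction \<sigma> arbitrary: \<alpha>)
  case empty
  thus ?case by (auto simp: mcoeff_1 split: if_splits)
next
  case (add k \<sigma>)
  have k: "k > 0" and \<sigma>: "is_partition \<sigma>" using add.prems by (auto simp: is_partition_def)
  have "mcoeff (psum k * pprod \<sigma> :: 'a symfun) \<alpha> \<noteq> 0" using add.prems by simp
  then obtain i where i: "k \<le> lookup \<alpha> i" "mcoeff (pprod \<sigma> :: 'a symfun) (\<alpha> - single i k) \<noteq> 0"
    unfolding mcoeff_psum_mult[OF k] by (auto dest: sum.not_neutral_contains_not_neutral)
  have "mon_degree (single i k) = k" by (simp add: mon_degree_def)
  thus ?case
    using add.IH[OF \<sigma> i(2)] mon_degree_add[of "single i k" "\<alpha> - single i k"]
    by (simp add: single_add_minus[OF i(1)])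
qed

lemma ex_mtype: "is_partition \<rho> \<Longrightarrow> \<exists>\<alpha>. mtype \<alpha> = \<rho>"
proof (induction \<rho>)
  case empty
  have "mtype 0 = {#}" by (simp add: mtype_def)
  thus ?case by blast
next
  case (add k \<rho>)
  then obtain \<alpha> where \<alpha>: "mtype \<alpha> = \<rho>" and k: "k > 0" by (auto simp: is_partition_def)
  obtain i where i: "i \<notin> keys \<alpha>"
    using ex_new_if_finite[OF infinite_UNIV_nat, of "keys \<alpha>"] by auto
  let ?\<beta> = "single i k + \<alpha>"
  have "lookup ?\<beta> i = k" using i by (simp add: lookup_add in_keys_iff)
  from mtype_minus_single[OF k this] have "mtype ?\<beta> = add_mset k \<rho>" using \<alpha> by simp
  thus ?case by blast
qed

definition Psi :: "'a::comm_ring_1 pol \<Rightarrow> 'a symfun" where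
  "Psi = lin (\<lambda>\<rho> a. sf_scale a (pprod \<rho>))"

lemma Psi_add: "Psi (f + g) = Psi f + Psi g"
  unfolding Psi_def by (rule lin_add) (simp_all add: symfun.scale_left_distrib)

lemma Psi_pmono: "Psi (pmono \<rho> a) = sf_scale a (pprod \<rho>)"
  by (simp add: Psi_def lin_mono)

lemma Psi_0 [simp]: "Psi 0 = 0"
  by (simp add: Psi_def lin_def)

lemma Psi_diff: "Psi (f - g) = Psi f - Psi g"
  using Psi_add[of "f - g" g] by simp

lemma Psi_sum: "Psi (\<Sum>i\<in>X. f i) = (\<Sum>i\<in>X. Psi (f i))"
  by (induction X rule: infinite_finite_induct) (simp_all add: Psi_add)

abbreviation part_supp :: "'a::zero pol \<Rightarrow> bool" where
  "part_supp f \<equiv> keys f \<subseteq> Collect is_partition"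

lemma part_supp_add: "part_supp f \<Longrightarrow> part_supp g \<Longrightarrow> part_supp (f + g)"
  using Poly_Mapping.keys_add[of f g] by auto

lemma homog_part_supp: "homog n f \<Longrightarrow> part_supp f"
  by (auto simp: homog_def partitions_of_def)

text \<open>At a monomial of type rho, with rho of maximal length among the keys, triangularity
  leaves the p_rho term alone, and its monomial coefficient prod m_i! is nonzero.\<close>

lemma Psi_eq_0:
  fixes f :: "'a::{idom, ring_char_0} pol"
  assumes f: "part_supp f" and 0: "Psi f = 0"
  shows "f = 0"
proof (rule ccontr)
  assume "f \<noteq> 0"
  let ?K = "keys f"
  have fin: "finite (size ` ?K)" and ne: "size ` ?K \<noteq> {}" using \<open>f \<noteq> 0\<close> by auto
  obtain \<rho> where \<rho>: "\<rho> \<in> ?K" "size \<rho> = Max (size ` ?K)"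
    using Max_in[OF fin ne] by force
  obtain \<alpha> where \<alpha>: "mtype \<alpha> = \<rho>" using \<rho> f ex_mtype by blast
  have "size \<sigma> \<le> card (keys \<alpha>)" if "\<sigma> \<in> ?K" for \<sigma>
  proof -
    have "size \<sigma> \<le> Max (size ` ?K)" by (rule Max_ge[OF fin]) (use that in simp)
    also have "\<dots> = card (keys \<alpha>)" using \<rho> \<alpha> size_mtype[of \<alpha>] by simp
    finally show ?thesis .
  qed
  hence c: "mcoeff (pprod \<sigma>) \<alpha> = (if \<sigma> = \<rho> then of_nat (mfact \<rho>) else (0::'a))" if "\<sigma> \<in> ?K" for \<sigma>
    using that f \<alpha> by (subst mcoeff_pprod) auto
  have "0 = mcoeff (Psi f) \<alpha>" by (simp add: 0)
  also have "\<dots> = (\<Sum>\<sigma>\<in>?K. lookup f \<sigma> * mcoeff (pprod \<sigma>) \<alpha>)"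
    by (simp add: Psi_def lin_def)
  also have "\<dots> = (\<Sum>\<sigma>\<in>?K. if \<sigma> = \<rho> then lookup f \<rho> * of_nat (mfact \<rho>) else 0)"
    by (rule sum.cong) (auto simp: c)
  also have "\<dots> = lookup f \<rho> * of_nat (mfact \<rho>)"
    using \<rho> by simp
  finally show False using \<rho> mfact_pos[of \<rho>] by (simp add: in_keys_iff)
qed

lemma Psi_inj:
  fixes f g :: "'a::{idom, ring_char_0} pol"
  assumes "part_supp f" "part_supp g" "Psi f = Psi g"
  shows "f = g"
  using Psi_eq_0[of "f - g"] assms keys_diff[of f g] by (auto simp: Psi_diff)

lemma inj_on_pprod: "inj_on (pprod :: _ \<Rightarrow> 'a::{idom, ring_char_0} symfun) (Collect is_partition)"
proof (rule inj_onI)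
  fix \<rho> \<sigma> :: "nat multiset"
  assume "\<rho> \<in> Collect is_partition" "\<sigma> \<in> Collect is_partition" "(pprod \<rho> :: 'a symfun) = pprod \<sigma>"
  hence "pmono \<rho> (1::'a) = pmono \<sigma> 1"
    by (intro Psi_inj) (auto simp: Psi_pmono)
  hence "keys (pmono \<rho> (1::'a)) = keys (pmono \<sigma> (1::'a))" by simp
  thus "\<rho> = \<sigma>" by simp
qed

abbreviation unpprod :: "'a::comm_ring_1 symfun \<Rightarrow> nat multiset" where
  "unpprod \<equiv> inv_into (Collect is_partition) pprod"

lemma independent_pprod:
  "symfun.independent ((pprod :: _ \<Rightarrow> 'a::{idom, ring_char_0} symfun) ` Collect is_partition)"
  unfolding symfun.independent_explicit_module
proof (intro allI impI)
  fix t and u :: "'a symfun \<Rightarrow> 'a" and v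
  assume t: "finite t" "t \<subseteq> pprod ` Collect is_partition" "(\<Sum>v\<in>t. sf_scale (u v) v) = 0" "v \<in> t"
  let ?f = "\<Sum>v\<in>t. pmono (unpprod v) (u v)"
  have un: "pprod (unpprod v) = v" "is_partition (unpprod v)" if "v \<in> t" for v
    using that t(2) f_inv_into_f[of v pprod] inv_into_into[of v pprod "Collect is_partition"] by auto
  have "Psi ?f = (\<Sum>v\<in>t. sf_scale (u v) v)"
    by (simp add: Psi_sum Psi_pmono un)
  moreover have "part_supp ?f"
    using Poly_Mapping.keys_sum[of "\<lambda>v. pmono (unpprod v) (u v)" t] un by (fastforce split: if_splits)
  ultimately have "?f = 0" using Psi_eq_0[of ?f] t(3) by simp
  hence "0 = lookup ?f (unpprod v)" by simp
  also have "\<dots> = (\<Sum>w\<in>t. if w = v then u v else 0)"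
    unfolding lookup_sum
  proof (rule sum.cong)
    fix w assume "w \<in> t"
    hence "unpprod w = unpprod v \<longleftrightarrow> w = v" using un t(4) by metis
    thus "lookup (pmono (unpprod w) (u w)) (unpprod v) = (if w = v then u v else 0)"
      by (auto simp: lookup_single when_def)
  qed simp
  finally show "u v = 0" using t by simp
qed

text \<open>\<open>pcoeff\<close> is defined by coordinates with respect to a set of basis vectors;
  injectivity of \<open>pprod\<close> on partitions lets these be indexed by partitions
  again.\<close>

lemma pcoeff_Psi:
  fixes f :: "'a::{idom, ring_char_0} pol"
  assumes f: "part_supp f" and \<rho>: "is_partition \<rho>"
  shows "pcoeff (Psi f) \<rho> = lookup f \<rho>"
proof -
  let ?B = "pprod ` Collect is_partition :: 'a symfun set"
  let ?g = "\<lambda>b. if b \<in> ?B then lookup f (unpprod b) else 0"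
  have un: "unpprod (pprod \<sigma> :: 'a symfun) = \<sigma>" if "is_partition \<sigma>" for \<sigma>
    using that by (simp add: inv_into_f_f[OF inj_on_pprod])
  have img: "{b. ?g b \<noteq> 0} = pprod ` keys f"
    using f un by (auto simp: in_keys_iff image_iff) (metis in_keys_iff mem_Collect_eq subsetD un)+
  have "(\<Sum>b | ?g b \<noteq> 0. sf_scale (?g b) b) = (\<Sum>\<sigma>\<in>keys f. sf_scale (?g (pprod \<sigma>)) (pprod \<sigma>))"
    unfolding img by (rule sum.reindex_cong[OF inj_on_subset[OF inj_on_pprod f]]) auto
  also have "\<dots> = Psi f"
    unfolding Psi_def lin_def
  proof (rule sum.cong[OF refl])
    fix \<sigma> assume "\<sigma> \<in> keys f"
    hence "is_partition \<sigma>" using f by blast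
    thus "sf_scale (?g (pprod \<sigma>)) (pprod \<sigma>) = sf_scale (lookup f \<sigma>) (pprod \<sigma>)"
      using un[of \<sigma>] by auto
  qed
  finally have sum: "(\<Sum>b | ?g b \<noteq> 0. sf_scale (?g b) b) = Psi f" .
  have "Psi f \<in> symfun.span ?B"
    unfolding Psi_def lin_def using f
    by (intro symfun.span_sum symfun.span_scale symfun.span_base) auto
  hence "symfun.representation ?B (Psi f) = ?g"
    using sum img by (intro symfun.representation_eqI[OF independent_pprod]) (auto split: if_splits)
  thus ?thesis using \<rho> un by (simp add: pcoeff_def)
qed

lemma pcoeff_support:
  fixes f :: "'a::{idom, ring_char_0} pol"
  assumes "part_supp f"
  shows "{\<mu>. is_partition \<mu> \<and> pcoeff (Psi f) \<mu> \<noteq> 0} = keys f"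
proof -
  have "is_partition \<mu> \<and> pcoeff (Psi f) \<mu> \<noteq> 0 \<longleftrightarrow> \<mu> \<in> keys f" for \<mu>
    using assms pcoeff_Psi[OF assms, of \<mu>] by (auto simp: in_keys_iff)
  thus ?thesis by blast
qed

lemma hall_Psi:
  fixes f g :: "'a::{idom, ring_char_0} pol"
  assumes f: "part_supp f" and g: "part_supp g"
  shows "hall (Psi f) (Psi g) = pip f g"
  unfolding hall_def pcoeff_support[OF f] pip_def lin_def
proof (rule sum.cong[OF refl])
  fix \<rho> assume "\<rho> \<in> keys f"
  hence "is_partition \<rho>" using f by blast
  thus "of_nat (zee \<rho>) * pcoeff (Psi f) \<rho> * pcoeff (Psi g) \<rho>
    = of_nat (zee \<rho>) * lookup f \<rho> * lookup g \<rho>"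
    by (simp add: pcoeff_Psi[OF f] pcoeff_Psi[OF g])
qed

section \<open>Every symmetric function is a polynomial in the power sums\<close>

lemma image_mset_eq_bij:
  assumes "finite K" "finite L" "image_mset f (mset_set K) = image_mset g (mset_set L)"
  shows "\<exists>h. bij_betw h K L \<and> (\<forall>i\<in>K. g (h i) = f i)"
  using assms
proof (induction K arbitrary: L rule: finite_induct)
  case empty
  hence "L = {}" by (metis image_mset_empty image_mset_is_empty_iff mset_set.empty mset_set_empty_iff)
  thus ?case by (auto simp: bij_betw_def)
next
  case (insert x K)
  have "f x \<in># image_mset g (mset_set L)"
    using insert by (metis image_mset_add_mset mset_set.insert union_single_eq_member)
  then obtain y where y: "y \<in> L" "g y = f x" using insert by auto
  have "mset_set L = add_mset y (mset_set (L - {y}))"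
    by (rule mset_set.remove) (use insert y in auto)
  hence "image_mset f (mset_set K) = image_mset g (mset_set (L - {y}))"
    using insert y by simp
  from insert.IH[OF _ this] insert.prems obtain h where h: "bij_betw h K (L - {y})" "\<forall>i\<in>K. g (h i) = f i"
    by auto
  have "bij_betw (h(x := y)) K (L - {y})"
    by (rule bij_betw_cong[THEN iffD1, OF _ h(1)]) (use insert in auto)
  hence "bij_betw (h(x := y)) (K \<union> {x}) ((L - {y}) \<union> {(h(x := y)) x})"
    by (intro notIn_Un_bij_betw) (use insert in auto)
  moreover have "(L - {y}) \<union> {(h(x := y)) x} = L" using y by auto
  ultimately have "bij_betw (h(x := y)) (insert x K) L" by simp
  moreover have "\<forall>i\<in>insert x K. g ((h(x := y)) i) = f i" using h y insert by auto
  ultimately show ?case by blast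
qed

text \<open>A bijection between the supports is extended over their union, where the two complements
  have equal size, and by the identity elsewhere.\<close>

lemma mtype_eq_ex_bij:
  assumes "mtype \<alpha> = mtype \<beta>"
  shows "\<exists>\<pi>. bij \<pi> \<and> Poly_Mapping.map_key \<pi> \<alpha> = \<beta>"
proof -
  let ?K = "keys \<beta>" and ?L = "keys \<alpha>"
  obtain h where h: "bij_betw h ?K ?L" "\<forall>i\<in>?K. lookup \<alpha> (h i) = lookup \<beta> i"
    using image_mset_eq_bij[of ?K ?L "lookup \<beta>" "lookup \<alpha>"] assms
    by (auto simp: mtype_def)
  let ?U = "?K \<union> ?L"
  have "card (?U - ?K) = card (?U - ?L)"
    using bij_betw_same_card[OF h(1)] by (simp add: card_Diff_subset)
  then obtain h' where h': "bij_betw h' (?U - ?K) (?U - ?L)"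
    using finite_same_card_bij[of "?U - ?K" "?U - ?L"] by auto
  define \<pi> where "\<pi> i = (if i \<in> ?K then h i else if i \<in> ?U then h' i else i)" for i
  have "bij_betw \<pi> ?K ?L" using h(1) by (rule bij_betw_cong[THEN iffD1, rotated]) (simp add: \<pi>_def)
  moreover have "bij_betw \<pi> (?U - ?K) (?U - ?L)"
    using h' by (rule bij_betw_cong[THEN iffD1, rotated]) (auto simp: \<pi>_def)
  ultimately have "bij_betw \<pi> (?K \<union> (?U - ?K)) (?L \<union> (?U - ?L))"
    by (rule bij_betw_combine) auto
  moreover have "?K \<union> (?U - ?K) = ?U" "?L \<union> (?U - ?L) = ?U" by auto
  ultimately have U: "bij_betw \<pi> ?U ?U" by simp
  moreover have "bij_betw \<pi> (- ?U) (- ?U)"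
    by (rule bij_betw_cong[THEN iffD1, OF _ bij_betw_id]) (auto simp: \<pi>_def)
  ultimately have "bij_betw \<pi> (?U \<union> - ?U) (?U \<union> - ?U)"
    by (rule bij_betw_combine) auto
  hence bij: "bij \<pi>" by (simp only: Compl_partition)
  have "lookup \<alpha> (\<pi> i) = lookup \<beta> i" for i
  proof (cases "i \<in> ?K")
    case True
    thus ?thesis using h(2) by (simp add: \<pi>_def)
  next
    case False
    have "\<pi> i \<notin> ?L"
    proof (cases "i \<in> ?U")
      case True
      hence "\<pi> i \<in> ?U - ?L" using \<open>bij_betw \<pi> (?U - ?K) (?U - ?L)\<close> False bij_betwE by blast
      thus ?thesis by blast
    qed (auto simp: \<pi>_def)
    thus ?thesis using False by (simp add: in_keys_iff)
  qed
  hence "Poly_Mapping.map_key \<pi> \<alpha> = \<beta>"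
    using bij by (intro poly_mapping_eqI) (simp add: map_key.rep_eq bij_is_inj)
  with bij show ?thesis by blast
qed

lemma mcoeff_mtype_cong: "mtype \<alpha> = mtype \<beta> \<Longrightarrow> mcoeff f \<alpha> = mcoeff f \<beta>"
  using mtype_eq_ex_bij[of \<alpha> \<beta>] mcoeff[of f] by (auto simp: perm_invariant_def)

lemma finite_partitions_of: "finite (partitions_of n)"
proof -
  have "\<mu> \<in> mset ` {xs. set xs \<subseteq> {..n} \<and> length xs \<le> n}" if "\<mu> \<in> partitions_of n" for \<mu>
  proof -
    obtain xs where xs: "mset xs = \<mu>" using ex_mset by blast
    have "set xs \<subseteq> {..n}" using that xs
      by (auto simp: partitions_of_def sum_mset_sum_list dest: member_le_sum_list)
    moreover have "length xs \<le> sum_list xs" if "0 \<notin> set xs"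
      using that by (induction xs) auto
    hence "length xs \<le> n" using that xs
      by (auto simp: partition_defs sum_mset_sum_list)
    ultimately show ?thesis using xs by auto
  qed
  hence "partitions_of n \<subseteq> mset ` {xs. set xs \<subseteq> {..n} \<and> length xs \<le> n}" by blast
  thus ?thesis by (rule finite_subset) (intro finite_imageI finite_lists_length_le, simp)
qed

text \<open>The description of \<open>HL_Q'\<close> ranges over all symmetric functions, so its
  uniqueness needs each of them to be a polynomial in the power sums. Monomials with the largest
  number of variables are cleared by products p_rho of that length, leaving fewer variables; the
  number of variables never exceeds the degree.\<close>

lemma Psi_surj:
  fixes g :: "complex poly symfun"
  shows "\<exists>f. part_supp f \<and> Psi f = g"
proof -
  obtain d where d: "\<And>\<alpha>. mcoeff g \<alpha> \<noteq> 0 \<Longrightarrow> mon_degree \<alpha> \<le> d"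
    using mcoeff[of g] by (auto simp: bounded_degree_def)
  have "\<exists>f. part_supp f \<and> Psi f = g"
    if "\<And>\<alpha>. mcoeff g \<alpha> \<noteq> 0 \<Longrightarrow> mon_degree \<alpha> \<le> d \<and> card (keys \<alpha>) < N"
    for N and g :: "complex poly symfun"
    using that
  proof (induction N arbitrary: g)
    case 0
    hence "g = 0" by (intro symfun_eqI) auto
    thus ?case by (intro exI[of _ 0]) simp
  next
    case (Suc N)
    let ?R = "{\<rho>. is_partition \<rho> \<and> size \<rho> = N \<and> \<Sum>\<^sub># \<rho> \<le> d}"
    have "?R \<subseteq> (\<Union>n\<le>d. partitions_of n)" by (auto simp: partitions_of_def)
    hence fin: "finite ?R" by (rule finite_subset) (auto simp: finite_partitions_of)
    \<comment> \<open>Symmetry makes the coefficient independent of the representative picked by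
      \<open>SOME\<close>; prod m_i! is the leading coefficient of p_rho.\<close>
    define c where "c \<rho> = mcoeff g (SOME \<alpha>. mtype \<alpha> = \<rho>) * [:1 / of_nat (mfact \<rho>):]" for \<rho>
    have c: "c (mtype \<alpha>) * of_nat (mfact (mtype \<alpha>)) = mcoeff g \<alpha>" for \<alpha>
    proof -
      have "mtype (SOME \<beta>. mtype \<beta> = mtype \<alpha>) = mtype \<alpha>" by (rule someI) simp
      hence "mcoeff g (SOME \<beta>. mtype \<beta> = mtype \<alpha>) = mcoeff g \<alpha>" by (rule mcoeff_mtype_cong)
      thus ?thesis using mfact_pos[of "mtype \<alpha>"]
        by (simp add: c_def mult.assoc of_nat_poly)
    qed
    let ?f = "\<Sum>\<rho>\<in>?R. pmono \<rho> (c \<rho>)"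
    have f: "part_supp ?f"
      using Poly_Mapping.keys_sum[of "\<lambda>\<rho>. pmono \<rho> (c \<rho>)" ?R] by (fastforce split: if_splits)
    have Pf: "mcoeff (Psi ?f) \<alpha> = (\<Sum>\<rho>\<in>?R. c \<rho> * mcoeff (pprod \<rho>) \<alpha>)" for \<alpha>
      by (simp add: Psi_sum Psi_pmono)
    have top: "mcoeff (Psi ?f) \<alpha> = (if card (keys \<alpha>) = N \<and> mon_degree \<alpha> \<le> d then mcoeff g \<alpha> else 0)"
      if "card (keys \<alpha>) \<ge> N" for \<alpha>
    proof -
      have "mcoeff (Psi ?f) \<alpha> = (\<Sum>\<rho>\<in>?R. if \<rho> = mtype \<alpha> then c \<rho> * of_nat (mfact \<rho>) else 0)"
        unfolding Pf using that by (intro sum.cong) (auto simp: mcoeff_pprod)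
      also have "\<dots> = (if mtype \<alpha> \<in> ?R then mcoeff g \<alpha> else 0)"
        using fin c by simp
      also have "mtype \<alpha> \<in> ?R \<longleftrightarrow> card (keys \<alpha>) = N \<and> mon_degree \<alpha> \<le> d"
        by (simp add: is_partition_mtype sum_mset_mtype)
      finally show ?thesis .
    qed
    have "mon_degree \<alpha> \<le> d \<and> card (keys \<alpha>) < N" if nz: "mcoeff (g - Psi ?f) \<alpha> \<noteq> 0" for \<alpha>
    proof
      have ne: "mcoeff g \<alpha> \<noteq> mcoeff (Psi ?f) \<alpha>"
        using nz mcoeff_add[of "g - Psi ?f" "Psi ?f" \<alpha>] by auto
      show deg: "mon_degree \<alpha> \<le> d"
      proof (rule ccontr)
        assume "\<not> mon_degree \<alpha> \<le> d"
        moreover from this have "mcoeff g \<alpha> = 0" using Suc.prems by blast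
        moreover have "mcoeff (Psi ?f) \<alpha> = 0"
          unfolding Pf
        proof (rule sum.neutral, rule ballI)
          fix \<rho> assume "\<rho> \<in> ?R"
          thus "c \<rho> * mcoeff (pprod \<rho>) \<alpha> = 0"
            using mcoeff_pprod_degree[of \<rho> \<alpha>, where 'a="complex poly"] \<open>\<not> mon_degree \<alpha> \<le> d\<close> by auto
        qed
        ultimately show False using ne by simp
      qed
      show "card (keys \<alpha>) < N"
        using ne top[of \<alpha>] deg Suc.prems[of \<alpha>] by (cases "mcoeff g \<alpha> = 0") (auto simp: not_less split: if_splits)
    qed
    then obtain f' where f': "part_supp f'" "Psi f' = g - Psi ?f" using Suc.IH by blast
    have "part_supp (f' + ?f)" by (rule part_supp_add[OF f'(1) f])
    moreover have "Psi (f' + ?f) = g" by (simp add: Psi_add f')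
    ultimately show ?case by blast
  qed
  moreover have "card (keys \<alpha>) < Suc d" if "mcoeff g \<alpha> \<noteq> 0" for \<alpha>
  proof -
    have "card (keys \<alpha>) \<le> mon_degree \<alpha>"
      unfolding mon_degree_def using sum_mono[of "keys \<alpha>" "\<lambda>_. 1" "lookup \<alpha>"]
      by (auto simp: in_keys_iff Suc_le_eq)
    thus ?thesis using d[OF that] by simp
  qed
  ultimately show ?thesis using d by blast
qed

section \<open>Restriction to finitely many variables\<close>

lemma lookup_mult_splits:
  fixes F G :: "(nat \<Rightarrow>\<^sub>0 nat) \<Rightarrow>\<^sub>0 'a::comm_ring_1"
  shows "lookup (F * G) \<alpha>
    = (\<Sum>(\<beta>, \<gamma>)\<in>mon_splits \<alpha>. lookup F \<beta> * lookup G \<gamma>)"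
proof -
  have "lookup (F * G) \<alpha>
      = (\<Sum>(\<beta>, \<gamma>). lookup F \<beta> * lookup G \<gamma> when \<alpha> = \<beta> + \<gamma>)"
    unfolding times_poly_mapping.rep_eq by (rule prod_fun_unfold_prod) simp_all
  also have "\<dots> = (\<Sum>(\<beta>, \<gamma>)\<in>mon_splits \<alpha>. lookup F \<beta> * lookup G \<gamma> when \<alpha> = \<beta> + \<gamma>)"
    by (rule Sum_any.expand_superset[OF finite_mon_splits]) (auto simp: mon_splits_def)
  also have "\<dots> = (\<Sum>(\<beta>, \<gamma>)\<in>mon_splits \<alpha>. lookup F \<beta> * lookup G \<gamma>)"
    by (rule sum.cong) (auto simp: mon_splits_def)
  finally show ?thesis .
qed

lemma lookup_sf_restrict:
  "lookup (sf_restrict m f) \<alpha> = (if keys \<alpha> \<subseteq> {..<m} then mcoeff f \<alpha> else 0)"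
  by transfer simp

lemma sf_restrict_add: "sf_restrict m (f + g) = sf_restrict m f + sf_restrict m g"
  by (rule poly_mapping_eqI) (simp add: lookup_sf_restrict lookup_add)

lemma sf_restrict_0 [simp]: "sf_restrict m 0 = 0"
  by (rule poly_mapping_eqI) (simp add: lookup_sf_restrict)

lemma sf_restrict_1: "sf_restrict m 1 = 1"
  by (rule poly_mapping_eqI) (auto simp: lookup_sf_restrict mcoeff_1 lookup_one)

lemma sf_restrict_mult:
  "sf_restrict m (f * g) = sf_restrict m f * (sf_restrict m g :: _ \<Rightarrow>\<^sub>0 'a::comm_ring_1)"
proof (rule poly_mapping_eqI)
  fix \<alpha>
  have k: "keys \<alpha> = keys \<beta> \<union> keys \<gamma>" if "(\<beta>, \<gamma>) \<in> mon_splits \<alpha>" for \<beta> \<gamma>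
    using that by (auto simp: mon_splits_def in_keys_iff lookup_add)
  show "lookup (sf_restrict m (f * g)) \<alpha> = lookup (sf_restrict m f * sf_restrict m g) \<alpha>"
    unfolding lookup_mult_splits lookup_sf_restrict mcoeff_mult
    using k by (auto intro!: sum.cong sum.neutral[symmetric] sum.neutral split: prod.splits)
qed

lemma sf_restrict_scale: "sf_restrict m (sf_scale c f) = single 0 c * sf_restrict m f"
proof (rule poly_mapping_eqI)
  fix \<alpha>
  show "lookup (sf_restrict m (sf_scale c f)) \<alpha>
      = lookup (single 0 c * sf_restrict m f) \<alpha>"
    by (simp add: mult_map_scale_conv_mult[symmetric] map.rep_eq lookup_sf_restrict when_def)
qed

lemma sf_restrict_psum:
  assumes "k > 0"
  shows "sf_restrict m (psum k) = (\<Sum>i<m. single (single i k) (1 :: 'a::comm_ring_1))"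
proof (rule poly_mapping_eqI)
  fix \<alpha> :: "nat \<Rightarrow>\<^sub>0 nat"
  show "lookup (sf_restrict m (psum k)) \<alpha>
    = lookup (\<Sum>i<m. single (single i k) (1::'a)) \<alpha>"
  proof (cases "\<exists>i. \<alpha> = single i k")
    case True
    then obtain i where i: "\<alpha> = single i k" ..
    have "lookup (\<Sum>i<m. single (single i k) (1::'a)) \<alpha>
        = (\<Sum>j<m. if j = i then 1 else 0)"
      unfolding lookup_sum by (rule sum.cong) (use single_left_inj[OF assms] i in \<open>auto simp: lookup_single when_def\<close>)
    thus ?thesis using i assms by (auto simp: lookup_sf_restrict mcoeff_psum)
  next
    case False
    hence "single i k \<noteq> \<alpha>" for i by metis
    with False show ?thesis
      by (simp add: lookup_sf_restrict mcoeff_psum lookup_sum lookup_single when_def)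
  qed
qed

section \<open>Evaluation in rational functions\<close>

definition rf_const :: "complex poly \<Rightarrow> ratfun" where
  "rf_const c = to_fract (single 0 c)"

lemma rf_const_hom: "comm_ring_hom rf_const"
  by standard (simp_all add: rf_const_def single_add mult_single flip: to_fract_mult)

interpretation rf_const: comm_ring_hom rf_const
  by (rule rf_const_hom)

lemma single_eq_0_iff: "single k v = 0 \<longleftrightarrow> v = 0"
  by (metis lookup_single_eq lookup_zero single_zero)

lemma rf_const_eq_0 [simp]: "rf_const c = 0 \<longleftrightarrow> c = 0"
  by (simp add: rf_const_def single_eq_0_iff)

lemma rf_t_conv: "rf_t = rf_const tvar"
  by (simp add: rf_t_def rf_const_def)

lemma rf_t_power_neq_1: "k > 0 \<Longrightarrow> rf_t ^ k \<noteq> 1"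
proof
  assume "k > 0" "rf_t ^ k = 1"
  hence "rf_const (1 - tvar ^ k) = 0"
    unfolding rf_t_conv by (simp add: rf_const.hom_minus rf_const.hom_power del: rf_const_eq_0)
  thus False using one_minus_tvar_power_neq_0[OF \<open>k > 0\<close>] by simp
qed

lemma rf_x_power: "rf_x i ^ k = to_fract (single (single i k) 1)"
  by (induction k) (simp_all add: rf_x_def mult_single single_add[symmetric] to_fract_mult[symmetric] del: to_fract_mult)

lemma rf_x_neq_0: "rf_x i \<noteq> 0"
  by (simp add: rf_x_def single_eq_0_iff)

lemma inj_rf_x: "inj rf_x"
proof (rule injI)
  fix i j assume "rf_x i = rf_x j"
  hence "keys (single (single i (1::nat)) (1 :: complex poly))
    = keys (single (single j (1::nat)) (1 :: complex poly))"
    by (simp add: rf_x_def)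
  hence "single i (1::nat) = single j 1" by simp
  hence "keys (single i (1::nat)) = keys (single j (1::nat))" by simp
  thus "i = j" by simp
qed

lemma infinite_ratfun: "infinite (UNIV :: ratfun set)"
  using finite_subset[OF subset_UNIV, of "range rf_x"] range_inj_infinite[OF inj_rf_x] by blast

text \<open>\<open>I\<close> may be any set of variables because the recursion removes them one by
  one. Sending p_0 to 0 rather than to the number of variables agrees with
  \<open>one_shift 0 = 0\<close> when a variable is removed.\<close>

definition ev :: "nat set \<Rightarrow> complex poly pol \<Rightarrow> ratfun" where
  "ev I = psubst rf_const (\<lambda>k. if k = 0 then 0 else \<Sum>i\<in>I. rf_x i ^ k)"

lemma ev_hom: "comm_ring_hom (ev I)"
  unfolding ev_def by (rule comm_ring_hom.psubst_hom[OF rf_const_hom])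

interpretation ev: comm_ring_hom "ev I" for I
  by (rule ev_hom)

lemma ev_pconst [simp]: "ev I (pconst c) = rf_const c"
  unfolding ev_def by (rule comm_ring_hom.psubst_pconst[OF rf_const_hom])

lemma ev_pvar: "ev I (pvar k) = (if k = 0 then 0 else \<Sum>i\<in>I. rf_x i ^ k)"
  unfolding ev_def by (rule comm_ring_hom.psubst_pvar[OF rf_const_hom])

lemma ev_pmono: "ev I (pmono \<rho> c) = rf_const c * (\<Prod>k\<in>#\<rho>. ev I (pvar k))"
  unfolding ev_pvar unfolding ev_def by (rule comm_ring_hom.psubst_mono[OF rf_const_hom])

lemma to_fract_sum: "to_fract (\<Sum>i\<in>X. f i) = (\<Sum>i\<in>X. to_fract (f i))"
  by (induction X rule: infinite_finite_induct) simp_all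

lemma sf_restrict_pprod: "is_partition \<rho> \<Longrightarrow> to_fract (sf_restrict m (pprod \<rho>)) = (\<Prod>k\<in>#\<rho>. ev {..<m} (pvar k))"
proof (induction \<rho>)
  case (add k \<rho>)
  hence "k > 0" "is_partition \<rho>" by (auto simp: is_partition_def)
  with add show ?case
    by (simp add: sf_restrict_mult sf_restrict_psum to_fract_sum ev_pvar rf_x_power)
qed (simp add: sf_restrict_1)

lemma sf_restrict_Psi:
  assumes "part_supp f"
  shows "to_fract (sf_restrict m (Psi f)) = ev {..<m} f"
proof -
  have *: "to_fract (sf_restrict m (Psi (\<Sum>\<rho>\<in>X. pmono \<rho> (c \<rho>)))) = ev {..<m} (\<Sum>\<rho>\<in>X. pmono \<rho> (c \<rho>))"
    if "finite X" "X \<subseteq> Collect is_partition" for X c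
    using that
  proof (induction X rule: finite_induct)
    case (insert \<rho> X)
    hence "to_fract (sf_restrict m (Psi (pmono \<rho> (c \<rho>)))) = ev {..<m} (pmono \<rho> (c \<rho>))"
      by (simp add: Psi_pmono sf_restrict_scale sf_restrict_pprod ev_pmono[of _ \<rho>] rf_const_def)
    with insert show ?case
      by (simp add: Psi_add sf_restrict_add ev.hom_add)
  qed simp
  show ?thesis
    using *[OF finite_keys assms, of "lookup f"] unfolding poly_mapping_sum_monomials .
qed

lemma sf_restrict_inj:
  fixes f g :: "'a::zero symfun"
  assumes "\<And>m. m \<ge> n \<Longrightarrow> sf_restrict m f = sf_restrict m g"
  shows "f = g"
proof (rule symfun_eqI)
  fix \<alpha> :: "nat \<Rightarrow>\<^sub>0 nat"
  obtain M where "\<forall>i\<in>keys \<alpha>. i < M"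
    using finite_nat_set_iff_bounded[of "keys \<alpha>"] by auto
  hence "keys \<alpha> \<subseteq> {..<max n M}" by auto
  thus "mcoeff f \<alpha> = mcoeff g \<alpha>"
    using arg_cong[OF assms[of "max n M"], of "\<lambda>F. lookup F \<alpha>"] by (simp add: lookup_sf_restrict)
qed

section \<open>Partial fractions\<close>

lemma newton_prod_geoc:
  "finite I \<Longrightarrow> newton (\<lambda>k. \<Sum>i\<in>I. (1 - t ^ k) * x i ^ k) (fps_nth (\<Prod>i\<in>I. Abs_fps (geoc t (x i))))"
proof (induction I rule: finite_induct)
  case empty
  show ?case by (simp add: newton_def)
next
  case (insert i I)
  have "fps_nth (\<Prod>j\<in>insert i I. Abs_fps (geoc t (x j)))
      = (\<lambda>n. \<Sum>j\<le>n. geoc t (x i) j * fps_nth (\<Prod>j\<in>I. Abs_fps (geoc t (x j))) (n - j))"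
    using insert by (simp add: fun_eq_iff fps_mult_nth atLeast0AtMost)
  thus ?case using newton_mult[OF newton_geoc insert.IH, of t "x i"] insert by simp
qed

lemma geoc_times_linear: "Abs_fps (geoc t x) * fps_of_poly [:1, - x:] = fps_of_poly [:1, - (t * x):]"
  (is "?A = ?B")
proof (rule fps_ext)
  fix n
  have "fps_of_poly [:1, - x:] = 1 - fps_const x * fps_X"
    by (simp add: fps_of_poly_pCons fps_of_poly_const)
  hence "?A = Abs_fps (geoc t x) - fps_const x * (fps_X * Abs_fps (geoc t x))"
    by (simp only: right_diff_distrib mult_1_right mult_1_left ac_simps)
  hence "fps_nth ?A n = geoc t x n - x * (if n = 0 then 0 else geoc t x (n - 1))"
    by (simp add: fps_X_mult_nth)
  thus "fps_nth ?A n = fps_nth ?B n"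
    by (cases n; cases "n - 1") (simp_all add: geoc_def algebra_simps)
qed

lemma geometric_times_linear:
  "Abs_fps (\<lambda>n. x ^ n) * fps_of_poly [:1, - x:] = 1" for x :: "'a::comm_ring_1"
proof -
  have "geoc 0 x = (\<lambda>n. x ^ n)" by (simp add: fun_eq_iff geoc_def)
  thus ?thesis using geoc_times_linear[of 0 x] by simp
qed

text \<open>The coefficient of 1 / (1 - x_i u) in the partial fraction expansion of prod_j (1 - t
  x_j u) / (1 - x_j u). Up to the factor 1 - t it is the product attached to x_i in the
  symmetrization formula, which is where the two descriptions of P meet.\<close>

definition pf_coeff :: "'i set \<Rightarrow> ('i \<Rightarrow> 'a::field) \<Rightarrow> 'a \<Rightarrow> 'i \<Rightarrow> 'a" where
  "pf_coeff I x t i = (1 - t) * (\<Prod>j\<in>I - {i}. (x i - t * x j) / (x i - x j))"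

context
  fixes I :: "'i set" and x :: "'i \<Rightarrow> 'a::field" and t :: 'a
  assumes fin: "finite I" and inj: "inj_on x I" and nz: "\<And>i. i \<in> I \<Longrightarrow> x i \<noteq> 0"
    and inf: "infinite (UNIV :: 'a set)"
begin

text \<open>The expansion with denominators cleared and z = 1/u. The difference of both sides has
  degree at most |I| in z, yet vanishes at 0 and at the |I| distinct nonzero points x_i.\<close>

lemma partial_fractions_monic:
  "(\<Prod>i\<in>I. z - t * x i) = t ^ card I * (\<Prod>i\<in>I. z - x i) + (\<Sum>i\<in>I. pf_coeff I x t i * z * (\<Prod>j\<in>I - {i}. z - x j))"
proof -
  define P where "P = (\<Prod>i\<in>I. [:- (t * x i), 1:]) - smult (t ^ card I) (\<Prod>i\<in>I. [:- x i, 1:])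
    - (\<Sum>i\<in>I. smult (pf_coeff I x t i) ([:0, 1:] * (\<Prod>j\<in>I - {i}. [:- x j, 1:])))"
  have Pz: "poly P z = (\<Prod>i\<in>I. z - t * x i) - t ^ card I * (\<Prod>i\<in>I. z - x i)
      - (\<Sum>i\<in>I. pf_coeff I x t i * z * (\<Prod>j\<in>I - {i}. z - x j))" for z
    by (simp add: P_def poly_prod poly_sum ac_simps)
  have "P = 0"
  proof (rule ccontr)
    assume "P \<noteq> 0"
    have lin: "degree (\<Prod>i\<in>J. [:- y i, 1:]) \<le> card J" if "finite J" for J and y :: "'i \<Rightarrow> 'a"
      using degree_prod_sum_le[OF that, of "\<lambda>i. [:- y i, 1:]"] by simp
    have "degree ([:0, 1:] * (\<Prod>j\<in>I - {i}. [:- x j, 1:])) \<le> card I" if "i \<in> I" for i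
    proof -
      have "degree ([:0, 1:] * (\<Prod>j\<in>I - {i}. [:- x j, 1:])) \<le> 1 + degree (\<Prod>j\<in>I - {i}. [:- x j, 1:])"
        using degree_mult_le[of "[:0, 1:]" "\<Prod>j\<in>I - {i}. [:- x j, 1:]"] by simp
      also have "\<dots> \<le> 1 + card (I - {i})" using lin[of "I - {i}" x] fin by simp
      also have "\<dots> = card I" using fin that by (metis One_nat_def card_Suc_Diff1 plus_1_eq_Suc)
      finally show ?thesis .
    qed
    hence "degree P \<le> card I" unfolding P_def
      using lin[OF fin]
      by (intro degree_diff_le degree_sum_le fin order.trans[OF degree_smult_le]) auto
    moreover have "insert 0 (x ` I) \<subseteq> {z. poly P z = 0}"
    proof
      fix z assume z: "z \<in> insert 0 (x ` I)"
      show "z \<in> {z. poly P z = 0}"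
      proof (cases "z = 0")
        case True
        have "(\<Prod>i\<in>I. - (t * x i)) = t ^ card I * (\<Prod>i\<in>I. - x i)"
          by (simp add: prod.distrib prod_uminus mult.left_commute)
        thus ?thesis using True by (simp add: Pz)
      next
        case False
        then obtain i where i: "i \<in> I" "z = x i" using z by auto
        have 1: "(\<Prod>j\<in>I. z - x j) = 0" using i fin by (auto intro!: prod_zero)
        have "(\<Sum>k\<in>I. pf_coeff I x t k * z * (\<Prod>j\<in>I - {k}. z - x j)) = (\<Sum>k\<in>{i}. pf_coeff I x t k * z * (\<Prod>j\<in>I - {k}. z - x j))"
        proof (rule sum.mono_neutral_right[OF fin])
          show "\<forall>k\<in>I - {i}. pf_coeff I x t k * z * (\<Prod>j\<in>I - {k}. z - x j) = 0"
            using i fin by (auto intro!: prod_zero)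
        qed (use i in auto)
        also have "\<dots> = z * (1 - t) * ((\<Prod>j\<in>I - {i}. (x i - t * x j) / (x i - x j)) * (\<Prod>j\<in>I - {i}. z - x j))"
          by (simp add: pf_coeff_def)
        also have "(\<Prod>j\<in>I - {i}. (x i - t * x j) / (x i - x j)) * (\<Prod>j\<in>I - {i}. z - x j) = (\<Prod>j\<in>I - {i}. z - t * x j)"
          unfolding prod.distrib[symmetric] using i inj by (intro prod.cong) (auto simp: inj_on_def)
        also have "z * (1 - t) * \<dots> = (\<Prod>j\<in>I. z - t * x j)"
          using i fin by (simp add: prod.remove[of I i] algebra_simps)
        finally show ?thesis by (simp add: Pz 1)
      qed
    qed
    hence "card (insert 0 (x ` I)) \<le> degree P"
      using card_mono[OF poly_roots_finite[OF \<open>P \<noteq> 0\<close>]] card_poly_roots_bound[OF \<open>P \<noteq> 0\<close>] order.trans by blast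
    moreover have "card (insert 0 (x ` I)) = Suc (card I)"
      using fin nz by (subst card_insert_disjoint) (auto simp: card_image[OF inj])
    ultimately show False by simp
  qed
  hence "poly P z = 0" by simp
  thus ?thesis unfolding Pz by (simp add: algebra_simps)
qed

text \<open>Put z = 1/u in the monic form and multiply by u^|I|; over an infinite field, agreement
  at all u \<noteq> 0 is equality of polynomials.\<close>

lemma partial_fractions_poly:
  "(\<Prod>i\<in>I. [:1, - (t * x i):]) = smult (t ^ card I) (\<Prod>i\<in>I. [:1, - x i:])
    + (\<Sum>i\<in>I. smult (pf_coeff I x t i) (\<Prod>j\<in>I - {i}. [:1, - x j:]))" (is "?l = ?r")
proof -
  have "poly ?l u = poly ?r u" if "u \<noteq> 0" for u
  proof -
    have *: "(\<Prod>i\<in>J. 1 - y i * u) = u ^ card J * (\<Prod>i\<in>J. 1 / u - y i)" if "finite J" for J and y :: "'i \<Rightarrow> 'a"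
    proof -
      have "(\<Prod>i\<in>J. 1 - y i * u) = (\<Prod>i\<in>J. u * (1 / u - y i))"
        using \<open>u \<noteq> 0\<close> by (intro prod.cong) (auto simp: algebra_simps)
      thus ?thesis by (simp add: prod.distrib)
    qed
    have "poly ?l u = (\<Prod>i\<in>I. 1 - (t * x i) * u)"
      by (simp add: poly_prod mult.commute)
    also have "\<dots> = u ^ card I * (t ^ card I * (\<Prod>i\<in>I. 1 / u - x i)
        + (\<Sum>i\<in>I. pf_coeff I x t i * (1 / u) * (\<Prod>j\<in>I - {i}. 1 / u - x j)))"
      by (simp only: *[OF fin] partial_fractions_monic)
    also have "\<dots> = t ^ card I * (\<Prod>i\<in>I. 1 - x i * u)
        + (\<Sum>i\<in>I. u ^ card I * (pf_coeff I x t i * (1 / u) * (\<Prod>j\<in>I - {i}. 1 / u - x j)))"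
      by (simp add: *[OF fin] distrib_left sum_distrib_left)
    also have "(\<Sum>i\<in>I. u ^ card I * (pf_coeff I x t i * (1 / u) * (\<Prod>j\<in>I - {i}. 1 / u - x j)))
       = (\<Sum>i\<in>I. pf_coeff I x t i * (\<Prod>j\<in>I - {i}. 1 - x j * u))"
    proof (rule sum.cong[OF refl])
      fix i assume "i \<in> I"
      hence "u ^ card I = u * u ^ card (I - {i})"
        using fin by (metis card_Suc_Diff1 power_Suc)
      thus "u ^ card I * (pf_coeff I x t i * (1 / u) * (\<Prod>j\<in>I - {i}. 1 / u - x j)) = pf_coeff I x t i * (\<Prod>j\<in>I - {i}. 1 - x j * u)"
        using that by (subst *) (simp_all add: fin)
    qed
    also have "t ^ card I * (\<Prod>i\<in>I. 1 - x i * u) + \<dots> = poly ?r u"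
      by (simp add: poly_prod poly_sum mult.commute)
    finally show ?thesis .
  qed
  hence sub: "UNIV - {0} \<subseteq> {u. poly (?l - ?r) u = 0}" by auto
  show ?thesis
  proof (rule ccontr)
    assume "?l \<noteq> ?r"
    hence "finite {u. poly (?l - ?r) u = 0}" by (intro poly_roots_finite) simp
    hence "finite (UNIV - {0 :: 'a})" by (rule finite_subset[OF sub])
    thus False using inf by simp
  qed
qed

lemma partial_fractions_fps:
  "(\<Prod>i\<in>I. Abs_fps (geoc t (x i))) = fps_const (t ^ card I) + (\<Sum>i\<in>I. fps_const (pf_coeff I x t i) * Abs_fps (\<lambda>n. x i ^ n))"
proof -
  define L :: "'i \<Rightarrow> 'a fps" where "L i = fps_of_poly [:1, - x i:]" for i
  have "(\<Prod>i\<in>I. Abs_fps (geoc t (x i))) * (\<Prod>i\<in>I. L i) = fps_of_poly (\<Prod>i\<in>I. [:1, - (t * x i):])"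
    unfolding L_def fps_of_poly_prod prod.distrib[symmetric] by (simp only: geoc_times_linear)
  also have "\<dots> = fps_const (t ^ card I) * (\<Prod>i\<in>I. L i) + (\<Sum>i\<in>I. fps_const (pf_coeff I x t i) * (\<Prod>j\<in>I - {i}. L j))"
    by (simp add: partial_fractions_poly fps_of_poly_add fps_of_poly_smult fps_of_poly_sum fps_of_poly_prod L_def)
  also have "(\<Sum>i\<in>I. fps_const (pf_coeff I x t i) * (\<Prod>j\<in>I - {i}. L j))
      = (\<Sum>i\<in>I. fps_const (pf_coeff I x t i) * Abs_fps (\<lambda>n. x i ^ n) * (\<Prod>j\<in>I. L j))"
  proof (rule sum.cong[OF refl])
    fix i assume "i \<in> I"
    hence "(\<Prod>j\<in>I. L j) = L i * (\<Prod>j\<in>I - {i}. L j)" using fin by (simp add: prod.remove)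
    thus "fps_const (pf_coeff I x t i) * (\<Prod>j\<in>I - {i}. L j)
       = fps_const (pf_coeff I x t i) * Abs_fps (\<lambda>n. x i ^ n) * (\<Prod>j\<in>I. L j)"
      using geometric_times_linear[of "x i"] by (simp add: L_def mult.assoc[symmetric])
  qed
  also have "fps_const (t ^ card I) * (\<Prod>i\<in>I. L i) + \<dots>
     = (fps_const (t ^ card I) + (\<Sum>i\<in>I. fps_const (pf_coeff I x t i) * Abs_fps (\<lambda>n. x i ^ n))) * (\<Prod>i\<in>I. L i)"
    by (simp only: distrib_right sum_distrib_right)
  finally show ?thesis
  proof (rule mult_right_cancel[THEN iffD1, rotated])
    have "L i \<noteq> 0" for i
      unfolding L_def by (metis fps_of_poly_eq_iff fps_of_poly_0 one_neq_zero pCons_eq_0_iff)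
    thus "(\<Prod>i\<in>I. L i) \<noteq> 0" using fin by simp
  qed
qed

text \<open>The coefficient of u^n; the constant t^|I| of the expansion affects n = 0 only.\<close>

lemma sum_pf_coeff_power:
  "(\<Sum>i\<in>I. pf_coeff I x t i * x i ^ n) = fps_nth (\<Prod>i\<in>I. Abs_fps (geoc t (x i))) n - (if n = 0 then t ^ card I else 0)"
  by (simp add: partial_fractions_fps fps_sum_nth)

end

section \<open>Comparison with the symmetrization formula\<close>

abbreviation rf_g :: "nat set \<Rightarrow> nat \<Rightarrow> ratfun" where
  "rf_g I \<equiv> pf_coeff I rf_x rf_t"

lemma inj_on_rf_x: "inj_on rf_x I"
  using inj_rf_x by (rule inj_on_subset) simp

lemma ev_qsym:
  assumes "finite I"
  shows "ev I (qsym n) = fps_nth (\<Prod>i\<in>I. Abs_fps (geoc rf_t (rf_x i))) n"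
proof (rule newton_unique)
  show "newton (\<lambda>k. ev I (pconst (1 - tvar ^ k) * pvar k)) (\<lambda>n. ev I (qsym n))"
    by (rule newton_hom[OF ev_hom newton_qsym])
  have "(\<Sum>i\<in>I. (1 - rf_t ^ k) * rf_x i ^ k) = ev I (pconst (1 - tvar ^ k) * pvar k)" for k
  proof -
    have "1 - rf_t ^ k = rf_const (1 - tvar ^ k)"
      by (simp add: rf_t_conv rf_const.hom_minus rf_const.hom_power)
    thus ?thesis by (cases "k = 0") (simp_all add: ev.hom_mult ev_pvar sum_distrib_left)
  qed
  thus "newton (\<lambda>k. ev I (pconst (1 - tvar ^ k) * pvar k)) (fps_nth (\<Prod>i\<in>I. Abs_fps (geoc rf_t (rf_x i))))"
    using newton_prod_geoc[OF assms, of rf_t rf_x] by simp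
  have "fps_nth (\<Prod>i\<in>I. Abs_fps (geoc rf_t (rf_x i))) 0 = 1"
    using assms by (induction I rule: finite_induct) (simp_all add: geoc_def)
  thus "ev I (qsym 0) = fps_nth (\<Prod>i\<in>I. Abs_fps (geoc rf_t (rf_x i))) 0"
    by simp
  fix n :: nat assume "n > 0"
  hence "[:1 / of_nat n:] * of_nat n = (1 :: complex poly)"
    by (simp add: of_nat_poly one_pCons)
  hence "rf_const [:1 / of_nat n:] * rf_const (of_nat n) = 1"
    by (metis rf_const.hom_mult rf_const.hom_one)
  moreover have "rf_const (of_nat n) = of_nat n" by (induction n) (simp_all add: rf_const.hom_add)
  ultimately show "\<exists>u::ratfun. u * of_nat n = 1" by metis
qed

lemma sum_rf_g_power:
  assumes "finite I"
  shows "(\<Sum>i\<in>I. rf_g I i * rf_x i ^ n) = ev I (qsym n) - (if n = 0 then rf_t ^ card I else 0)"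
  unfolding ev_qsym[OF assms]
  by (rule sum_pf_coeff_power[OF assms inj_on_rf_x rf_x_neq_0 infinite_ratfun])

lemma map_poly_ev_const: "map_poly (ev I) [:a:] = [:ev I a:]"
  by (rule poly_eqI) (simp add: coeff_map_poly coeff_pCons split: nat.split)

text \<open>D(y) at y = x_i turns each p_k of the alphabet into p_k - x_i^k, which removes x_i from
  it.\<close>

lemma ev_remove:
  assumes "finite I" "i \<in> I"
  shows "ev (I - {i}) f = poly (map_poly (ev I) (shift (\<lambda>k. - one_shift k) f)) (rf_x i)"
proof (rule pol_hom_eqI[OF ev_hom])
  have m: "map_poly_comm_ring_hom (ev I)" by unfold_locales
  interpret m: map_poly_comm_ring_hom "ev I" by (rule m)
  show "comm_ring_hom (\<lambda>f. poly (map_poly (ev I) (shift (\<lambda>k. - one_shift k) f)) (rf_x i))"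
    by standard (simp_all add: shift.hom_add shift.hom_mult m.hom_add m.hom_mult)
  show "ev (I - {i}) (pconst c) = poly (map_poly (ev I) (shift (\<lambda>k. - one_shift k) (pconst c))) (rf_x i)" for c
    by (simp add: map_poly_ev_const)
  show "ev (I - {i}) (pvar k) = poly (map_poly (ev I) (shift (\<lambda>k. - one_shift k) (pvar k))) (rf_x i)" for k
    using assms
    by (simp add: map_poly_ev_const m.hom_add map_poly_monom poly_monom ev_pvar one_shift_def sum_diff1
        single_uminus rf_const.hom_uminus ev.hom_uminus)
qed

lemma ev_remove_sum:
  assumes "finite I" "i \<in> I"
  shows "ev (I - {i}) f = (\<Sum>k\<le>degree (shift (\<lambda>k. - one_shift k) f). ev I (D k f) * rf_x i ^ k)"
proof -
  let ?p = "shift (\<lambda>k. - one_shift k) f"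
  let ?q = "map_poly (ev I) ?p"
  have "poly ?q (rf_x i) = (\<Sum>k\<le>degree ?q. poly.coeff ?q k * rf_x i ^ k)"
    by (rule poly_altdef)
  also have "\<dots> = (\<Sum>k\<le>degree ?p. poly.coeff ?q k * rf_x i ^ k)"
  proof (rule sum.mono_neutral_left)
    show "\<forall>k\<in>{..degree ?p} - {..degree ?q}. poly.coeff ?q k * rf_x i ^ k = 0"
    proof
      fix k assume "k \<in> {..degree ?p} - {..degree ?q}"
      hence "degree ?q < k" by simp
      hence "poly.coeff ?q k = 0" by (rule coeff_eq_0)
      thus "poly.coeff ?q k * rf_x i ^ k = 0" by (simp only: mult_zero_left)
    qed
  qed (use degree_map_poly_le[of "ev I" ?p] in auto)
  also have "\<dots> = (\<Sum>k\<le>degree ?p. ev I (D k f) * rf_x i ^ k)"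
    by (simp add: coeff_map_poly)
  finally show ?thesis by (simp add: ev_remove[OF assms])
qed

text \<open>Since r > 0, q_{r+k} is the plain sum of g_i x_i^{r+k}; the factors x_i^k then
  reassemble the D_k into the removal of x_i.\<close>

lemma ev_HLQ_Cons:
  assumes "finite I" "r > 0"
  shows "ev I (HLQ (r # xs)) = (\<Sum>i\<in>I. rf_g I i * rf_x i ^ r * ev (I - {i}) (HLQ xs))"
proof -
  let ?N = "degree (shift (\<lambda>k. - one_shift k) (HLQ xs))"
  have q: "ev I (qsym (r + k)) = (\<Sum>i\<in>I. rf_g I i * rf_x i ^ (r + k))" for k
    using sum_rf_g_power[OF assms(1), of "r + k"] assms(2) by simp
  have "ev I (HLQ (r # xs)) = (\<Sum>k\<le>?N. \<Sum>i\<in>I. rf_g I i * rf_x i ^ r * (ev I (D k (HLQ xs)) * rf_x i ^ k))"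
    unfolding HLQ_Cons hlrow_def ev.hom_sum ev.hom_mult q sum_distrib_right power_add
    by (simp only: ac_simps)
  also have "\<dots> = (\<Sum>i\<in>I. \<Sum>k\<le>?N. rf_g I i * rf_x i ^ r * (ev I (D k (HLQ xs)) * rf_x i ^ k))"
    by (rule sum.swap)
  also have "\<dots> = (\<Sum>i\<in>I. rf_g I i * rf_x i ^ r * ev (I - {i}) (HLQ xs))"
    by (intro sum.cong refl) (simp add: ev_remove_sum[OF assms(1)] sum_distrib_left)
  finally show ?thesis .
qed

section \<open>The symmetrization sum as a recursion over variables\<close>

definition rf_c :: "nat \<Rightarrow> nat \<Rightarrow> ratfun" where
  "rf_c i j = (rf_x i - rf_t * rf_x j) / (rf_x i - rf_x j)"

text \<open>Symmetrization arranged by which variable receives the first exponent; the product over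
  the remaining variables collects the factors of all pairs containing it.\<close>

fun lsum :: "nat list \<Rightarrow> nat set \<Rightarrow> ratfun" where
  "lsum [] I = 1"
| "lsum (a # as) I = (\<Sum>i\<in>I. rf_x i ^ a * (\<Prod>j\<in>I - {i}. rf_c i j) * lsum as (I - {i}))"

definition lterm :: "nat list \<Rightarrow> nat list \<Rightarrow> ratfun" where
  "lterm as is = (\<Prod>i<length is. rf_x (is ! i) ^ (as ! i)) * (\<Prod>j<length is. \<Prod>i<j. rf_c (is ! i) (is ! j))"

lemma lterm_Cons:
  assumes "distinct is"
  shows "lterm (a # as) (y # is) = rf_x y ^ a * (\<Prod>j\<in>set is. rf_c y j) * lterm as is"
proof -
  have "(\<Prod>j\<in>set is. rf_c y j) = (\<Prod>j<length is. rf_c y (is ! j))"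
    by (rule prod.reindex_bij_betw[symmetric, OF bij_betw_nth]) (use assms in auto)
  thus ?thesis
    by (simp add: lterm_def prod.lessThan_Suc_shift prod.distrib del: prod.lessThan_Suc)
qed

lemma lsum_permutations:
  "finite I \<Longrightarrow> card I = length as \<Longrightarrow> lsum as I = (\<Sum>is\<in>permutations_of_set I. lterm as is)"
proof (induction as arbitrary: I)
  case Nil
  thus ?case by (simp add: lterm_def)
next
  case (Cons a as)
  have "I \<noteq> {}" using Cons.prems by auto
  have "(\<Sum>is\<in>permutations_of_set I. lterm (a # as) is)
      = (\<Sum>i\<in>I. \<Sum>is\<in>(#) i ` permutations_of_set (I - {i}). lterm (a # as) is)"
    unfolding permutations_of_set_nonempty[OF \<open>I \<noteq> {}\<close>]
    by (rule sum.UNION_disjoint) (use Cons.prems in auto)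
  also have "\<dots> = (\<Sum>i\<in>I. \<Sum>is\<in>permutations_of_set (I - {i}). lterm (a # as) (i # is))"
    by (rule sum.cong[OF refl]) (simp add: sum.reindex)
  also have "\<dots> = (\<Sum>i\<in>I. \<Sum>is\<in>permutations_of_set (I - {i}). rf_x i ^ a * (\<Prod>j\<in>I - {i}. rf_c i j) * lterm as is)"
  proof (rule sum.cong[OF refl], rule sum.cong[OF refl])
    fix i "is" assume "is \<in> permutations_of_set (I - {i})"
    hence "set is = I - {i}" "distinct is" by (auto dest: permutations_of_setD)
    thus "lterm (a # as) (i # is) = rf_x i ^ a * (\<Prod>j\<in>I - {i}. rf_c i j) * lterm as is"
      by (simp add: lterm_Cons)
  qed
  also have "\<dots> = lsum (a # as) I"
  proof -
    have "lsum as (I - {i}) = (\<Sum>is\<in>permutations_of_set (I - {i}). lterm as is)" if "i \<in> I" for i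
      by (rule Cons.IH) (use Cons.prems that in auto)
    thus ?thesis by (simp add: sum_distrib_left)
  qed
  finally show ?case ..
qed

lemma bij_betw_permutes_lists:
  "bij_betw (\<lambda>w. map w [0..<m]) {w. w permutes {..<m}} (permutations_of_set {..<m})"
proof (rule bij_betwI')
  fix v w assume "v \<in> {w. w permutes {..<m}}" "w \<in> {w. w permutes {..<m}}"
  hence vw: "v permutes {..<m}" "w permutes {..<m}" by auto
  show "map v [0..<m] = map w [0..<m] \<longleftrightarrow> v = w"
  proof
    assume eq: "map v [0..<m] = map w [0..<m]"
    have "v i = w i" for i
      using eq vw permutes_not_in[of v] permutes_not_in[of w] by (cases "i < m") auto
    thus "v = w" by auto
  qed simp
next
  fix w assume "w \<in> {w. w permutes {..<m}}"
  hence w: "w permutes {..<m}" by simp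
  show "map w [0..<m] \<in> permutations_of_set {..<m}"
    using permutes_image[OF w] permutes_inj_on[OF w]
    by (intro permutations_of_setI) (simp_all add: distinct_map atLeast0LessThan)
next
  fix ys assume "ys \<in> permutations_of_set {..<m}"
  hence ys: "set ys = {..<m}" "distinct ys" by (auto dest: permutations_of_setD)
  hence len: "length ys = m" using distinct_card by fastforce
  define w where "w i = (if i < m then ys ! i else i)" for i
  have "bij_betw ((!) ys) {..<m} {..<m}"
    by (rule bij_betw_nth[OF ys(2)]) (simp_all add: len ys(1))
  hence "bij_betw w {..<m} {..<m}"
    by (rule bij_betw_cong[THEN iffD1, rotated]) (simp add: w_def)
  hence "w permutes {..<m}" by (rule bij_imp_permutes) (simp add: w_def)
  moreover have "ys = map w [0..<m]"
    by (rule nth_equalityI) (simp_all add: len w_def)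
  ultimately show "\<exists>w\<in>{w. w permutes {..<m}}. ys = map w [0..<m]" by auto
qed

lemma HL_poly_conv_lsum: "HL_poly m \<mu> = lsum (map (nth_part \<mu>) [0..<m]) {..<m} / v_part m \<mu>"
proof -
  have "lsum (map (nth_part \<mu>) [0..<m]) {..<m}
      = (\<Sum>is\<in>permutations_of_set {..<m}. lterm (map (nth_part \<mu>) [0..<m]) is)"
    by (rule lsum_permutations) simp_all
  also have "\<dots> = (\<Sum>w | w permutes {..<m}. lterm (map (nth_part \<mu>) [0..<m]) (map w [0..<m]))"
    by (rule sum.reindex_bij_betw[symmetric, OF bij_betw_permutes_lists])
  also have "\<dots> = (\<Sum>w | w permutes {..<m}. (\<Prod>i<m. rf_x (w i) ^ nth_part \<mu> i) *
        (\<Prod>j<m. \<Prod>i<j. rf_c (w i) (w j)))"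
    unfolding lterm_def by (intro sum.cong arg_cong2[of _ _ _ _ "(*)"] prod.cong refl) auto
  finally show ?thesis by (simp add: HL_poly_def rf_c_def)
qed

lemma rf_t_neq_1: "1 - rf_t \<noteq> 0"
  using rf_t_power_neq_1[of 1] by simp

lemma rf_g_conv: "rf_g I i = (1 - rf_t) * (\<Prod>j\<in>I - {i}. rf_c i j)"
  by (simp add: pf_coeff_def rf_c_def)

text \<open>For exponent 0 the constant term matters: the g_i sum to 1 - t^|I|, so each step
  supplies one factor (1 - t^k) / (1 - t) of \<open>v_fac\<close>.\<close>

lemma lsum_zeros: "finite I \<Longrightarrow> lsum (replicate (card I) 0) I = v_fac (card I)"
proof (induction "card I" arbitrary: I)
  case 0
  thus ?case by (simp add: v_fac_def)
next
  case (Suc n)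
  have IH: "lsum (replicate n 0) (I - {i}) = v_fac n" if "i \<in> I" for i
  proof -
    have n: "n = card (I - {i})" using Suc(2,3) that by simp
    show ?thesis using Suc(1)[OF n] Suc(3) by (simp add: n[symmetric])
  qed
  have "lsum (replicate (card I) 0) I = (\<Sum>i\<in>I. (\<Prod>j\<in>I - {i}. rf_c i j) * v_fac n)"
    unfolding Suc(2)[symmetric] by (simp add: IH)
  also have "\<dots> = (\<Sum>i\<in>I. rf_g I i * rf_x i ^ 0) * v_fac n / (1 - rf_t)"
    using rf_t_neq_1 by (simp add: rf_g_conv sum_distrib_right sum_divide_distrib mult.assoc)
  also have "(\<Sum>i\<in>I. rf_g I i * rf_x i ^ 0) = 1 - rf_t ^ Suc n"
    unfolding sum_rf_g_power[OF Suc(3)] by (simp add: Suc(2))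
  also have "(1 - rf_t ^ Suc n) * v_fac n / (1 - rf_t) = v_fac (card I)"
    unfolding Suc(2)[symmetric] by (simp add: v_fac_def mult.commute)
  finally show ?case .
qed

text \<open>Each positive part uses one factor 1 - t to complete its product to g_i, after which the
  step is the recursion for Q; the padding zeros contribute \<open>v_fac k\<close>.\<close>

lemma lsum_append_zeros:
  "finite I \<Longrightarrow> card I = length xs + k \<Longrightarrow> 0 \<notin> set xs \<Longrightarrow>
    (1 - rf_t) ^ length xs * lsum (xs @ replicate k 0) I = ev I (HLQ xs) * v_fac k"
proof (induction xs arbitrary: I)
  case Nil
  thus ?case using lsum_zeros[of I] by simp
next
  case (Cons r xs)
  have "(1 - rf_t) ^ length (r # xs) * lsum ((r # xs) @ replicate k 0) I
     = (\<Sum>i\<in>I. rf_g I i * rf_x i ^ r * ((1 - rf_t) ^ length xs * lsum (xs @ replicate k 0) (I - {i})))"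
    by (simp add: sum_distrib_left rf_g_conv ac_simps)
  also have "\<dots> = (\<Sum>i\<in>I. rf_g I i * rf_x i ^ r * (ev (I - {i}) (HLQ xs) * v_fac k))"
    using Cons by (intro sum.cong refl) simp
  also have "\<dots> = ev I (HLQ (r # xs)) * v_fac k"
    using Cons.prems by (simp add: ev_HLQ_Cons sum_distrib_right mult.assoc)
  finally show ?case .
qed

section \<open>Partitions as decreasing lists\<close>

definition plist :: "nat multiset \<Rightarrow> nat list" where
  "plist \<mu> = rev (sorted_list_of_multiset \<mu>)"

lemma mset_plist [simp]: "mset (plist \<mu>) = \<mu>"
  by (simp add: plist_def)

lemma set_plist [simp]: "set (plist \<mu>) = set_mset \<mu>"
  by (simp add: plist_def)

lemma length_plist [simp]: "length (plist \<mu>) = size \<mu>"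
  by (metis mset_plist size_mset)

lemma sorted_plist: "sorted_wrt (\<ge>) (plist \<mu>)"
  by (simp add: plist_def sorted_wrt_rev)

lemma plist_in_plists: "is_partition \<mu> \<Longrightarrow> plist \<mu> \<in> plists (\<Sum>\<^sub># \<mu>)"
  by (simp add: plists_def sorted_plist is_partition_def sum_mset_sum_list[symmetric])

lemma plist_mset:
  assumes "xs \<in> plists n"
  shows "plist (mset xs) = xs"
proof -
  have "sorted (rev xs)" using assms by (simp add: plists_def sorted_wrt_rev)
  hence "sorted_list_of_multiset (mset xs) = rev xs"
    by (metis mset_rev sorted_list_of_multiset_mset sorted_sort_id)
  thus ?thesis by (simp add: plist_def)
qed

lemma plist_inj: "plist \<mu> = plist \<nu> \<longleftrightarrow> \<mu> = \<nu>"
  by (metis mset_plist)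

lemma map_nth_part:
  assumes "m \<ge> size \<mu>"
  shows "map (nth_part \<mu>) [0..<m] = plist \<mu> @ replicate (m - size \<mu>) 0"
proof (rule nth_equalityI)
  show "length (map (nth_part \<mu>) [0..<m]) = length (plist \<mu> @ replicate (m - size \<mu>) 0)"
    using assms by simp
  have "length (sorted_list_of_multiset \<mu>) = size \<mu>"
    using length_plist[of \<mu>] by (simp add: plist_def)
  moreover fix i assume "i < length (map (nth_part \<mu>) [0..<m])"
  ultimately show "map (nth_part \<mu>) [0..<m] ! i = (plist \<mu> @ replicate (m - size \<mu>) 0) ! i"
    by (auto simp: nth_append nth_part_def plist_def)
qed

lemma HLb_conv_prod: "HLb xs = (\<Prod>i\<in>set xs. \<Prod>k=1..count_list xs i. 1 - tvar ^ k)"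
proof (induction xs)
  case (Cons r xs)
  have c: "count_list ys = count (mset ys)" for ys :: "nat list"
    by (simp add: fun_eq_iff count_mset)
  have "(\<Prod>i\<in>set (r # xs). \<Prod>k=1..count_list (r # xs) i. 1 - tvar ^ k)
     = (1 - tvar ^ count_list (r # xs) r) * (\<Prod>i\<in>set xs. \<Prod>k=1..count_list xs i. 1 - tvar ^ k)"
    unfolding c set_mset_mset[symmetric] mset.simps by (rule prod_count_add_mset) simp_all
  with Cons show ?case by (simp only: HLb.simps)
qed simp

text \<open>Splitting (1 - t)^{m_i} off each block of b_lambda leaves v_{m_i}, which reconciles
  b_lambda with the normalization of the symmetrization formula.\<close>

lemma rf_const_HLb:
  "rf_const (HLb xs) = (1 - rf_t) ^ length xs * (\<Prod>i\<in>set xs. v_fac (count_list xs i))"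
proof -
  have "rf_const (\<Prod>k=1..n. 1 - tvar ^ k) = (1 - rf_t) ^ n * v_fac n" for n
    using rf_t_neq_1
    by (simp add: v_fac_def rf_const.hom_prod rf_const.hom_minus rf_const.hom_power rf_t_conv[symmetric] prod_dividef)
  hence "rf_const (HLb xs) = (\<Prod>i\<in>set xs. (1 - rf_t) ^ count_list xs i) * (\<Prod>i\<in>set xs. v_fac (count_list xs i))"
    by (simp add: HLb_conv_prod rf_const.hom_prod prod.distrib)
  also have "(\<Prod>i\<in>set xs. (1 - rf_t) ^ count_list xs i) = (1 - rf_t) ^ length xs"
    by (simp add: power_sum[symmetric] sum_count_set)
  finally show ?thesis .
qed

lemma v_fac_neq_0: "v_fac k \<noteq> 0"
  using rf_t_power_neq_1 rf_t_neq_1 by (auto simp: v_fac_def)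

text \<open>The powers of 1 - t and the factor of the padding zeros cancel, leaving exactly Q / b.
  As \<open>HLP\<close> does not involve m, this also gives stability in m.\<close>

lemma HL_poly_eq_ev:
  assumes \<mu>: "is_partition \<mu>" and m: "m \<ge> size \<mu>"
  shows "HL_poly m \<mu> = ev {..<m} (HLP (plist \<mu>))"
proof -
  let ?xs = "plist \<mu>" and ?k = "m - size \<mu>"
  let ?b = "\<Prod>i\<in>set_mset \<mu>. v_fac (count \<mu> i)"
  have b: "rf_const (HLb ?xs) = (1 - rf_t) ^ size \<mu> * ?b"
    unfolding rf_const_HLb by (simp add: count_mset[symmetric])
  have b0: "?b \<noteq> 0" using v_fac_neq_0 by simp
  have "(1 - rf_t) ^ size \<mu> * lsum (map (nth_part \<mu>) [0..<m]) {..<m} = ev {..<m} (HLQ ?xs) * v_fac ?k"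
    using lsum_append_zeros[of "{..<m}" ?xs ?k] m \<mu> by (simp add: map_nth_part is_partition_def)
  also have "ev {..<m} (HLQ ?xs) = (1 - rf_t) ^ size \<mu> * ?b * ev {..<m} (HLP ?xs)"
    unfolding pconst_HLb_HLP[OF plist_in_plists[OF \<mu>], symmetric] by (simp add: ev.hom_mult b)
  finally have "(1 - rf_t) ^ size \<mu> * lsum (map (nth_part \<mu>) [0..<m]) {..<m}
      = (1 - rf_t) ^ size \<mu> * (?b * v_fac ?k * ev {..<m} (HLP ?xs))"
    by (simp add: ac_simps)
  hence "lsum (map (nth_part \<mu>) [0..<m]) {..<m} = ?b * v_fac ?k * ev {..<m} (HLP ?xs)"
    by (rule mult_left_cancel[THEN iffD1, rotated]) (use rf_t_neq_1 in auto)
  thus ?thesis using b0 v_fac_neq_0[of ?k]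
    by (simp add: HL_poly_conv_lsum v_part_def)
qed

lemma HL_P_eq:
  assumes \<mu>: "is_partition \<mu>"
  shows "HL_P \<mu> = Psi (HLP (plist \<mu>))"
  unfolding HL_P_def
proof (rule the_equality)
  have supp: "part_supp (HLP (plist \<mu>))"
    by (rule homog_part_supp[OF homog_HLP])
  thus *: "\<forall>m\<ge>size \<mu>. to_fract (sf_restrict m (Psi (HLP (plist \<mu>)))) = HL_poly m \<mu>"
    by (simp add: sf_restrict_Psi HL_poly_eq_ev[OF \<mu>])
  fix f assume "\<forall>m\<ge>size \<mu>. to_fract (sf_restrict m f) = HL_poly m \<mu>"
  with * have "\<forall>m\<ge>size \<mu>. to_fract (sf_restrict m f) = to_fract (sf_restrict m (Psi (HLP (plist \<mu>))))"
    by simp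
  thus "f = Psi (HLP (plist \<mu>))"
    by (intro sf_restrict_inj[of "size \<mu>"]) simp
qed

text \<open>Existence is the orthogonality of Q' and P. For uniqueness, a competitor is a polynomial
  in the power sums, and its difference from Q' pairs to 0 with every P.\<close>

lemma HL_Q'_eq:
  assumes \<mu>: "is_partition \<mu>"
  shows "HL_Q' \<mu> = Psi (HLQ' (plist \<mu>))"
  unfolding HL_Q'_def
proof (rule the_equality)
  have hall: "hall (Psi f) (HL_P \<nu>) = pip f (HLP (plist \<nu>))" if "part_supp f" "is_partition \<nu>" for f \<nu>
    using that by (simp add: HL_P_eq hall_Psi homog_part_supp[OF homog_HLP])
  have q: "part_supp (HLQ' (plist \<mu>))" by (rule homog_part_supp[OF homog_HLQ'])
  show *: "\<forall>\<nu>. is_partition \<nu> \<longrightarrow> hall (Psi (HLQ' (plist \<mu>))) (HL_P \<nu>) = (if \<nu> = \<mu> then 1 else 0)"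
    using q by (auto simp: hall pip_HLQ'_HLP[OF plist_in_plists[OF \<mu>] plist_in_plists] plist_inj)
  fix g assume g: "\<forall>\<nu>. is_partition \<nu> \<longrightarrow> hall g (HL_P \<nu>) = (if \<nu> = \<mu> then 1 else 0)"
  obtain f where f: "part_supp f" "Psi f = g" using Psi_surj by blast
  have "f - HLQ' (plist \<mu>) = 0"
  proof (rule pip_HLP_nondegenerate)
    show "part_supp (f - HLQ' (plist \<mu>))"
      using keys_diff[of f "HLQ' (plist \<mu>)"] f q by blast
    fix n xs assume xs: "xs \<in> plists n"
    have \<nu>: "is_partition (mset xs)" using xs by (simp add: plists_def is_partition_def)
    have "pip f (HLP xs) = hall g (HL_P (mset xs))"
      using hall[OF f(1) \<nu>] by (simp add: f plist_mset[OF xs])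
    also have "\<dots> = hall (Psi (HLQ' (plist \<mu>))) (HL_P (mset xs))"
      using g * \<nu> by simp
    also have "\<dots> = pip (HLQ' (plist \<mu>)) (HLP xs)"
      using hall[OF q \<nu>] by (simp add: plist_mset[OF xs])
    finally show "pip (f - HLQ' (plist \<mu>)) (HLP xs) = 0"
      using pip_add_left[of "f - HLQ' (plist \<mu>)" "HLQ' (plist \<mu>)" "HLP xs"] by simp
  qed
  thus "g = Psi (HLQ' (plist \<mu>))" using f by simp
qed

section \<open>Counting regular partitions\<close>

lemma finite_CP: "finite (CP r n)"
  by (rule finite_subset[OF _ finite_partitions_of[of n]]) (auto simp: CP_def)

lemma finite_RP: "finite (RP r n)"
  by (rule finite_subset[OF _ finite_partitions_of[of n]]) (auto simp: RP_def)

lemma sum_mset_repeat: "\<Sum>\<^sub># (repeat_mset r \<kappa>) = r * \<Sum>\<^sub># (\<kappa> :: nat multiset)"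
  by (induction r) (simp_all add: sum_mset.distrib)

lemma sum_mset_image_mult: "\<Sum>\<^sub># (image_mset ((*) r) \<kappa>) = r * \<Sum>\<^sub># (\<kappa> :: nat multiset)"
  by (induction \<kappa>) (simp_all add: algebra_simps)

lemma card_SIGMA_regular:
  assumes "\<And>k. finite (A k)" "r > 0"
  shows "card (SIGMA k:{k. r * k \<le> N}. A (N - r * k) \<times> partitions_of k)
    = (\<Sum>k | r * k \<le> N. card (A (N - r * k)) * card (partitions_of k))"
proof -
  have "{k. r * k \<le> N} \<subseteq> {..N}" using assms(2) by (auto intro: order.trans[rotated])
  hence "finite {k. r * k \<le> N}" by (rule finite_subset) simp
  thus ?thesis using assms by (simp add: finite_partitions_of card_cartesian_product)
qed

text \<open>The parts divisible by r, divided by r, form an arbitrary partition of k; the others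
  form an r-regular one.\<close>

lemma card_partitions_CP:
  assumes "r \<ge> 2"
  shows "card (partitions_of N) = (\<Sum>k | r * k \<le> N. card (CP r (N - r * k)) * card (partitions_of k))"
proof -
  let ?S = "SIGMA k:{k. r * k \<le> N}. CP r (N - r * k) \<times> partitions_of k"
  let ?f = "\<lambda>(k, \<rho>, \<kappa>). \<rho> + image_mset ((*) r) (\<kappa> :: nat multiset)"
  let ?g = "\<lambda>\<mu>. let \<kappa> = image_mset (\<lambda>i. i div r) (filter_mset (\<lambda>i. r dvd i) \<mu>)
    in (\<Sum>\<^sub># \<kappa>, filter_mset (\<lambda>i. \<not> r dvd i) \<mu>, \<kappa>)"
  have "bij_betw ?f ?S (partitions_of N)"
  proof (rule bij_betw_byWitness[where f' = ?g])
    show "\<forall>x\<in>?S. ?g (?f x) = x"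
    proof (clarify, goal_cases)
      case (1 k \<rho> \<kappa>)
      hence \<rho>: "filter_mset (\<lambda>i. r dvd i) \<rho> = {#}" "filter_mset (\<lambda>i. \<not> r dvd i) \<rho> = \<rho>"
        by (auto simp: CP_def multiset_eq_iff count_eq_zero_iff)
      have \<kappa>: "filter_mset (\<lambda>i. r dvd i) (image_mset ((*) r) \<kappa>) = image_mset ((*) r) \<kappa>"
        "filter_mset (\<lambda>i. \<not> r dvd i) (image_mset ((*) r) \<kappa>) = {#}"
        by (auto simp: multiset_eq_iff count_eq_zero_iff)
      have "image_mset (\<lambda>i. i div r) (image_mset ((*) r) \<kappa>) = \<kappa>"
        using assms by (simp add: image_mset.compositionality comp_def)
      thus ?case using 1 by (simp add: \<rho> \<kappa> partitions_of_def)
    qed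
    have gf: "?f (?g \<mu>) = \<mu>" for \<mu>
    proof -
      have "image_mset (\<lambda>i. r * (i div r)) (filter_mset (\<lambda>i. r dvd i) \<mu>) = image_mset (\<lambda>i. i) (filter_mset (\<lambda>i. r dvd i) \<mu>)"
        by (rule image_mset_cong) auto
      hence "image_mset ((*) r) (image_mset (\<lambda>i. i div r) (filter_mset (\<lambda>i. r dvd i) \<mu>)) = filter_mset (\<lambda>i. r dvd i) \<mu>"
        by (simp add: image_mset.compositionality comp_def)
      moreover have "\<mu> = filter_mset (\<lambda>i. r dvd i) \<mu> + filter_mset (\<lambda>i. \<not> r dvd i) \<mu>"
        by (rule multiset_partition)
      ultimately show ?thesis by (simp add: Let_def add.commute)
    qed
    thus "\<forall>\<mu>\<in>partitions_of N. ?f (?g \<mu>) = \<mu>" by blast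
    show "?f ` ?S \<subseteq> partitions_of N"
    proof (rule image_subsetI)
      fix p assume "p \<in> ?S"
      then obtain k \<rho> \<kappa> where p: "p = (k, \<rho>, \<kappa>)" "r * k \<le> N" "\<rho> \<in> CP r (N - r * k)" "\<kappa> \<in> partitions_of k"
        by auto
      have "\<Sum>\<^sub># (image_mset ((*) r) \<kappa>) = r * k"
        unfolding sum_mset_image_mult using p by (simp add: partitions_of_def)
      moreover have "\<Sum>\<^sub># \<rho> = N - r * k" using p by (simp add: CP_def partitions_of_def)
      ultimately have "\<Sum>\<^sub># (\<rho> + image_mset ((*) r) \<kappa>) = N"
        unfolding sum_mset.union using p(2) by linarith
      moreover have "0 \<notin># \<rho>" "0 \<notin># \<kappa>"
        using p by (simp_all add: CP_def partition_defs)
      hence "0 \<notin># \<rho> + image_mset ((*) r) \<kappa>" using assms by auto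
      ultimately show "?f p \<in> partitions_of N"
        unfolding p(1) prod.case partition_defs by blast
    qed
    show "?g ` partitions_of N \<subseteq> ?S"
    proof (rule image_subsetI)
      fix \<mu> assume \<mu>: "\<mu> \<in> partitions_of N"
      define \<kappa> where "\<kappa> = image_mset (\<lambda>i. i div r) (filter_mset (\<lambda>i. r dvd i) \<mu>)"
      define \<rho> where "\<rho> = filter_mset (\<lambda>i. \<not> r dvd i) \<mu>"
      have "\<rho> + image_mset ((*) r) \<kappa> = \<mu>" using gf[of \<mu>] by (simp add: Let_def \<kappa>_def \<rho>_def)
      hence "\<Sum>\<^sub># \<rho> + r * \<Sum>\<^sub># \<kappa> = \<Sum>\<^sub># \<mu>"
        by (metis sum_mset.union sum_mset_image_mult)
      moreover have "is_partition \<rho>" "is_partition \<kappa>"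
        using \<mu> assms by (auto simp: \<rho>_def \<kappa>_def partition_defs dvd_div_eq_0_iff)
      moreover have "\<forall>i\<in>#\<rho>. \<not> r dvd i" by (simp add: \<rho>_def)
      ultimately have "(\<Sum>\<^sub># \<kappa>, \<rho>, \<kappa>) \<in> ?S"
        using \<mu> by (auto simp: partitions_of_def CP_def)
      thus "?g \<mu> \<in> ?S" by (simp add: Let_def \<kappa>_def \<rho>_def)
    qed
  qed
  hence "card (partitions_of N) = card ?S" by (simp add: bij_betw_same_card)
  also have "\<dots> = (\<Sum>k | r * k \<le> N. card (CP r (N - r * k)) * card (partitions_of k))"
    using assms by (intro card_SIGMA_regular finite_CP) simp
  finally show ?thesis .
qed

lemma RP_count: "\<nu> \<in> RP r n \<Longrightarrow> r > 0 \<Longrightarrow> count \<nu> i < r"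
  by (cases "i \<in># \<nu>") (auto simp: RP_def not_in_iff)

text \<open>Multiplicities are divided by r with remainder: remainders give the \<open>RP\<close>
  partition, quotients a partition of k.\<close>

lemma card_partitions_RP:
  assumes "r \<ge> 2"
  shows "card (partitions_of N) = (\<Sum>k | r * k \<le> N. card (RP r (N - r * k)) * card (partitions_of k))"
proof -
  let ?S = "SIGMA k:{k. r * k \<le> N}. RP r (N - r * k) \<times> partitions_of k"
  let ?f = "\<lambda>(k, \<rho>, \<kappa>). \<rho> + repeat_mset r (\<kappa> :: nat multiset)"
  have "bij_betw ?f ?S (partitions_of N)"
    unfolding bij_betw_def
  proof
    show "inj_on ?f ?S"
    proof (rule inj_onI, clarify, goal_cases)
      case (1 k \<rho> \<kappa> k' \<rho>' \<kappa>')
      have "count \<rho> i = count \<rho>' i \<and> count \<kappa> i = count \<kappa>' i" for i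
      proof -
        have lt: "count \<rho> i < r" "count \<rho>' i < r" using 1 assms by (auto intro: RP_count)
        have eq: "count \<rho> i + r * count \<kappa> i = count \<rho>' i + r * count \<kappa>' i"
        proof -
          have "\<rho> + repeat_mset r \<kappa> = \<rho>' + repeat_mset r \<kappa>'" using 1 by simp
          from arg_cong[OF this, of "\<lambda>\<mu>. count \<mu> i"] show ?thesis by simp
        qed
        have "(count \<rho> i + r * count \<kappa> i) mod r = count \<rho> i" "(count \<rho>' i + r * count \<kappa>' i) mod r = count \<rho>' i"
          using lt by simp_all
        with eq have "count \<rho> i = count \<rho>' i" by simp
        with eq assms show ?thesis by simp
      qed
      hence "\<rho> = \<rho>'" "\<kappa> = \<kappa>'" by (auto simp: multiset_eq_iff)
      thus ?case using 1 by (auto simp: partitions_of_def)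
    qed
    have "\<mu> \<in> ?f ` ?S" if \<mu>: "\<mu> \<in> partitions_of N" for \<mu>
    proof -
      define \<rho> where "\<rho> = Abs_multiset (\<lambda>i. count \<mu> i mod r)"
      define \<kappa> where "\<kappa> = Abs_multiset (\<lambda>i. count \<mu> i div r)"
      have fin: "finite {i. 0 < count \<mu> i mod r}" "finite {i. 0 < count \<mu> i div r}"
      proof -
        have "{i. 0 < count \<mu> i mod r} \<subseteq> set_mset \<mu>" "{i. 0 < count \<mu> i div r} \<subseteq> set_mset \<mu>"
          by (rule subsetI, rule ccontr, simp add: not_in_iff)+
        thus "finite {i. 0 < count \<mu> i mod r}" "finite {i. 0 < count \<mu> i div r}"
          by (simp_all add: finite_subset)
      qed
      have c: "count \<rho> i = count \<mu> i mod r" "count \<kappa> i = count \<mu> i div r" for i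
        using fin by (simp_all add: \<rho>_def \<kappa>_def Abs_multiset_inverse)
      have eq: "\<rho> + repeat_mset r \<kappa> = \<mu>" by (simp add: multiset_eq_iff c)
      hence "\<Sum>\<^sub># \<rho> + r * \<Sum>\<^sub># \<kappa> = \<Sum>\<^sub># \<mu>"
        by (metis sum_mset.union sum_mset_repeat)
      moreover have "is_partition \<rho>" "is_partition \<kappa>"
        using \<mu> by (auto simp: partition_defs not_in_iff c)
      moreover have "\<forall>i\<in>#\<rho>. count \<rho> i < r" using assms by (simp add: c)
      ultimately have "(\<Sum>\<^sub># \<kappa>, \<rho>, \<kappa>) \<in> ?S"
        using \<mu> by (auto simp: partitions_of_def RP_def)
      thus ?thesis using eq by (intro image_eqI[of _ _ "(\<Sum>\<^sub># \<kappa>, \<rho>, \<kappa>)"]) auto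
    qed
    moreover have "?f ` ?S \<subseteq> partitions_of N"
    proof (rule image_subsetI)
      fix p assume "p \<in> ?S"
      then obtain k \<rho> \<kappa> where p: "p = (k, \<rho>, \<kappa>)" "r * k \<le> N" "\<rho> \<in> RP r (N - r * k)" "\<kappa> \<in> partitions_of k"
        by auto
      hence "\<Sum>\<^sub># (repeat_mset r \<kappa>) = r * k"
        unfolding sum_mset_repeat by (simp add: partitions_of_def)
      moreover have "0 \<notin># repeat_mset r \<kappa>"
        using p by (simp add: not_in_iff partition_defs)
      ultimately show "?f p \<in> partitions_of N"
        using assms p by (auto simp: RP_def partition_defs)
    qed
    ultimately show "?f ` ?S = partitions_of N" by blast
  qed
  hence "card (partitions_of N) = card ?S" by (simp add: bij_betw_same_card)
  also have "\<dots> = (\<Sum>k | r * k \<le> N. card (RP r (N - r * k)) * card (partitions_of k))"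
    using assms by (intro card_SIGMA_regular finite_RP) simp
  finally show ?thesis .
qed

text \<open>Both families satisfy the same convolution identity with the partition numbers, whose k
  = 0 term isolates the unknown. The equality is also what makes M square.\<close>

lemma glaisher:
  assumes "r \<ge> 2"
  shows "card (RP r N) = card (CP r N)"
proof (induction N rule: less_induct)
  case (less N)
  let ?K = "{k. r * k \<le> N}"
  have "?K \<subseteq> {..N}" using assms by (auto intro: order.trans[rotated])
  hence fin: "finite ?K" by (rule finite_subset) simp
  have split: "(\<Sum>k\<in>?K. card (A (N - r * k)) * card (partitions_of k))
      = card (A N) + (\<Sum>k\<in>?K - {0}. card (A (N - r * k)) * card (partitions_of k))" for A :: "nat \<Rightarrow> nat multiset set"
  proof -
    have "\<mu> = {#}" if "\<mu> \<in> partitions_of 0" for \<mu>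
      using that by (cases \<mu>) (auto simp: partition_defs)
    hence "partitions_of 0 = {{#}}"
      by (auto simp: partition_defs)
    thus ?thesis using fin by (simp add: sum.remove[of ?K 0])
  qed
  have "(\<Sum>k\<in>?K - {0}. card (RP r (N - r * k)) * card (partitions_of k))
      = (\<Sum>k\<in>?K - {0}. card (CP r (N - r * k)) * card (partitions_of k))"
  proof (rule sum.cong[OF refl])
    fix k assume k: "k \<in> ?K - {0}"
    hence "0 < r * k" "r * k \<le> N" using assms by auto
    hence "N - r * k < N" by linarith
    thus "card (RP r (N - r * k)) * card (partitions_of k) = card (CP r (N - r * k)) * card (partitions_of k)"
      by (simp only: less.IH)
  qed
  thus ?case
    using card_partitions_CP[OF assms, of N] card_partitions_RP[OF assms, of N] split[of "CP r"] split[of "RP r"]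
    by simp
qed

lemma part_times_count_le: "i * count \<rho> i \<le> \<Sum>\<^sub># (\<rho> :: nat multiset)"
proof -
  have "replicate_mset (count \<rho> i) i \<subseteq># \<rho>"
    by (simp add: count_le_replicate_mset_subset_eq[symmetric])
  then obtain \<sigma> where "\<rho> = replicate_mset (count \<rho> i) i + \<sigma>" by (metis mset_subset_eq_exists_conv)
  from arg_cong[OF this, of sum_mset] show ?thesis by (simp add: mult.commute)
qed

lemma partitions_of_add_replicate:
  "i > 0 \<Longrightarrow> \<sigma> + replicate_mset s i \<in> partitions_of n \<longleftrightarrow> i * s \<le> n \<and> \<sigma> \<in> partitions_of (n - i * s)"
  by (auto simp: partition_defs mult.commute[of s])

lemma card_remove_replicate:
  assumes A: "\<And>\<sigma>. \<sigma> + replicate_mset s i \<in> B \<longleftrightarrow> P \<and> \<sigma> \<in> A" and B: "\<And>\<rho>. \<rho> \<in> B \<Longrightarrow> s \<le> count \<rho> i"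
  shows "card B = (if P then card A else 0)"
proof -
  have "B = (\<lambda>\<sigma>. \<sigma> + replicate_mset s i) ` {\<sigma> \<in> A. P}"
  proof
    show "B \<subseteq> (\<lambda>\<sigma>. \<sigma> + replicate_mset s i) ` {\<sigma> \<in> A. P}"
    proof
      fix \<rho> assume "\<rho> \<in> B"
      moreover from this have "\<rho> = \<rho> - replicate_mset s i + replicate_mset s i"
        using B by (simp add: count_le_replicate_mset_subset_eq)
      ultimately show "\<rho> \<in> (\<lambda>\<sigma>. \<sigma> + replicate_mset s i) ` {\<sigma> \<in> A. P}"
        using A[of "\<rho> - replicate_mset s i"] by auto
    qed
  qed (auto simp: A)
  thus ?thesis by (simp add: card_image)
qed

lemma card_CP_count_ge:
  assumes "i > 0" "\<not> r dvd i"
  shows "card {\<rho> \<in> CP r n. count \<rho> i \<ge> s} = (if i * s \<le> n then card (CP r (n - i * s)) else 0)"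
proof (rule card_remove_replicate)
  fix \<sigma>
  let ?\<rho> = "\<sigma> + replicate_mset s i"
  have "?\<rho> \<in> partitions_of n \<longleftrightarrow> i * s \<le> n \<and> \<sigma> \<in> partitions_of (n - i * s)"
    by (rule partitions_of_add_replicate[OF assms(1)])
  moreover have "(\<forall>j\<in>#?\<rho>. \<not> r dvd j) \<longleftrightarrow> (\<forall>j\<in>#\<sigma>. \<not> r dvd j)"
    using assms(2) by auto
  moreover have "s \<le> count ?\<rho> i" by simp
  ultimately show "?\<rho> \<in> {\<rho> \<in> CP r n. count \<rho> i \<ge> s} \<longleftrightarrow> i * s \<le> n \<and> \<sigma> \<in> CP r (n - i * s)"
    unfolding CP_def mem_Collect_eq by blast
qed simp

lemma card_RP_count_eq:
  assumes "i > 0" "k < r"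
  shows "card {\<nu> \<in> RP r n. count \<nu> i = k} = (if i * k \<le> n then card {\<nu> \<in> RP r (n - i * k). count \<nu> i = 0} else 0)"
proof (rule card_remove_replicate)
  fix \<sigma>
  let ?\<rho> = "\<sigma> + replicate_mset k i"
  have *: "?\<rho> \<in> partitions_of n \<longleftrightarrow> i * k \<le> n \<and> \<sigma> \<in> partitions_of (n - i * k)"
    by (rule partitions_of_add_replicate[OF assms(1)])
  have e: "(\<forall>j\<in>#?\<rho>. count ?\<rho> j < r) \<longleftrightarrow> (\<forall>j\<in>#\<sigma>. count \<sigma> j < r)" if "count \<sigma> i = 0"
  proof -
    have bounded: "(\<forall>j\<in>#\<tau>. count \<tau> j < r) \<longleftrightarrow> (\<forall>j. count \<tau> j < r)" for \<tau> :: "nat multiset"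
      using assms(2) by (metis gr_implies_not0 neq0_conv not_in_iff)
    have "count ?\<rho> j < r \<longleftrightarrow> count \<sigma> j < r" for j
      using that assms(2) by (cases "j = i") simp_all
    thus ?thesis unfolding bounded by (simp only:)
  qed
  have c: "count ?\<rho> i = k \<longleftrightarrow> count \<sigma> i = 0" by simp
  show "?\<rho> \<in> {\<nu> \<in> RP r n. count \<nu> i = k} \<longleftrightarrow>
      i * k \<le> n \<and> \<sigma> \<in> {\<nu> \<in> RP r (n - i * k). count \<nu> i = 0}"
  proof (cases "count \<sigma> i = 0")
    case True
    show ?thesis unfolding RP_def mem_Collect_eq * c e[OF True] by blast
  next
    case False
    thus ?thesis unfolding mem_Collect_eq c by blast
  qed
qed simp

text \<open>The number of \<open>r\<close>-regular partitions of \<open>n - m\<close>, read as \<open>0\<close> for \<open>m > n\<close>.\<close>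

definition reg :: "nat \<Rightarrow> nat \<Rightarrow> nat \<Rightarrow> nat" where
  "reg r n m = (if m \<le> n then card (CP r (n - m)) else 0)"

lemma reg_eq_0: "m > n \<Longrightarrow> reg r n m = 0"
  by (simp add: reg_def)

text \<open>Both sides equal the sum over \<open>j \<ge> m\<close> of the number of partitions in \<open>RP r (n - i * j)\<close> without the part \<open>i\<close>.\<close>

lemma card_RP_count_ge:
  assumes r: "r \<ge> 2" and i: "i > 0" and m: "m < r"
  shows "card {\<nu> \<in> RP r n. count \<nu> i \<ge> m} + (\<Sum>l=1..n. reg r n (i * (r * l)))
    = (\<Sum>l\<le>n. reg r n (i * (m + r * l)))"
proof -
  define e where "e y = (if i * y \<le> n then card {\<nu> \<in> RP r (n - i * y). count \<nu> i = 0} else 0)" for y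
  have e0: "e y = 0" if "y > n" for y
  proof -
    have "n < i * y" using that i by (metis less_le_trans mult_le_mono1 mult_1 One_nat_def Suc_leI)
    thus ?thesis by (simp add: e_def)
  qed
  have A: "card {\<nu> \<in> RP r N. m \<le> count \<nu> i} = (\<Sum>k\<in>{m..<r}. card {\<nu> \<in> RP r N. count \<nu> i = k})" for N m
  proof -
    have "{\<nu> \<in> RP r N. m \<le> count \<nu> i} = (\<Union>k\<in>{m..<r}. {\<nu> \<in> RP r N. count \<nu> i = k})"
      using r by (auto intro!: RP_count)
    thus ?thesis by (simp only:) (rule card_UN_disjoint, auto intro: finite_subset[OF _ finite_RP])
  qed
  \<comment> \<open>Partitions are classified by the multiplicity k < r of i; as \<open>reg\<close>
    counts \<open>CP\<close>, the equality of the two counts enters here.\<close>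
  have B: "reg r n (i * y) = (\<Sum>k<r. e (y + k))" for y
  proof (cases "i * y \<le> n")
    case True
    have "card (RP r (n - i * y)) = (\<Sum>k<r. card {\<nu> \<in> RP r (n - i * y). count \<nu> i = k})"
      using A[of "n - i * y" 0] by (simp add: atLeast0LessThan)
    also have "\<dots> = (\<Sum>k<r. e (y + k))"
    proof (rule sum.cong[OF refl])
      fix k assume "k \<in> {..<r}"
      thus "card {\<nu> \<in> RP r (n - i * y). count \<nu> i = k} = e (y + k)"
        using True i by (subst card_RP_count_eq) (auto simp: e_def distrib_left)
    qed
    finally show ?thesis using True r by (simp add: reg_def glaisher)
  next
    case False
    thus ?thesis by (auto simp: reg_def e_def distrib_left)
  qed
  \<comment> \<open>The blocks of length r starting at m + r l tile everything from m on, and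
    \<open>e\<close> vanishes beyond n.\<close>
  have C: "(\<Sum>l\<le>n. reg r n (i * (m + r * l))) = (\<Sum>j\<in>{m..m + n}. e j)" for m
  proof -
    have "(\<Sum>l\<le>n. reg r n (i * (m + r * l))) = (\<Sum>l<Suc n. \<Sum>k\<in>{l * r..<l * r + r}. e (m + k))"
      unfolding lessThan_Suc_atMost
    proof (rule sum.cong[OF refl])
      fix l
      show "reg r n (i * (m + r * l)) = (\<Sum>k\<in>{l * r..<l * r + r}. e (m + k))"
        unfolding B by (rule sum.reindex_bij_witness[of _ "\<lambda>k. k - l * r" "\<lambda>k. l * r + k"]) (auto simp: algebra_simps)
    qed
    also have "\<dots> = (\<Sum>k<Suc n * r. e (m + k))" by (rule sum.nat_group)
    also have "\<dots> = (\<Sum>k\<le>n. e (m + k))"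
    proof (rule sum.mono_neutral_right)
      have "Suc n * 1 \<le> Suc n * r" by (rule mult_le_mono2) (use r in simp)
      thus "{..n} \<subseteq> {..<Suc n * r}" by auto
    qed (auto simp: e0)
    also have "\<dots> = (\<Sum>j\<in>{m..m + n}. e j)"
      by (rule sum.reindex_bij_witness[of _ "\<lambda>j. j - m" "\<lambda>k. m + k"]) auto
    finally show ?thesis .
  qed
  \<comment> \<open>The sum over l \<ge> 1 is the tiling started at r instead of m; its additional
    term l = n + 1 is 0.\<close>
  have "(\<Sum>l=1..n. reg r n (i * (r * l))) = (\<Sum>l\<le>n. reg r n (i * (r + r * l)))"
  proof -
    have "(\<Sum>l\<le>n. reg r n (i * (r + r * l))) = (\<Sum>l=1..Suc n. reg r n (i * (r * l)))"
      by (rule sum.reindex_bij_witness[of _ "\<lambda>l. l - 1" Suc]) (auto simp: algebra_simps)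
    moreover have "reg r n (i * (r * Suc n)) = 0"
    proof (rule reg_eq_0)
      have "1 * (1 * Suc n) \<le> i * (r * Suc n)" using i r by (intro mult_le_mono) auto
      thus "n < i * (r * Suc n)" by simp
    qed
    ultimately show ?thesis by simp
  qed
  also have "\<dots> = (\<Sum>j\<in>{r..r + n}. e j)" by (rule C)
  finally have 1: "(\<Sum>l=1..n. reg r n (i * (r * l))) = (\<Sum>j\<in>{r..r + n}. e j)" .
  have "card {\<nu> \<in> RP r n. count \<nu> i \<ge> m} = (\<Sum>k\<in>{m..<r}. e k)"
    unfolding A using i by (intro sum.cong refl) (simp add: card_RP_count_eq e_def)
  hence "card {\<nu> \<in> RP r n. count \<nu> i \<ge> m} + (\<Sum>l=1..n. reg r n (i * (r * l))) = (\<Sum>k\<in>{m..<r} \<union> {r..r + n}. e k)"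
    unfolding 1 by (subst sum.union_disjoint) auto
  also have "{m..<r} \<union> {r..r + n} = {m..r + n}" using m by auto
  also have "(\<Sum>k\<in>{m..r + n}. e k) = (\<Sum>k\<in>{m..m + n}. e k)"
    by (rule sum.mono_neutral_right) (use m e0 in auto)
  finally show ?thesis by (simp add: C)
qed

definition cparts :: "nat \<Rightarrow> nat \<Rightarrow> nat set" where
  "cparts r n = {i \<in> {1..n}. \<not> r dvd i}"

lemma finite_cparts [simp]: "finite (cparts r n)"
  by (simp add: cparts_def)

lemma less_power_self: "r \<ge> 2 \<Longrightarrow> k < r ^ k" for r k :: nat
  by (metis less_exp order.strict_trans2 power_mono zero_le)

text \<open>Every \<open>s \<ge> 1\<close> is uniquely \<open>r\<^sup>k j\<close> with \<open>r\<close> not dividing \<open>j\<close>, for composite \<open>r\<close> as well.\<close>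

lemma (in comm_monoid_set) r_power_decomposition:
  fixes r n :: nat
  assumes r: "r \<ge> 2" and g: "\<And>s. s > n \<Longrightarrow> g s = \<^bold>1"
  shows "F g {1..n} = F (\<lambda>j. F (\<lambda>k. g (r ^ k * j)) {..n}) (cparts r n)"
proof -
  let ?h = "\<lambda>(j, k). r ^ k * j :: nat"
  let ?S = "{(j, k). j \<in> cparts r n \<and> k \<le> n \<and> r ^ k * j \<le> n}"
  have S: "?S \<subseteq> cparts r n \<times> {..n}" by auto
  have mult: "multiplicity r (r ^ k * j) = k" if "j \<in> cparts r n" for j k
    using r that by (intro multiplicity_eqI) (auto simp: cparts_def)
  have inj: "inj_on ?h ?S"
  proof (rule inj_onI, clarify)
    fix j k j' k' assume j: "j \<in> cparts r n" "j' \<in> cparts r n" and eq: "r ^ k * j = r ^ k' * j'"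
    have "k = k'" using mult[OF j(1), of k] mult[OF j(2), of k'] eq by simp
    with eq r show "j = j' \<and> k = k'" by simp
  qed
  have img: "?h ` ?S = {1..n}"
  proof
    show "?h ` ?S \<subseteq> {1..n}" using r by (auto simp: cparts_def Suc_le_eq)
    show "{1..n} \<subseteq> ?h ` ?S"
    proof
      fix s assume s: "s \<in> {1..n}"
      then obtain j where j: "s = r ^ multiplicity r s * j" "\<not> r dvd j"
        using multiplicity_decompose'[of s r] r by auto
      let ?k = "multiplicity r s"
      have j0: "j > 0" using j(2) by (intro gr0I) auto
      have "j \<le> r ^ ?k * j" "r ^ ?k \<le> r ^ ?k * j" using r j0 by auto
      hence "j \<le> n" "?k \<le> n" using j(1) s less_power_self[OF r, of ?k] by auto
      hence "(j, ?k) \<in> ?S" using j j0 s by (auto simp: cparts_def)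
      thus "s \<in> ?h ` ?S" using j(1) by (intro image_eqI[of _ _ "(j, ?k)"]) auto
    qed
  qed
  have "F g {1..n} = F (\<lambda>p. g (?h p)) ?S"
    using reindex[OF inj, of g] by (simp add: img comp_def)
  also have "\<dots> = F (\<lambda>p. g (?h p)) (cparts r n \<times> {..n})"
    by (rule mono_neutral_left[OF _ S]) (auto intro!: g)
  also have "\<dots> = F (\<lambda>j. F (\<lambda>k. g (r ^ k * j)) {..n}) (cparts r n)"
    by (simp add: cartesian_product case_prod_unfold)
  finally show ?thesis .
qed

section \<open>Product formulas over regular partitions\<close>

text \<open>Interchanging the products: G i s occurs once for every rho with at least s copies of
  i.\<close>

lemma prod_over_parts:
  fixes G :: "nat \<Rightarrow> nat \<Rightarrow> 'a::comm_monoid_mult"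
  assumes "finite X" "finite J" "\<And>\<rho>. \<rho> \<in> X \<Longrightarrow> set_mset \<rho> \<subseteq> J" "\<And>\<rho> i. \<rho> \<in> X \<Longrightarrow> count \<rho> i \<le> K"
  shows "(\<Prod>\<rho>\<in>X. \<Prod>i\<in>set_mset \<rho>. \<Prod>s=1..count \<rho> i. G i s)
    = (\<Prod>i\<in>J. \<Prod>s=1..K. G i s ^ card {\<rho> \<in> X. count \<rho> i \<ge> s})"
proof -
  have "(\<Prod>\<rho>\<in>X. \<Prod>i\<in>set_mset \<rho>. \<Prod>s=1..count \<rho> i. G i s)
      = (\<Prod>\<rho>\<in>X. \<Prod>i\<in>J. \<Prod>s=1..K. if s \<le> count \<rho> i then G i s else 1)"
  proof (rule prod.cong[OF refl])
    fix \<rho> assume \<rho>: "\<rho> \<in> X"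
    have "(\<Prod>i\<in>set_mset \<rho>. \<Prod>s=1..count \<rho> i. G i s) = (\<Prod>i\<in>J. \<Prod>s=1..count \<rho> i. G i s)"
      using assms(3)[OF \<rho>] by (intro prod.mono_neutral_left assms(2)) (auto simp: not_in_iff)
    also have "\<dots> = (\<Prod>i\<in>J. \<Prod>s=1..K. if s \<le> count \<rho> i then G i s else 1)"
      using assms(4)[OF \<rho>] by (intro prod.cong refl prod.mono_neutral_cong_left) (auto intro: order.trans)
    finally show "(\<Prod>i\<in>set_mset \<rho>. \<Prod>s=1..count \<rho> i. G i s)
      = (\<Prod>i\<in>J. \<Prod>s=1..K. if s \<le> count \<rho> i then G i s else 1)" .
  qed
  also have "\<dots> = (\<Prod>i\<in>J. \<Prod>\<rho>\<in>X. \<Prod>s=1..K. if s \<le> count \<rho> i then G i s else 1)"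
    by (rule prod.swap)
  also have "\<dots> = (\<Prod>i\<in>J. \<Prod>s=1..K. \<Prod>\<rho>\<in>X. if s \<le> count \<rho> i then G i s else 1)"
    by (intro prod.cong refl prod.swap)
  also have "\<dots> = (\<Prod>i\<in>J. \<Prod>s=1..K. G i s ^ card {\<rho> \<in> X. count \<rho> i \<ge> s})"
    using assms(1) by (simp add: prod.If_cases Int_def)
  finally show ?thesis .
qed

lemma prod_over_CP:
  fixes G :: "nat \<Rightarrow> nat \<Rightarrow> 'a::comm_monoid_mult"
  shows "(\<Prod>\<rho>\<in>CP r n. \<Prod>i\<in>set_mset \<rho>. \<Prod>s=1..count \<rho> i. G i s)
    = (\<Prod>i\<in>cparts r n. \<Prod>s=1..n. G i s ^ reg r n (i * s))"
proof -
  have "(\<Prod>\<rho>\<in>CP r n. \<Prod>i\<in>set_mset \<rho>. \<Prod>s=1..count \<rho> i. G i s)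
    = (\<Prod>i\<in>cparts r n. \<Prod>s=1..n. G i s ^ card {\<rho> \<in> CP r n. count \<rho> i \<ge> s})"
  proof (rule prod_over_parts[OF finite_CP finite_cparts])
    fix \<rho> assume \<rho>: "\<rho> \<in> CP r n"
    have pos: "i > 0" if "i \<in># \<rho>" for i
      using that \<rho> by (auto simp: CP_def partition_defs intro!: gr0I)
    have sum: "\<Sum>\<^sub># \<rho> = n" using \<rho> by (simp add: CP_def partitions_of_def)
    show "set_mset \<rho> \<subseteq> cparts r n"
    proof
      fix i assume i: "i \<in># \<rho>"
      hence "i \<le> i * count \<rho> i" by simp
      also have "\<dots> \<le> n" using part_times_count_le[of i \<rho>] sum by simp
      finally show "i \<in> cparts r n" using i pos[OF i] \<rho> by (auto simp: cparts_def CP_def)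
    qed
    fix i
    show "count \<rho> i \<le> n"
    proof (cases "i \<in># \<rho>")
      case True
      have "count \<rho> i \<le> i * count \<rho> i" using pos[OF True] by simp
      also have "\<dots> \<le> n" using part_times_count_le[of i \<rho>] sum by simp
      finally show ?thesis .
    qed (simp add: not_in_iff)
  qed
  also have "\<dots> = (\<Prod>i\<in>cparts r n. \<Prod>s=1..n. G i s ^ reg r n (i * s))"
    by (intro prod.cong refl) (simp add: cparts_def card_CP_count_ge reg_def)
  finally show ?thesis .
qed

lemma prod_over_RP:
  fixes g :: "nat \<Rightarrow> 'a::comm_monoid_mult"
  assumes "r > 0"
  shows "(\<Prod>\<nu>\<in>RP r n. \<Prod>i\<in>set_mset \<nu>. \<Prod>k=1..count \<nu> i. g k)
    = (\<Prod>i=1..n. \<Prod>k=1..<r. g k ^ card {\<nu> \<in> RP r n. count \<nu> i \<ge> k})"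
proof -
  have "(\<Prod>\<nu>\<in>RP r n. \<Prod>i\<in>set_mset \<nu>. \<Prod>k=1..count \<nu> i. g k)
    = (\<Prod>i=1..n. \<Prod>k=1..r - 1. g k ^ card {\<nu> \<in> RP r n. count \<nu> i \<ge> k})"
  proof (rule prod_over_parts[OF finite_RP])
    fix \<nu> assume \<nu>: "\<nu> \<in> RP r n"
    show "set_mset \<nu> \<subseteq> {1..n}"
    proof
      fix i assume i: "i \<in># \<nu>"
      hence "i \<le> i * count \<nu> i" by simp
      also have "\<dots> \<le> n" using part_times_count_le[of i \<nu>] \<nu> by (simp add: RP_def partitions_of_def)
      finally have "i \<le> n" .
      moreover have "i \<noteq> 0" using i \<nu> by (intro notI) (auto simp: RP_def partition_defs)
      ultimately show "i \<in> {1..n}" by simp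
    qed
    fix i show "count \<nu> i \<le> r - 1" using RP_count[OF \<nu> assms, of i] by simp
  qed simp
  moreover have "{1..r - 1} = {1..<r}" using assms by auto
  ultimately show ?thesis by simp
qed

text \<open>Pairs (rho, i) with at least s copies of i in rho are counted in two ways; removing s
  copies leaves a partition of n - i s.\<close>

lemma W_conv_reg: "s > 0 \<Longrightarrow> W r s n = (\<Sum>i\<in>cparts r n. reg r n (i * s))"
proof -
  assume s: "s > 0"
  have "card {i. i \<ge> 1 \<and> count \<rho> i \<ge> s} = (\<Sum>i\<in>cparts r n. if count \<rho> i \<ge> s then 1 else 0)"
    if \<rho>: "\<rho> \<in> CP r n" for \<rho>
  proof -
    have "{i. i \<ge> 1 \<and> count \<rho> i \<ge> s} = {i \<in> cparts r n. count \<rho> i \<ge> s}"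
    proof (intro Collect_cong iffI)
      fix i assume i: "i \<ge> 1 \<and> count \<rho> i \<ge> s"
      hence mem: "i \<in># \<rho>" using s by (intro count_inI) auto
      hence "i \<le> i * count \<rho> i" by simp
      also have "\<dots> \<le> n" using part_times_count_le[of i \<rho>] \<rho> by (simp add: CP_def partitions_of_def)
      finally show "i \<in> cparts r n \<and> count \<rho> i \<ge> s"
        using i mem \<rho> by (auto simp: cparts_def CP_def)
    qed (auto simp: cparts_def)
    thus ?thesis by (simp add: sum.If_cases Int_def)
  qed
  hence "W r s n = (\<Sum>\<rho>\<in>CP r n. \<Sum>i\<in>cparts r n. if count \<rho> i \<ge> s then 1 else 0)"
    by (simp add: W_def)
  also have "\<dots> = (\<Sum>i\<in>cparts r n. \<Sum>\<rho>\<in>CP r n. if count \<rho> i \<ge> s then 1 else 0)"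
    by (rule sum.swap)
  also have "\<dots> = (\<Sum>i\<in>cparts r n. reg r n (i * s))"
  proof (rule sum.cong[OF refl])
    fix i assume "i \<in> cparts r n"
    thus "(\<Sum>\<rho>\<in>CP r n. if count \<rho> i \<ge> s then 1 else 0) = reg r n (i * s)"
      using card_CP_count_ge[of i r n s]
      by (simp add: sum.If_cases finite_CP Int_def cparts_def reg_def)
  qed
  finally show ?thesis .
qed

lemma reg_mult_eq_0:
  assumes "i > 0" "s > n"
  shows "reg r n (i * s) = 0"
proof (rule reg_eq_0)
  have "s \<le> i * s" using assms(1) by simp
  with assms(2) show "n < i * s" by (rule less_le_trans)
qed

lemma c_exp_conv_reg:
  assumes r: "r \<ge> 2"
  shows "c_exp r n = (\<Sum>j\<in>cparts r n. \<Sum>k\<le>n. \<Sum>i\<in>cparts r n. k * reg r n (i * (r ^ k * j)))"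
proof -
  have W0: "W r s n = 0" if "s > n" for s
  proof -
    have "reg r n (i * s) = 0" if "i \<in> cparts r n" for i
      by (rule reg_mult_eq_0[OF _ \<open>s > n\<close>]) (use that in \<open>simp add: cparts_def\<close>)
    thus ?thesis using that by (simp add: W_conv_reg)
  qed
  have inner: "Sum_any (\<lambda>k. k * W r (r ^ k * j) n) = (\<Sum>k\<le>n. k * W r (r ^ k * j) n)" if "j \<ge> 1" for j
  proof (rule Sum_any.expand_superset)
    show "{k. k * W r (r ^ k * j) n \<noteq> 0} \<subseteq> {..n}"
    proof
      fix k assume "k \<in> {k. k * W r (r ^ k * j) n \<noteq> 0}"
      hence "k * W r (r ^ k * j) n \<noteq> 0" by simp
      hence n: "r ^ k * j \<le> n" using W0 by (metis mult_0_right not_le)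
      have "k \<le> r ^ k" using less_power_self[OF r] by (rule less_imp_le)
      also have "\<dots> \<le> r ^ k * j" using that by simp
      also note n
      finally show "k \<in> {..n}" by simp
    qed
  qed simp
  have "c_exp r n = Sum_any (\<lambda>j. if j \<ge> 1 \<and> \<not> r dvd j then \<Sum>k\<le>n. k * W r (r ^ k * j) n else 0)"
    unfolding c_exp_def by (rule Sum_any.cong) (simp add: inner)
  also have "\<dots> = (\<Sum>j\<in>cparts r n. if j \<ge> 1 \<and> \<not> r dvd j then \<Sum>k\<le>n. k * W r (r ^ k * j) n else 0)"
  proof (rule Sum_any.expand_superset)
    show "{j. (if j \<ge> 1 \<and> \<not> r dvd j then \<Sum>k\<le>n. k * W r (r ^ k * j) n else 0) \<noteq> 0} \<subseteq> cparts r n"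
    proof (rule subsetI, rule ccontr)
      fix j
      assume 1: "j \<in> {j. (if j \<ge> 1 \<and> \<not> r dvd j then \<Sum>k\<le>n. k * W r (r ^ k * j) n else 0) \<noteq> 0}"
        and 2: "j \<notin> cparts r n"
      have "(if j \<ge> 1 \<and> \<not> r dvd j then \<Sum>k\<le>n. k * W r (r ^ k * j) n else 0) = 0"
      proof (cases "j \<ge> 1 \<and> \<not> r dvd j")
        case True
        hence j: "j > n" using 2 by (simp add: cparts_def)
        have "W r (r ^ k * j) n = 0" for k
        proof (rule W0)
          have "j \<le> r ^ k * j" using r by simp
          with j show "n < r ^ k * j" by (rule less_le_trans)
        qed
        thus ?thesis by simp
      next
        case False
        thus ?thesis by (simp only: if_False)
      qed
      with 1 show False by (simp only: mem_Collect_eq)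
    qed
  qed simp
  also have "\<dots> = (\<Sum>j\<in>cparts r n. \<Sum>k\<le>n. k * W r (r ^ k * j) n)"
    by (rule sum.cong) (auto simp: cparts_def)
  also have "\<dots> = (\<Sum>j\<in>cparts r n. \<Sum>k\<le>n. \<Sum>i\<in>cparts r n. k * reg r n (i * (r ^ k * j)))"
  proof (intro sum.cong refl)
    fix j k assume "j \<in> cparts r n"
    hence "r ^ k * j > 0" using r by (simp add: cparts_def)
    thus "k * W r (r ^ k * j) n = (\<Sum>i\<in>cparts r n. k * reg r n (i * (r ^ k * j)))"
      by (simp add: W_conv_reg sum_distrib_left)
  qed
  finally show ?thesis .
qed

text \<open>In the product of the m_i! each s occurs with exponent \<open>reg r n (i * s)\<close>
  for every i. Writing s = r^k j, the powers of r add up to c_{r,n}; since \<open>reg\<close> sees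
  only the product i r^k j, exchanging i and j turns what remains into the product of all
  parts.\<close>

lemma prod_mfact_CP:
  assumes r: "r \<ge> 2"
  shows "(\<Prod>\<rho>\<in>CP r n. mfact \<rho>) = r ^ c_exp r n * (\<Prod>\<rho>\<in>CP r n. \<Prod>\<^sub># \<rho>)"
proof -
  let ?I = "cparts r n"
  have pos: "i > 0" if "i \<in> ?I" for i using that by (simp add: cparts_def)
  have dec: "(\<Prod>s=1..n. g s ^ reg r n (i * s)) = (\<Prod>j\<in>?I. \<Prod>k\<le>n. g (r ^ k * j) ^ reg r n (i * (r ^ k * j)))"
    if "i \<in> ?I" for i and g :: "nat \<Rightarrow> nat"
    by (rule prod.r_power_decomposition[OF r]) (simp add: reg_mult_eq_0 pos[OF that])
  have prods: "(\<Prod>\<rho>\<in>CP r n. \<Prod>\<^sub># \<rho>) = (\<Prod>i\<in>?I. \<Prod>s=1..n. i ^ reg r n (i * s))"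
  proof -
    have "\<Prod>\<^sub># \<rho> = (\<Prod>i\<in>set_mset \<rho>. \<Prod>s=1..count \<rho> i. i)" for \<rho> :: "nat multiset"
      by (simp add: prod_mset_multiplicity)
    thus ?thesis using prod_over_CP[of "\<lambda>i s. i" r n] by simp
  qed
  have "(\<Prod>\<rho>\<in>CP r n. mfact \<rho>) = (\<Prod>i\<in>?I. \<Prod>s=1..n. s ^ reg r n (i * s))"
    using prod_over_CP[of "\<lambda>i s. s" r n] by (simp add: mfact_def fact_prod)
  also have "\<dots> = (\<Prod>i\<in>?I. \<Prod>j\<in>?I. \<Prod>k\<le>n. (r ^ k * j) ^ reg r n (i * (r ^ k * j)))"
    by (rule prod.cong[OF refl]) (rule dec)
  also have "\<dots> = (\<Prod>i\<in>?I. \<Prod>j\<in>?I. \<Prod>k\<le>n. r ^ (k * reg r n (i * (r ^ k * j))))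
      * (\<Prod>i\<in>?I. \<Prod>j\<in>?I. \<Prod>k\<le>n. j ^ reg r n (i * (r ^ k * j)))"
    by (simp add: power_mult_distrib power_mult prod.distrib)
  also have "(\<Prod>i\<in>?I. \<Prod>j\<in>?I. \<Prod>k\<le>n. r ^ (k * reg r n (i * (r ^ k * j)))) = r ^ c_exp r n"
  proof -
    have "c_exp r n = (\<Sum>j\<in>?I. \<Sum>i\<in>?I. \<Sum>k\<le>n. k * reg r n (i * (r ^ k * j)))"
      unfolding c_exp_conv_reg[OF r] by (intro sum.cong refl sum.swap)
    also have "\<dots> = (\<Sum>i\<in>?I. \<Sum>j\<in>?I. \<Sum>k\<le>n. k * reg r n (i * (r ^ k * j)))"
      by (rule sum.swap)
    finally show ?thesis by (simp add: power_sum)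
  qed
  also have "(\<Prod>i\<in>?I. \<Prod>j\<in>?I. \<Prod>k\<le>n. j ^ reg r n (i * (r ^ k * j)))
      = (\<Prod>j\<in>?I. \<Prod>i\<in>?I. \<Prod>k\<le>n. j ^ reg r n (i * (r ^ k * j)))"
    by (rule prod.swap)
  also have "\<dots> = (\<Prod>\<rho>\<in>CP r n. \<Prod>\<^sub># \<rho>)"
    unfolding prods
  proof (rule prod.cong[OF refl])
    fix j assume "j \<in> ?I"
    thus "(\<Prod>i\<in>?I. \<Prod>k\<le>n. j ^ reg r n (i * (r ^ k * j))) = (\<Prod>s=1..n. j ^ reg r n (j * s))"
      using dec[of j "\<lambda>_. j"] by (simp add: ac_simps)
  qed
  finally show ?thesis .
qed

text \<open>With s = r^p i and l = r^q j the argument is i r^{p+q+1} j, and k = p + q + 1 has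
  exactly k solutions (p, q), which is the weight k in c_{r,n}.\<close>

lemma c_exp_conv_sum:
  assumes r: "r \<ge> 2"
  shows "(\<Sum>s=1..n. \<Sum>l=1..n. reg r n (s * (r * l))) = c_exp r n"
proof -
  let ?I = "cparts r n"
  have pos: "i > 0" if "i \<in> ?I" for i using that by (simp add: cparts_def)
  have inner: "(\<Sum>l=1..n. reg r n (s * (r * l))) = (\<Sum>j\<in>?I. \<Sum>q\<le>n. reg r n (s * (r * (r ^ q * j))))"
    if "s > 0" for s
  proof (rule sum.r_power_decomposition[OF r, where g = "\<lambda>l. reg r n (s * (r * l))"])
    fix l :: nat assume "l > n"
    thus "reg r n (s * (r * l)) = 0"
      using reg_mult_eq_0[of "s * r" n l r] that r by (simp add: mult.assoc)
  qed
  have "(\<Sum>s=1..n. \<Sum>l=1..n. reg r n (s * (r * l)))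
      = (\<Sum>i\<in>?I. \<Sum>p\<le>n. \<Sum>l=1..n. reg r n (r ^ p * i * (r * l)))"
  proof (rule sum.r_power_decomposition[OF r, where g = "\<lambda>s. \<Sum>l=1..n. reg r n (s * (r * l))"])
    fix s :: nat assume "s > n"
    have "reg r n (s * (r * l)) = 0" if "l \<ge> 1" for l
      using reg_mult_eq_0[of "r * l" n s r] that r \<open>s > n\<close> by (simp add: mult.commute)
    thus "(\<Sum>l=1..n. reg r n (s * (r * l))) = 0" by simp
  qed
  also have "\<dots> = (\<Sum>i\<in>?I. \<Sum>p\<le>n. \<Sum>j\<in>?I. \<Sum>q\<le>n. reg r n (r ^ p * i * (r * (r ^ q * j))))"
    using r pos by (intro sum.cong refl inner) simp
  also have "\<dots> = (\<Sum>i\<in>?I. \<Sum>j\<in>?I. \<Sum>p\<le>n. \<Sum>q\<le>n. reg r n (r ^ p * i * (r * (r ^ q * j))))"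
    by (intro sum.cong refl sum.swap)
  also have "\<dots> = (\<Sum>i\<in>?I. \<Sum>j\<in>?I. \<Sum>k\<le>n. k * reg r n (i * (r ^ k * j)))"
  proof (rule sum.cong[OF refl], rule sum.cong[OF refl])
    fix i j assume ij: "i \<in> ?I" "j \<in> ?I"
    define h where "h k = reg r n (i * (r ^ k * j))" for k
    have h0: "h k = 0" if "k > n" for k
    proof -
      have "n < r ^ k" using less_power_self[OF r, of k] that by simp
      thus ?thesis
        using reg_mult_eq_0[of "i * j" n "r ^ k" r] pos ij by (simp add: h_def ac_simps)
    qed
    have "(\<Sum>p\<le>n. \<Sum>q\<le>n. reg r n (r ^ p * i * (r * (r ^ q * j)))) = (\<Sum>p\<le>n. \<Sum>q\<le>n. h (Suc (p + q)))"
      by (simp add: h_def power_add ac_simps)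
    also have "\<dots> = (\<Sum>m\<le>n + n. \<Sum>q\<le>m. h (Suc (m - q + q)))"
      by (rule sum_rect_triangle) (auto intro: h0)
    also have "\<dots> = (\<Sum>m\<le>n + n. Suc m * h (Suc m))" by simp
    also have "\<dots> = (\<Sum>k\<in>{1..Suc (n + n)}. k * h k)"
      by (rule sum.reindex_bij_witness[of _ "\<lambda>k. k - 1" Suc]) auto
    also have "\<dots> = (\<Sum>k\<in>{1..n}. k * h k)"
      by (rule sum.mono_neutral_right) (auto simp: h0)
    also have "\<dots> = (\<Sum>k\<le>n. k * h k)"
      by (rule sum.mono_neutral_left) auto
    finally show "(\<Sum>p\<le>n. \<Sum>q\<le>n. reg r n (r ^ p * i * (r * (r ^ q * j)))) = (\<Sum>k\<le>n. k * reg r n (i * (r ^ k * j)))"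
      by (simp add: h_def)
  qed
  also have "\<dots> = (\<Sum>j\<in>?I. \<Sum>i\<in>?I. \<Sum>k\<le>n. k * reg r n (i * (r ^ k * j)))"
    by (rule sum.swap)
  also have "\<dots> = c_exp r n"
    unfolding c_exp_conv_reg[OF r] by (intro sum.cong refl sum.swap)
  finally show ?thesis .
qed

section \<open>Products of 1 - zeta^k\<close>

lemma prod_residues:
  fixes f :: "nat \<Rightarrow> 'a::comm_monoid_mult"
  assumes r: "r \<ge> 2" and f: "\<And>i. i > n \<Longrightarrow> f i = 1"
  shows "(\<Prod>i\<in>cparts r n. f i) = (\<Prod>m=1..<r. \<Prod>l\<le>n. f (m + r * l))"
proof -
  let ?h = "\<lambda>(m, l). m + r * l"
  let ?S = "{1..<r} \<times> {..n}"
  have inj: "inj_on ?h ?S"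
  proof (rule inj_onI, clarify)
    fix m l m' l' assume m: "m \<in> {1..<r}" "m' \<in> {1..<r}" and eq: "m + r * l = m' + r * l'"
    have "(m + r * l) mod r = m" "(m' + r * l') mod r = m'" using m by simp_all
    with eq have "m = m'" by simp
    with eq r show "m = m' \<and> l = l'" by simp
  qed
  have "(\<Prod>m=1..<r. \<Prod>l\<le>n. f (m + r * l)) = (\<Prod>p\<in>?S. f (?h p))"
    by (simp add: prod.cartesian_product case_prod_unfold)
  also have "\<dots> = (\<Prod>i\<in>?h ` ?S. f i)"
    using prod.reindex[OF inj, of f] by (simp add: comp_def)
  also have "\<dots> = (\<Prod>i\<in>cparts r n. f i)"
  proof (rule prod.mono_neutral_right)
    show "cparts r n \<subseteq> ?h ` ?S"
    proof
      fix i assume i: "i \<in> cparts r n"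
      hence "i mod r \<noteq> 0" by (auto simp: cparts_def mod_eq_0_iff_dvd)
      moreover have "i div r \<le> n"
        by (rule order.trans[OF div_le_dividend]) (use i in \<open>simp add: cparts_def\<close>)
      ultimately show "i \<in> ?h ` ?S"
        using r by (intro image_eqI[of _ _ "(i mod r, i div r)"]) auto
    qed
    show "\<forall>i\<in>?h ` ?S - cparts r n. f i = 1"
    proof
      fix i assume i: "i \<in> ?h ` ?S - cparts r n"
      then obtain m l where ml: "i = m + r * l" "m \<in> {1..<r}" by auto
      hence "\<not> r dvd i" by (auto simp: dvd_add_left_iff dest: dvd_imp_le)
      hence "i > n" using i ml by (auto simp: cparts_def)
      thus "f i = 1" by (rule f)
    qed
  qed simp
  finally show ?thesis ..
qed

lemma primitive_root_power_neq_1: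
  "primitive_root r \<zeta> \<Longrightarrow> 0 < k \<Longrightarrow> k < r \<Longrightarrow> \<zeta> ^ k \<noteq> 1"
  by (simp add: primitive_root_def)

text \<open>1 + z + ... + z^{r-1} and the product of z - zeta^m over 0 < m < r are monic of degree r
  - 1 with r - 1 common roots, hence equal; z = 1 gives the claim.\<close>

lemma prod_one_minus_primitive_root:
  assumes \<zeta>: "primitive_root r \<zeta>" and r: "r \<ge> 2"
  shows "(\<Prod>m=1..<r. 1 - \<zeta> ^ m) = of_nat r"
proof -
  define A where "A = (\<Sum>i<r. monom (1::complex) i)"
  define B where "B = (\<Prod>m=1..<r. [:- (\<zeta> ^ m), 1:])"
  have z0: "\<zeta> \<noteq> 0" using \<zeta> r by (auto simp: primitive_root_def power_0_left)
  have inj: "inj_on (\<lambda>m. \<zeta> ^ m) {1..<r}"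
  proof (rule linorder_inj_onI)
    fix a b :: nat assume ab: "a < b" "a \<in> {1..<r}" "b \<in> {1..<r}"
    show "\<zeta> ^ a \<noteq> \<zeta> ^ b"
    proof
      assume "\<zeta> ^ a = \<zeta> ^ b"
      also have "\<zeta> ^ b = \<zeta> ^ a * \<zeta> ^ (b - a)" using ab by (simp add: power_add[symmetric])
      finally have "\<zeta> ^ (b - a) = 1" using z0 by simp
      moreover have "0 < b - a" "b - a < r" using ab by auto
      ultimately show False using primitive_root_power_neq_1[OF \<zeta>, of "b - a"] by simp
    qed
  qed auto
  have degA: "degree A \<le> r - 1" unfolding A_def
    by (rule degree_sum_le) (auto intro: order.trans[OF degree_monom_le])
  have coeffA: "coeff A (r - 1) = 1"
    using r by (simp add: A_def coeff_sum)
  have degB: "degree B = r - 1"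
    unfolding B_def by (subst degree_prod_eq_sum_degree) simp_all
  have "lead_coeff B = 1" unfolding B_def by (simp add: lead_coeff_prod)
  hence coeffB: "coeff B (r - 1) = 1" by (simp add: degB)
  have "A - B = 0"
  proof (rule ccontr)
    assume nz: "A - B \<noteq> 0"
    have "degree (A - B) \<le> r - 1" using degA degB by (intro degree_diff_le) auto
    moreover have "degree (A - B) \<noteq> r - 1"
      using nz coeffA coeffB by (metis coeff_diff diff_self leading_coeff_0_iff)
    ultimately have lt: "degree (A - B) < r - 1" by simp
    have "(\<lambda>m. \<zeta> ^ m) ` {1..<r} \<subseteq> {z. poly (A - B) z = 0}"
    proof clarify
      fix m assume m: "m \<in> {1..<r}"
      have "\<zeta> ^ m \<noteq> 1" using primitive_root_power_neq_1[OF \<zeta>, of m] m by auto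
      moreover have "(\<zeta> ^ m) ^ r = 1"
        using \<zeta> by (simp add: primitive_root_def power_mult[symmetric] mult.commute[of m] power_mult)
      ultimately have "poly A (\<zeta> ^ m) = 0"
        by (simp add: A_def poly_sum poly_monom geometric_sum)
      moreover have "poly B (\<zeta> ^ m) = 0"
        using m by (auto simp: B_def poly_prod intro!: prod_zero)
      ultimately show "poly (A - B) (\<zeta> ^ m) = 0" by simp
    qed
    hence "card ((\<lambda>m. \<zeta> ^ m) ` {1..<r}) \<le> card {z. poly (A - B) z = 0}"
      by (rule card_mono[OF poly_roots_finite[OF nz]])
    hence "r - 1 \<le> card {z. poly (A - B) z = 0}" unfolding card_image[OF inj] by simp
    also have "\<dots> \<le> degree (A - B)" by (rule card_poly_roots_bound[OF nz])
    finally show False using lt by simp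
  qed
  hence "poly B 1 = poly A 1" by simp
  thus ?thesis by (simp add: A_def B_def poly_prod poly_sum poly_monom)
qed

text \<open>1 - zeta^i depends on i mod r only. For each residue m, the exponent of 1 - zeta^m
  exceeds its exponent in the product over \<open>RP\<close> by c_{r,n}, whatever m is, so the
  excess is the c_{r,n}-th power of prod (1 - zeta^m) = r.\<close>

lemma prod_one_minus_CP:
  assumes \<zeta>: "primitive_root r \<zeta>" and r: "r \<ge> 2"
  shows "(\<Prod>\<rho>\<in>CP r n. \<Prod>k\<in>#\<rho>. 1 - \<zeta> ^ k)
    = of_nat r ^ c_exp r n * (\<Prod>\<nu>\<in>RP r n. \<Prod>i\<in>set_mset \<nu>. \<Prod>k=1..count \<nu> i. 1 - \<zeta> ^ k)"
proof -
  let ?g = "\<lambda>k. 1 - \<zeta> ^ k"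
  let ?A = "\<lambda>i m. card {\<nu> \<in> RP r n. count \<nu> i \<ge> m}"
  have per: "?g (m + r * l) = ?g m" for m l
    using \<zeta> by (simp add: primitive_root_def power_add power_mult)
  have "(\<Prod>k\<in>#\<rho>. ?g k) = (\<Prod>i\<in>set_mset \<rho>. \<Prod>s=1..count \<rho> i. ?g i)" for \<rho> :: "nat multiset"
  proof (induction \<rho>)
    case (add x \<rho>)
    have "(\<Prod>i\<in>set_mset (add_mset x \<rho>). ?g i ^ count (add_mset x \<rho>) i) = ?g x * (\<Prod>i\<in>set_mset \<rho>. ?g i ^ count \<rho> i)"
      by (rule prod_count_add_mset) simp_all
    with add show ?case by simp
  qed simp
  hence "(\<Prod>\<rho>\<in>CP r n. \<Prod>k\<in>#\<rho>. ?g k) = (\<Prod>i\<in>cparts r n. \<Prod>s=1..n. ?g i ^ reg r n (i * s))"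
    using prod_over_CP[of "\<lambda>i s. ?g i" r n] by simp
  also have "\<dots> = (\<Prod>m=1..<r. \<Prod>l\<le>n. \<Prod>s=1..n. ?g (m + r * l) ^ reg r n ((m + r * l) * s))"
  proof (rule prod_residues[OF r])
    fix i :: nat assume "i > n"
    hence "reg r n (i * s) = 0" if "s \<in> {1..n}" for s
      using reg_mult_eq_0[of s n i r] that by (simp add: mult.commute)
    thus "(\<Prod>s=1..n. ?g i ^ reg r n (i * s)) = 1" by simp
  qed
  also have "\<dots> = (\<Prod>m=1..<r. ?g m ^ (\<Sum>s=1..n. \<Sum>l\<le>n. reg r n (s * (m + r * l))))"
  proof (rule prod.cong[OF refl])
    fix m
    have "(\<Prod>l\<le>n. \<Prod>s=1..n. ?g (m + r * l) ^ reg r n ((m + r * l) * s))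
        = ?g m ^ (\<Sum>l\<le>n. \<Sum>s=1..n. reg r n (s * (m + r * l)))"
      unfolding per by (simp add: power_sum mult.commute)
    also have "(\<Sum>l\<le>n. \<Sum>s=1..n. reg r n (s * (m + r * l))) = (\<Sum>s=1..n. \<Sum>l\<le>n. reg r n (s * (m + r * l)))"
      by (rule sum.swap)
    finally show "(\<Prod>l\<le>n. \<Prod>s=1..n. ?g (m + r * l) ^ reg r n ((m + r * l) * s))
        = ?g m ^ (\<Sum>s=1..n. \<Sum>l\<le>n. reg r n (s * (m + r * l)))" .
  qed
  also have "\<dots> = (\<Prod>m=1..<r. ?g m ^ (\<Sum>s=1..n. ?A s m) * ?g m ^ c_exp r n)"
  proof (rule prod.cong[OF refl])
    fix m assume m: "m \<in> {1..<r}"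
    have "(\<Sum>s=1..n. \<Sum>l\<le>n. reg r n (s * (m + r * l)))
        = (\<Sum>s=1..n. ?A s m + (\<Sum>l=1..n. reg r n (s * (r * l))))"
      by (intro sum.cong refl card_RP_count_ge[symmetric]) (use r m in auto)
    also have "\<dots> = (\<Sum>s=1..n. ?A s m) + c_exp r n"
      unfolding sum.distrib c_exp_conv_sum[OF r] ..
    finally show "?g m ^ (\<Sum>s=1..n. \<Sum>l\<le>n. reg r n (s * (m + r * l))) = ?g m ^ (\<Sum>s=1..n. ?A s m) * ?g m ^ c_exp r n"
      by (simp add: power_add)
  qed
  also have "\<dots> = (\<Prod>m=1..<r. \<Prod>s=1..n. ?g m ^ ?A s m) * (\<Prod>m=1..<r. ?g m) ^ c_exp r n"
    by (simp add: prod.distrib power_sum prod_power_distrib)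
  also have "(\<Prod>m=1..<r. \<Prod>s=1..n. ?g m ^ ?A s m) = (\<Prod>s=1..n. \<Prod>m=1..<r. ?g m ^ ?A s m)"
    by (rule prod.swap)
  also have "\<dots> = (\<Prod>\<nu>\<in>RP r n. \<Prod>i\<in>set_mset \<nu>. \<Prod>k=1..count \<nu> i. ?g k)"
    using r by (intro prod_over_RP[symmetric]) simp
  also have "(\<Prod>m=1..<r. ?g m) = of_nat r"
    by (rule prod_one_minus_primitive_root[OF \<zeta> r])
  finally show ?thesis by (simp add: mult.commute)
qed

section \<open>Specialization at a root of unity\<close>

lemma mcoeff_specialize: "mcoeff (specialize \<zeta> f) \<alpha> = poly (mcoeff f \<alpha>) \<zeta>"
  by transfer simp

lemma specialize_add: "specialize \<zeta> (f + g) = specialize \<zeta> f + specialize \<zeta> g"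
  by (rule symfun_eqI) (simp add: mcoeff_specialize)

lemma specialize_0 [simp]: "specialize \<zeta> 0 = 0"
  by (rule symfun_eqI) (simp add: mcoeff_specialize)

lemma specialize_sum: "specialize \<zeta> (\<Sum>i\<in>X. f i) = (\<Sum>i\<in>X. specialize \<zeta> (f i))"
  by (induction X rule: infinite_finite_induct) (simp_all add: specialize_add)

lemma specialize_scale: "specialize \<zeta> (sf_scale c f) = sf_scale (poly c \<zeta>) (specialize \<zeta> f)"
  by (rule symfun_eqI) (simp add: mcoeff_specialize)

lemma specialize_pprod [simp]: "specialize \<zeta> (pprod \<rho>) = pprod \<rho>"
proof (induction \<rho>)
  case empty
  show ?case by (rule symfun_eqI) (simp add: mcoeff_specialize mcoeff_1)
next
  case (add k \<rho>)
  have "specialize \<zeta> (psum k * pprod \<rho>) = psum k * specialize \<zeta> (pprod \<rho>)"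
    by (rule symfun_eqI)
       (simp add: mcoeff_specialize mcoeff_mult mcoeff_psum poly_sum case_prod_unfold if_distrib[of "\<lambda>p. poly p \<zeta>"]
          cong: if_cong)
  with add show ?case by simp
qed

definition pspec :: "complex \<Rightarrow> complex poly pol \<Rightarrow> complex pol" where
  "pspec \<zeta> f = (\<Sum>\<rho>\<in>keys f. pmono \<rho> (poly (lookup f \<rho>) \<zeta>))"

lemma lookup_pspec: "lookup (pspec \<zeta> f) \<rho> = poly (lookup f \<rho>) \<zeta>"
  by (simp add: pspec_def lookup_sum lookup_single when_def sum.delta in_keys_iff)

lemma specialize_Psi: "specialize \<zeta> (Psi f) = Psi (pspec \<zeta> f)"
  by (simp add: pspec_def Psi_sum Psi_pmono) (simp add: Psi_def lin_def specialize_sum specialize_scale)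

lemma homog_pspec: "homog n f \<Longrightarrow> homog n (pspec \<zeta> f)"
  unfolding pspec_def by (intro homog_sum homog_pmono) (auto simp: homog_def)

lemma p_truncate_Psi:
  fixes f :: "complex pol"
  assumes f: "homog n f"
  shows "p_truncate r (Psi f) = (\<Sum>\<rho>\<in>CP r n. sf_scale (lookup f \<rho>) (pprod \<rho>))"
proof -
  let ?v = "\<lambda>\<mu>. \<Prod>k\<in>#\<mu>. if r dvd k then 0 else psum k :: complex symfun"
  have v: "?v \<mu> = (if \<exists>k\<in>#\<mu>. r dvd k then 0 else pprod \<mu>)" for \<mu>
    by (induction \<mu>) auto
  have "p_truncate r (Psi f) = (\<Sum>\<mu>\<in>keys f. sf_scale (lookup f \<mu>) (?v \<mu>))"
    unfolding p_truncate_def pcoeff_support[OF homog_part_supp[OF f]]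
  proof (rule sum.cong[OF refl])
    fix \<mu> assume "\<mu> \<in> keys f"
    hence "is_partition \<mu>" using homog_part_supp[OF f] by blast
    thus "sf_scale (pcoeff (Psi f) \<mu>) (?v \<mu>) = sf_scale (lookup f \<mu>) (?v \<mu>)"
      by (simp only: pcoeff_Psi[OF homog_part_supp[OF f]])
  qed
  also have "\<dots> = (\<Sum>\<mu>\<in>partitions_of n. sf_scale (lookup f \<mu>) (?v \<mu>))"
    using f by (intro sum.mono_neutral_left finite_partitions_of) (auto simp: homog_def in_keys_iff)
  also have "\<dots> = (\<Sum>\<mu>\<in>CP r n. sf_scale (lookup f \<mu>) (?v \<mu>))"
    unfolding v by (intro sum.mono_neutral_right finite_partitions_of) (auto simp: CP_def)
  also have "\<dots> = (\<Sum>\<mu>\<in>CP r n. sf_scale (lookup f \<mu>) (pprod \<mu>))"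
    unfolding v by (intro sum.cong) (auto simp: CP_def)
  finally show ?thesis .
qed

definition Q'_coeff :: "complex \<Rightarrow> nat multiset \<Rightarrow> nat multiset \<Rightarrow> complex" where
  "Q'_coeff \<zeta> \<mu> \<rho> = poly (lookup (HLQ' (plist \<mu>)) \<rho>) \<zeta>"

lemma homog_HLQ'_plist: "\<mu> \<in> partitions_of n \<Longrightarrow> homog n (HLQ' (plist \<mu>))"
  using homog_HLQ'[of "plist \<mu>"] by (simp add: partitions_of_def sum_mset_sum_list[symmetric])

lemma p_truncate_HL_Q':
  assumes "\<mu> \<in> partitions_of n"
  shows "p_truncate r (specialize \<zeta> (HL_Q' \<mu>)) = (\<Sum>\<rho>\<in>CP r n. sf_scale (Q'_coeff \<zeta> \<mu> \<rho>) (pprod \<rho>))"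
proof -
  have "is_partition \<mu>" using assms by (simp add: partitions_of_def)
  hence "specialize \<zeta> (HL_Q' \<mu>) = Psi (pspec \<zeta> (HLQ' (plist \<mu>)))"
    by (simp add: HL_Q'_eq specialize_Psi)
  thus ?thesis
    using p_truncate_Psi[OF homog_pspec[OF homog_HLQ'_plist[OF assms]]] by (simp add: lookup_pspec Q'_coeff_def)
qed

lemma lookup_phi: "lookup (phi f) \<rho> = lookup f \<rho> * (\<Prod>k\<in>#\<rho>. 1 - tvar ^ k)"
proof (induction f rule: pol_add_induct)
  case (mono \<sigma> c)
  show ?case by (auto simp: phi_pmono lookup_single when_def)
qed (simp_all add: phi.hom_add lookup_add distrib_right)

text \<open>The diagonal value is nonzero exactly when all multiplicities of mu stay below r, since
  otherwise a factor 1 - zeta^r = 0 appears; this singles out \<open>RP\<close> for the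
  rows.\<close>

lemma Q'_coeff_orthogonality:
  assumes \<zeta>: "primitive_root r \<zeta>" and \<mu>: "\<mu> \<in> partitions_of n" and \<nu>: "\<nu> \<in> partitions_of n"
  shows "(\<Sum>\<rho>\<in>CP r n. Q'_coeff \<zeta> \<mu> \<rho> * (of_nat (zee \<rho>) * (\<Prod>k\<in>#\<rho>. 1 - \<zeta> ^ k)) * Q'_coeff \<zeta> \<nu> \<rho>)
    = (if \<mu> = \<nu> then \<Prod>i\<in>set_mset \<mu>. \<Prod>k=1..count \<mu> i. 1 - \<zeta> ^ k else 0)"
proof -
  let ?f = "HLQ' (plist \<mu>)" and ?g = "HLQ' (plist \<nu>)"
  let ?d = "\<lambda>\<rho>. \<Prod>k\<in>#\<rho>. 1 - \<zeta> ^ k"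
  have poly_d: "poly (\<Prod>k\<in>#\<rho>. 1 - tvar ^ k) \<zeta> = ?d \<rho>" for \<rho>
    by (induction \<rho>) simp_all
  have d0: "?d \<rho> = 0" if "k \<in># \<rho>" "r dvd k" for k \<rho>
  proof -
    have "\<zeta> ^ k = 1" using that(2) \<zeta> by (auto simp: primitive_root_def power_mult elim!: dvdE)
    thus ?thesis using that(1) by (force simp: prod_mset_zero_iff)
  qed
  have "pip ?f (HLQ (plist \<nu>)) = (\<Sum>\<rho>\<in>partitions_of n. of_nat (zee \<rho>) * lookup ?f \<rho> * lookup (phi ?g) \<rho>)"
    unfolding pip_def HLQ_def using homog_HLQ'_plist[OF \<mu>]
    by (intro lin_superset finite_partitions_of) (auto simp: homog_def)
  hence "poly (pip ?f (HLQ (plist \<nu>))) \<zeta>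
      = (\<Sum>\<rho>\<in>partitions_of n. Q'_coeff \<zeta> \<mu> \<rho> * (of_nat (zee \<rho>) * ?d \<rho>) * Q'_coeff \<zeta> \<nu> \<rho>)"
    by (simp add: poly_sum lookup_phi poly_d Q'_coeff_def ac_simps)
  also have "\<dots> = (\<Sum>\<rho>\<in>CP r n. Q'_coeff \<zeta> \<mu> \<rho> * (of_nat (zee \<rho>) * ?d \<rho>) * Q'_coeff \<zeta> \<nu> \<rho>)"
  proof (rule sum.mono_neutral_right[OF finite_partitions_of])
    show "\<forall>\<rho>\<in>partitions_of n - CP r n. Q'_coeff \<zeta> \<mu> \<rho> * (of_nat (zee \<rho>) * ?d \<rho>) * Q'_coeff \<zeta> \<nu> \<rho> = 0"
    proof
      fix \<rho> assume "\<rho> \<in> partitions_of n - CP r n"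
      then obtain k where "k \<in># \<rho>" "r dvd k" by (auto simp: CP_def)
      hence "?d \<rho> = 0" by (rule d0)
      thus "Q'_coeff \<zeta> \<mu> \<rho> * (of_nat (zee \<rho>) * ?d \<rho>) * Q'_coeff \<zeta> \<nu> \<rho> = 0"
        by (simp only: mult_zero_right mult_zero_left)
    qed
  qed (auto simp: CP_def)
  also have "pip ?f (HLQ (plist \<nu>)) = (if \<mu> = \<nu> then HLb (plist \<mu>) else 0)"
    using \<mu> \<nu> by (simp add: pip_HLQ'_HLQ sorted_plist partition_defs plist_inj)
  also have "HLb (plist \<mu>) = (\<Prod>i\<in>set_mset \<mu>. \<Prod>k=1..count \<mu> i. 1 - tvar ^ k)"
    unfolding HLb_conv_prod by (simp add: count_mset[symmetric])
  finally show ?thesis by (simp add: poly_prod split: if_splits)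
qed

text \<open>Linear independence of the power sum products makes the coefficient matrix the only one
  meeting the description.\<close>

lemma transition_mat_eq:
  fixes us :: "complex symfun list"
  assumes "distinct cs" "set cs \<subseteq> Collect is_partition"
    and us: "\<And>i. i < length us \<Longrightarrow> us ! i = (\<Sum>\<rho>\<in>set cs. sf_scale (c i \<rho>) (pprod \<rho>))"
  shows "transition_mat us (map pprod cs) = Matrix.mat (length us) (length cs) (\<lambda>(i, j). c i (cs ! j))"
  unfolding transition_mat_def
proof (rule the_equality)
  have sum_cs: "(\<Sum>\<rho>\<in>set cs. h \<rho>) = (\<Sum>j<length cs. h (cs ! j))" for h :: "nat multiset \<Rightarrow> 'b::comm_monoid_add"
    by (rule sum.reindex_bij_betw[symmetric, OF bij_betw_nth]) (use assms in auto)
  let ?M = "Matrix.mat (length us) (length cs) (\<lambda>(i, j). c i (cs ! j))"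
  show *: "?M \<in> carrier_mat (length us) (length (map pprod cs)) \<and>
    (\<forall>i<length us. us ! i = (\<Sum>j<length (map pprod cs). sf_scale (?M $$ (i, j)) (map pprod cs ! j)))"
    by (simp add: us sum_cs)
  fix M
  assume M: "M \<in> carrier_mat (length us) (length (map pprod cs)) \<and>
    (\<forall>i<length us. us ! i = (\<Sum>j<length (map pprod cs). sf_scale (M $$ (i, j)) (map pprod cs ! j)))"
  show "M = ?M"
  proof (rule eq_matI)
    fix i j assume "i < dim_row ?M" "j < dim_col ?M"
    hence ij: "i < length us" "j < length cs" by simp_all
    let ?F = "\<lambda>c. \<Sum>j<length cs. pmono (cs ! j) (c j)"
    have supp: "part_supp (?F c)" for c :: "nat \<Rightarrow> complex"
      using Poly_Mapping.keys_sum[of "\<lambda>j. pmono (cs ! j) (c j)" "{..<length cs}"] assms(2)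
      by (fastforce split: if_splits dest: nth_mem)
    have look: "lookup (?F c) (cs ! j) = c j" for c :: "nat \<Rightarrow> complex"
    proof -
      have "lookup (?F c) (cs ! j) = (\<Sum>k<length cs. if k = j then c j else 0)"
        unfolding lookup_sum
        using assms(1) ij by (intro sum.cong) (auto simp: lookup_single when_def nth_eq_iff_index_eq)
      thus ?thesis using ij by simp
    qed
    have "Psi (?F (\<lambda>j. M $$ (i, j))) = us ! i" using M ij by (simp add: Psi_sum Psi_pmono)
    moreover have "Psi (?F (\<lambda>j. c i (cs ! j))) = us ! i" using ij by (simp add: Psi_sum Psi_pmono us sum_cs)
    ultimately have "?F (\<lambda>j. M $$ (i, j)) = ?F (\<lambda>j. c i (cs ! j))"
      by (intro Psi_inj supp) simp
    hence "M $$ (i, j) = c i (cs ! j)"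
      using look[of "\<lambda>j. M $$ (i, j)"] look[of "\<lambda>j. c i (cs ! j)"] by metis
    thus "M $$ (i, j) = ?M $$ (i, j)" using ij by simp
  qed (use M in auto)
qed

section \<open>The determinant of the transition matrix\<close>

lemma det_mat_diag: "det (mat_diag n f) = (\<Prod>i<n. f i :: 'a::comm_ring_1)"
proof -
  have "det (mat_diag n f) = prod_list (diag_mat (mat_diag n f))"
    by (rule det_upper_triangular) (auto simp: mat_diag_def)
  also have "\<dots> = (\<Prod>i<n. f i)"
    by (simp add: prod_list_diag_prod mat_diag_def atLeast0LessThan)
  finally show ?thesis .
qed

lemma prod_list_index:
  "distinct xs \<Longrightarrow> (\<Prod>i<length xs. f (xs ! i)) = (\<Prod>x\<in>set xs. f x :: 'a::comm_monoid_mult)"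
  by (rule prod.reindex_bij_betw[OF bij_betw_nth]) auto

lemma zee_conv_mfact: "zee \<rho> = \<Prod>\<^sub># \<rho> * mfact \<rho>"
  by (simp add: zee_def mfact_def prod.distrib prod_mset_multiplicity)

text \<open>The Gram matrix of the rows is diagonal, which determines the square of the determinant.\<close>

lemma det_transition_mat_square:
  assumes r: "r \<ge> 2" and \<zeta>: "primitive_root r \<zeta>"
    and rs: "distinct rs" "set rs = RP r n" and cs: "distinct cs" "set cs = CP r n"
  defines "A \<equiv> Matrix.mat (length rs) (length cs) (\<lambda>(i, j). Q'_coeff \<zeta> (rs ! i) (cs ! j))"
  shows "(det A)\<^sup>2 * (\<Prod>\<rho>\<in>CP r n. of_nat (zee \<rho>) * (\<Prod>k\<in>#\<rho>. 1 - \<zeta> ^ k))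
    = (\<Prod>\<nu>\<in>RP r n. \<Prod>i\<in>set_mset \<nu>. \<Prod>k=1..count \<nu> i. 1 - \<zeta> ^ k)"
proof -
  define N where "N = length cs"
  \<comment> \<open>Equality of the two counts makes the matrix square, so that determinants
    multiply.\<close>
  have len: "length rs = N"
    using glaisher[OF r, of n] distinct_card[OF rs(1)] distinct_card[OF cs(1)] rs cs by (simp add: N_def)
  have A: "A \<in> carrier_mat N N" by (simp add: A_def len N_def)
  let ?d = "\<lambda>\<rho>. of_nat (zee \<rho>) * (\<Prod>k\<in>#\<rho>. 1 - \<zeta> ^ k)"
  let ?b = "\<lambda>\<nu>. \<Prod>i\<in>set_mset \<nu>. \<Prod>k=1..count \<nu> i. 1 - \<zeta> ^ k"
  have RP: "rs ! i \<in> partitions_of n" if "i < N" for i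
    using that nth_mem[of i rs] rs(2) by (simp add: len RP_def)
  have sum_cs: "(\<Sum>\<rho>\<in>CP r n. h \<rho>) = (\<Sum>j<N. h (cs ! j))" for h :: "nat multiset \<Rightarrow> complex"
    unfolding N_def by (rule sum.reindex_bij_betw[symmetric, OF bij_betw_nth]) (use cs in auto)
  have "A * mat_diag N (\<lambda>j. ?d (cs ! j)) * transpose_mat A = mat_diag N (\<lambda>i. ?b (rs ! i))"
  proof (rule eq_matI)
    fix i j assume "i < dim_row (mat_diag N (\<lambda>i. ?b (rs ! i)))" "j < dim_col (mat_diag N (\<lambda>i. ?b (rs ! i)))"
    hence ij: "i < N" "j < N" by (simp_all add: mat_diag_def)
    have "(A * mat_diag N (\<lambda>j. ?d (cs ! j)) * transpose_mat A) $$ (i, j)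
        = (\<Sum>k<N. Q'_coeff \<zeta> (rs ! i) (cs ! k) * ?d (cs ! k) * Q'_coeff \<zeta> (rs ! j) (cs ! k))"
      unfolding mat_diag_mult_right[OF A] using ij
      by (simp add: scalar_prod_def A_def len N_def[symmetric] atLeast0LessThan)
    also have "\<dots> = (if rs ! i = rs ! j then ?b (rs ! i) else 0)"
      using Q'_coeff_orthogonality[OF \<zeta> RP[OF ij(1)] RP[OF ij(2)]] unfolding sum_cs .
    finally show "(A * mat_diag N (\<lambda>j. ?d (cs ! j)) * transpose_mat A) $$ (i, j) = mat_diag N (\<lambda>i. ?b (rs ! i)) $$ (i, j)"
      using ij rs(1) by (simp add: mat_diag_def len nth_eq_iff_index_eq)
  qed (use A in \<open>simp_all add: mat_diag_def\<close>)
  hence "det (mat_diag N (\<lambda>i. ?b (rs ! i))) = det (A * mat_diag N (\<lambda>j. ?d (cs ! j))) * det (transpose_mat A)"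
    using det_mult[of "A * mat_diag N (\<lambda>j. ?d (cs ! j))" N "transpose_mat A"] A by simp
  also have "\<dots> = (det A)\<^sup>2 * det (mat_diag N (\<lambda>j. ?d (cs ! j)))"
    using det_mult[OF A mat_diag_dim] det_transpose[OF A] by (simp add: power2_eq_square)
  finally have "(\<Prod>i<N. ?b (rs ! i)) = (det A)\<^sup>2 * (\<Prod>j<N. ?d (cs ! j))"
    by (simp only: det_mat_diag)
  moreover have "(\<Prod>i<N. ?b (rs ! i)) = (\<Prod>\<nu>\<in>RP r n. ?b \<nu>)"
    using prod_list_index[OF rs(1), of ?b] by (simp add: len rs(2))
  moreover have "(\<Prod>j<N. ?d (cs ! j)) = (\<Prod>\<rho>\<in>CP r n. ?d \<rho>)"
    using prod_list_index[OF cs(1), of ?d] by (simp add: N_def cs(2))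
  ultimately show ?thesis by simp
qed

theorem theorem4p10:
  fixes r n :: nat and \<zeta> :: complex
    and rs cs :: "nat multiset list"
    and M :: "complex mat"
  assumes "r \<ge> 2"
    and "primitive_root r \<zeta>"
    and "distinct rs" and "set rs = RP r n"
    and "distinct cs" and "set cs = CP r n"
    and "M = transition_mat (map (\<lambda>\<mu>. p_truncate r (specialize \<zeta> (HL_Q' \<mu>))) rs) (map pprod cs)"
  shows "det M \<in> \<real> \<and>
    (\<exists>\<epsilon>\<in>{1, -1}. det M = \<epsilon> * (1 / (of_nat r ^ c_exp r n * of_nat (\<Prod>\<rho>\<in>CP r n. \<Prod>\<^sub># \<rho>))))"
proof -
  have rs: "set rs \<subseteq> partitions_of n" using assms(4) by (auto simp: RP_def)
  have cs: "set cs \<subseteq> Collect is_partition" using assms(6) by (auto simp: CP_def partitions_of_def)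
  define R :: nat where "R = r ^ c_exp r n * (\<Prod>\<rho>\<in>CP r n. \<Prod>\<^sub># \<rho>)"
  let ?G = "\<Prod>\<nu>\<in>RP r n. \<Prod>i\<in>set_mset \<nu>. \<Prod>k=1..count \<nu> i. 1 - \<zeta> ^ k"
  have M: "M = Matrix.mat (length rs) (length cs) (\<lambda>(i, j). Q'_coeff \<zeta> (rs ! i) (cs ! j))"
    unfolding assms(7)
    by (subst transition_mat_eq[OF assms(5) cs, where c = "\<lambda>i. Q'_coeff \<zeta> (rs ! i)"])
       (use rs nth_mem in \<open>auto simp: assms(6) intro!: p_truncate_HL_Q'\<close>)
  \<comment> \<open>z_rho is the product of the parts times prod m_i!. The latter gives r^c and the
    product of parts once more, and the factors 1 - zeta^k give the second r^c.\<close>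
  have "(\<Prod>\<rho>\<in>CP r n. of_nat (zee \<rho>) * (\<Prod>k\<in>#\<rho>. 1 - \<zeta> ^ k)) = (of_nat R)\<^sup>2 * ?G"
    unfolding prod.distrib prod_one_minus_CP[OF assms(2,1)] of_nat_prod[symmetric] zee_conv_mfact
      prod_mfact_CP[OF assms(1)]
    by (simp add: R_def power2_eq_square)
  hence "(det M)\<^sup>2 * ((of_nat R)\<^sup>2 * ?G) = ?G"
    using det_transition_mat_square[OF assms(1-6)] by (simp only: M)
  moreover have "?G \<noteq> 0"
  proof -
    \<comment> \<open>In \<open>RP\<close> every such k is below r, so primitivity applies; this
      allows cancelling \<open>?G\<close>.\<close>
    have "1 - \<zeta> ^ k \<noteq> 0" if "\<nu> \<in> RP r n" "k \<in> {1..count \<nu> i}" for \<nu> i k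
      using primitive_root_power_neq_1[OF assms(2), of k] RP_count[OF that(1), of i] that(2) assms(1) by auto
    hence "(\<Prod>k=1..count \<nu> i. 1 - \<zeta> ^ k) \<noteq> 0" if "\<nu> \<in> RP r n" for \<nu> i
      using that by (subst prod_zero_iff) blast+
    hence "(\<Prod>i\<in>set_mset \<nu>. \<Prod>k=1..count \<nu> i. 1 - \<zeta> ^ k) \<noteq> 0" if "\<nu> \<in> RP r n" for \<nu>
      using that by (subst prod_zero_iff) blast+
    thus ?thesis by (subst prod_zero_iff[OF finite_RP]) blast
  qed
  ultimately have "(det M * of_nat R)\<^sup>2 = 1"
    by (simp add: power_mult_distrib)
  hence \<epsilon>: "det M * of_nat R \<in> {1, -1}"
    by (simp add: power2_eq_1_iff)
  \<comment> \<open>For R = 0 the product would be 0, which is neither 1 nor -1.\<close>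
  hence "R \<noteq> 0" by (intro notI) simp
  hence "det M = (det M * of_nat R) * (1 / of_nat R)" by simp
  with \<epsilon> obtain \<epsilon> where \<epsilon>: "\<epsilon> \<in> {1, -1}" "det M = \<epsilon> * (1 / of_nat R)" by blast
  hence "det M \<in> \<real>" by auto
  with \<epsilon> show ?thesis by (auto simp: R_def)
qed

end
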